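(* Let $q$ be a prime power (odd or even) and let $\mu$ be a partition of $2n$. The proportion of elements $h$ of $Sp(2n,q)$ which are unipotent and have $GL(2n,q)$ rational canonical form of type $\mu$ (i.e. whose Jordan block sizes are the parts of $\mu$) is $0$ unless all odd parts of $\mu$ occur with even multiplicity. If all odd parts of $\mu$ occur with even multiplicity, it is $$\frac{1}{q^{n(\mu)+n+\frac{o(\mu)}{2}}\ \prod_i (1-1/q^2)(1-1/q^4) \cdots (1-1/q^{2\lfloor m_i(\mu)/2\rfloor})}.$$
   Context: $Sp(2n,q)$ is the symplectic group of rank $n$ over the field $F_q$ with $q$ elements, viewed inside $GL(2n,q)$. For a partition $\mu$: $m_i(\mu)$ is the number of parts equal to $i$, $o(\mu)$ is the number of odd parts (with multiplicity), $\mu_i'=m_i(\mu)+m_{i+1}(\mu)+\cdots$, and $n(\mu)=\sum_i\binom{\mu_i'}2$ (not to be confused with the integer $n$). Empty products equal $1$. *)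

theory Defs
  imports "Jordan_Normal_Form.Jordan_Normal_Form" "HOL-Library.Multiset" "HOL-Library.Cardinality" Complex_Main
begin

text \<open>
  Gram matrix of the standard alternating form on column vectors of length \<open>2 * n\<close>. It has zero
  diagonal in every characteristic, so in characteristic 2 the form is still alternating.
\<close>

definition symplectic_form_mat :: "nat \<Rightarrow> 'a :: field mat" where
  "symplectic_form_mat n =
     four_block_mat (0\<^sub>m n n) (1\<^sub>m n) (- 1\<^sub>m n) (0\<^sub>m n n)"

definition symplectic_group :: "nat \<Rightarrow> 'a :: field mat set" where
  "symplectic_group n =
     {A \<in> carrier_mat (2 * n) (2 * n). invertible_mat A \<and>
        transpose_mat A * symplectic_form_mat n * A = symplectic_form_mat n}"

definition unipotent_mat :: "'a :: field mat \<Rightarrow> bool" where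
  "unipotent_mat A \<longleftrightarrow>
     square_mat A \<and>
     (\<exists>k. (A - 1\<^sub>m (dim_row A)) ^\<^sub>m k = 0\<^sub>m (dim_row A) (dim_row A))"

text \<open>
  The eigenvalues are left unconstrained here; for unipotent matrices they are all 1.
\<close>

definition has_jordan_block_sizes :: "'a :: field mat \<Rightarrow> nat multiset \<Rightarrow> bool" where
  "has_jordan_block_sizes A mu \<longleftrightarrow>
     (\<exists>n_as. jordan_nf A n_as \<and> mset (map fst n_as) = mu)"

text \<open>
  A partition is the multiset of its (positive) parts, so \<open>m\<^sub>i(\<mu>)\<close> is \<open>count mu i\<close>.
\<close>

definition is_partition_of :: "nat multiset \<Rightarrow> nat \<Rightarrow> bool" where
  "is_partition_of mu N \<longleftrightarrow> 0 \<notin># mu \<and> sum_mset mu = N"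

definition num_odd_parts :: "nat multiset \<Rightarrow> nat" where
  "num_odd_parts mu = size {#i \<in># mu. odd i#}"

text \<open>
  The restriction to \<open>j \<in># mu\<close> makes the sum \<open>m\<^sub>i + m\<^sub>i\<^sub>+\<^sub>1 + \<dots>\<close> finite; omitted terms are 0.
\<close>

definition conj_part :: "nat multiset \<Rightarrow> nat \<Rightarrow> nat" where
  "conj_part mu i = (\<Sum>j | j \<in># mu \<and> i \<le> j. count mu j)"

text \<open>
  \<open>n(\<mu>)\<close>: every part is at most \<open>sum_mset mu\<close>, so \<open>conj_part mu i = 0\<close> beyond the upper limit.
\<close>

definition partition_n :: "nat multiset \<Rightarrow> nat" where
  "partition_n mu = (\<Sum>i = 1..sum_mset mu. conj_part mu i choose 2)"

end

theory Submission
  imports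
    Defs
    "Jordan_Normal_Form.Jordan_Normal_Form_Existence"
    "Jordan_Normal_Form.Jordan_Normal_Form_Uniqueness"
begin

text \<open>
  Let \<open>J\<close> be the alternating form. Following Wall, write a unipotent isometry as \<open>h = 1 + Z J\<close>; then \<open>h\<close>
  is an isometry iff \<open>Z - Z\<^sup>T = Z J Z\<^sup>T\<close>, an equation that makes sense for degenerate \<open>J\<close> and behaves
  uniformly in all characteristics. The Jordan type is the rank sequence of \<open>(Z J)\<^sup>i\<close>, and the type is
  reduced by two columns at a time.

  First, \<open>Z = W Y W\<^sup>T\<close> with \<open>W\<close> injective and \<open>Y\<close> invertible, uniquely up to \<open>GL\<^sub>k\<close>, and \<open>Y\<close> solves the same
  equation for the Gram matrix \<open>W\<^sup>T J W\<close>, usually degenerate. The matrices \<open>W\<close> with a Gram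
  matrix of given rank are counted by adding one column at a time.

  Second, a degenerate alternating form is a nondegenerate one bordered by zeros. Passing to a bordered
  solution \<open>[[t, q], [p, Y]]\<close>, \<open>t\<close> and \<open>q\<close> are free and determine \<open>p\<close>, and the corank moves by \<open>-1\<close>,
  \<open>0\<close> or \<open>1\<close> according to whether \<open>q\<close> lies in the range of \<open>Y\<^sup>T\<close> and to one further scalar condition.
  This Markov chain has closed-form hitting probabilities of corank \<open>0\<close>, and leads back to the
  original problem for a form of smaller dimension.
\<close>

text \<open>The obstacle is that \<open>Y\<close> must be nonsingular while its form
  \<open>W\<^sup>T * J * W\<close> may be degenerate, so nonsingular solutions alone do not recurse.
  What recurses is the count of all solutions of a given type for a nondegenerate form: there the
  type fixes the corank of a solution, and the number of its nonsingular extensions depends on the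
  corank only. Each round produces exactly the factors of the parts 1 and 2. Let \<open>k\<close>
  and \<open>e\<close> be the ranks of \<open>h - 1\<close> and \<open>(h - 1)^2\<close>. The Gram
  matrix has size \<open>k\<close> and rank \<open>e\<close>, and \<open>2n + e = 2k + m_1\<close>.
  Alternating forms have even rank, so \<open>m_1\<close> is even; this is the only source of the
  parity condition, larger odd parts being reached in later rounds. The distribution of Gram ranks
  gives the factor of \<open>m_1\<close>. The radical has dimension \<open>r = k - e\<close>, the
  second column length, and the probability of reaching corank 0 from \<open>\<kappa>\<close> in
  \<open>r\<close> steps gives the factor of \<open>m_2 = r - \<kappa>\<close>, with the floor of
  \<open>m_2 / 2\<close>. Dividing by the order of the symplectic group turns the recursion into a
  product.\<close>

subsection \<open>Linear algebra over finite fields by counting\<close>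

text \<open>As conditional rewrite rules, \<open>carrier_vecD\<close> and \<open>carrier_dim_vec\<close> loop together.\<close>

declare carrier_vecD [simp del] carrier_dim_vec [simp]

lemma mat_assoc:
  fixes A B C :: "'a :: comm_semiring_1 mat"
  assumes "dim_col A = dim_row B" "dim_col B = dim_row C"
  shows "A * B * C = A * (B * C)"
  using assms by (intro assoc_mult_mat) auto

lemma mat_vec_assoc:
  fixes A B :: "'a :: comm_semiring_1 mat"
  assumes "dim_col A = dim_row B" "dim_vec v = dim_col B"
  shows "A * B *\<^sub>v v = A *\<^sub>v (B *\<^sub>v v)"
  using assms by (intro assoc_mult_mat_vec[of _ "dim_row A" "dim_col A" _ "dim_col B"]) auto

lemma transpose_mult':
  fixes A B :: "'a :: comm_semiring_1 mat"
  assumes "dim_col A = dim_row B"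
  shows "(A * B)\<^sup>T = B\<^sup>T * A\<^sup>T"
  using assms by (intro transpose_mult) auto

lemma mult_mat_vec_zero [simp]:
  fixes A :: "'a :: comm_semiring_1 mat"
  shows "dim_col A = n \<Longrightarrow> A *\<^sub>v 0\<^sub>v n = 0\<^sub>v (dim_row A)"
  by (intro eq_vecI) auto

lemma zero_mult_mat_vec [simp]:
  "dim_vec v = m \<Longrightarrow> 0\<^sub>m n m *\<^sub>v v = (0\<^sub>v n :: 'a :: comm_semiring_1 vec)"
  by (intro eq_vecI) (auto intro!: scalar_prod_left_zero)

lemma mult_mat_vec_add:
  fixes A :: "'a :: comm_ring_1 mat"
  assumes "dim_vec v = dim_col A" "dim_vec w = dim_col A"
  shows "A *\<^sub>v (v + w) = A *\<^sub>v v + A *\<^sub>v w"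
  using assms by (intro mult_add_distrib_mat_vec[of _ "dim_row A" "dim_col A"]) auto

lemma mult_mat_vec_minus:
  fixes A :: "'a :: comm_ring_1 mat"
  assumes "dim_vec v = dim_col A" "dim_vec w = dim_col A"
  shows "A *\<^sub>v (v - w) = A *\<^sub>v v - A *\<^sub>v w"
  using assms by (intro mult_minus_distrib_mat_vec[of _ "dim_row A" "dim_col A"]) auto

lemma mult_mat_vec_smult:
  fixes A :: "'a :: field mat"
  assumes "dim_vec v = dim_col A"
  shows "A *\<^sub>v (k \<cdot>\<^sub>v v) = k \<cdot>\<^sub>v (A *\<^sub>v v)"
  using assms by (intro mult_mat_vec[of _ "dim_row A" "dim_col A"]) auto

lemma transpose_scalar_prod:
  fixes A :: "'a :: comm_ring_1 mat"
  assumes "dim_vec x = dim_col A" "dim_vec y = dim_row A"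
  shows "(A\<^sup>T *\<^sub>v y) \<bullet> x = y \<bullet> (A *\<^sub>v x)"
  using assms by (intro transpose_vec_mult_scalar[of _ "dim_row A" "dim_col A"]) auto

lemma scalar_prod_commute:
  fixes v w :: "'a :: comm_ring_1 vec"
  shows "dim_vec v = dim_vec w \<Longrightarrow> v \<bullet> w = w \<bullet> v"
  by (rule comm_scalar_prod[of _ "dim_vec v"]) auto

lemma mult_unit_vec:
  fixes A :: "'a :: comm_ring_1 mat"
  assumes "i < dim_col A" "dim_col A = n"
  shows "A *\<^sub>v unit_vec n i = col A i"
  using assms by (intro eq_vecI) auto

text \<open>Bordered matrices act simply on vectors \<open>vCons a v\<close>, so matrix identities
  are mostly checked below on vectors rather than on entries.\<close>

lemma eq_mat_by_vec:
  fixes A B :: "'a :: comm_ring_1 mat"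
  assumes "dim_row A = dim_row B" "dim_col A = dim_col B"
    and "\<And>v. dim_vec v = dim_col B \<Longrightarrow> A *\<^sub>v v = B *\<^sub>v v"
  shows "A = B"
proof (rule mat_col_eqI)
  fix i assume i: "i < dim_col B"
  have "A *\<^sub>v unit_vec (dim_col B) i = B *\<^sub>v unit_vec (dim_col B) i"
    by (rule assms(3)) simp
  then show "col A i = col B i"
    using i assms(2) by (simp add: mult_unit_vec)
qed (use assms in auto)

lemma mult_mat_of_cols:
  fixes A :: "'a :: comm_ring_1 mat"
  assumes "\<And>i. i < m \<Longrightarrow> dim_vec (f i) = dim_col A" "\<And>i. i < m \<Longrightarrow> A *\<^sub>v f i = col B i"
    "dim_row A = dim_row B" "dim_col B = m"
  shows "A * mat (dim_col A) m (\<lambda>(i, j). f j $ i) = B"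
proof (rule mat_col_eqI)
  fix i assume i: "i < dim_col B"
  have "col (mat (dim_col A) m (\<lambda>(i, j). f j $ i)) i = f i"
    using i assms by (intro eq_vecI) auto
  moreover have "col (A * mat (dim_col A) m (\<lambda>(i, j). f j $ i)) i =
      A *\<^sub>v col (mat (dim_col A) m (\<lambda>(i, j). f j $ i)) i"
    using i assms(4) by (intro col_mult2[of A "dim_row A" "dim_col A" _ m]) simp_all
  ultimately show "col (A * mat (dim_col A) m (\<lambda>(i, j). f j $ i)) i = col B i"
    using i assms(2,4) by simp
qed (use assms in auto)

section \<open>Counting vectors and matrices\<close>

lemma bij_betw_vCons:
  "bij_betw (\<lambda>(a, v). vCons a v) (UNIV \<times> carrier_vec n) (carrier_vec (Suc n))"
proof (rule bij_betwI')
  fix y :: "'a vec" assume "y \<in> carrier_vec (Suc n)"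
  then obtain a v where "y = vCons a v" "v \<in> carrier_vec n"
    by (cases y) auto
  then show "\<exists>x\<in>UNIV \<times> carrier_vec n. y = (case x of (a, v) \<Rightarrow> vCons a v)"
    by (intro bexI[of _ "(a, v)"]) auto
qed auto

lemma card_carrier_vec: "card (carrier_vec n :: 'a :: finite vec set) = CARD('a) ^ n"
proof (induction n)
  case 0
  have "(carrier_vec 0 :: 'a vec set) = {vNil}"
    by auto
  then show ?case by simp
next
  case (Suc n)
  show ?case
    using bij_betw_same_card[OF bij_betw_vCons[of n, where 'a = 'a]] Suc
    by (simp add: card_cartesian_product)
qed

lemma finite_carrier_vec [simp]: "finite (carrier_vec n :: 'a :: finite vec set)"
  by (rule card_ge_0_finite) (simp add: card_carrier_vec)

lemma finite_carrier_mat [simp]: "finite (carrier_mat n m :: 'a :: finite mat set)"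
proof (rule finite_subset)
  let ?I = "{..<n} \<times> {..<m}"
  show "carrier_mat n m \<subseteq> mat n m ` (?I \<rightarrow>\<^sub>E (UNIV :: 'a set))"
  proof
    fix A :: "'a mat" assume A: "A \<in> carrier_mat n m"
    have "A = mat n m (restrict (index_mat A) ?I)"
      using A by (intro eq_matI) auto
    then show "A \<in> mat n m ` (?I \<rightarrow>\<^sub>E UNIV)"
      by (rule image_eqI[of A "mat n m" "restrict (index_mat A) ?I"]) simp
  qed
  show "finite (mat n m ` (?I \<rightarrow>\<^sub>E (UNIV :: 'a set)))"
    by (intro finite_imageI finite_PiE) auto
qed

section \<open>Ranges, kernels and rank-nullity\<close>

definition mat_range :: "'a :: comm_ring_1 mat \<Rightarrow> 'a vec set" where
  "mat_range A = (\<lambda>v. A *\<^sub>v v) ` carrier_vec (dim_col A)"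

definition inj_mat :: "'a :: comm_ring_1 mat \<Rightarrow> bool" where
  "inj_mat A \<longleftrightarrow> mat_kernel A = {0\<^sub>v (dim_col A)}"

definition surj_mat :: "'a :: comm_ring_1 mat \<Rightarrow> bool" where
  "surj_mat A \<longleftrightarrow> mat_range A = carrier_vec (dim_row A)"

lemma mem_mat_kernel: "v \<in> mat_kernel A \<longleftrightarrow> dim_vec v = dim_col A \<and> A *\<^sub>v v = 0\<^sub>v (dim_row A)"
  by (auto simp: mat_kernel_def )

lemma mem_mat_range: "w \<in> mat_range A \<longleftrightarrow> (\<exists>v. dim_vec v = dim_col A \<and> w = A *\<^sub>v v)"
  by (auto simp: mat_range_def )

lemma mat_range_carrier: "mat_range A \<subseteq> carrier_vec (dim_row A)"
  by (auto simp: mat_range_def )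

lemma mat_rangeI: "dim_vec v = dim_col A \<Longrightarrow> A *\<^sub>v v \<in> mat_range A"
  by (auto simp: mem_mat_range)

lemma finite_mat_kernel [simp]: "finite (mat_kernel (A :: 'a :: {comm_ring_1, finite} mat))"
  by (rule finite_subset[of _ "carrier_vec (dim_col A)"]) (auto simp: mat_kernel_def)

lemma finite_mat_range [simp]: "finite (mat_range (A :: 'a :: {comm_ring_1, finite} mat))"
  by (simp add: mat_range_def)

lemma zero_mem_mat_kernel [simp]: "0\<^sub>v (dim_col A) \<in> mat_kernel A"
  by (simp add: mem_mat_kernel)

lemma inj_matD: "inj_mat A \<Longrightarrow> dim_vec v = dim_col A \<Longrightarrow> A *\<^sub>v v = 0\<^sub>v (dim_row A) \<Longrightarrow> v = 0\<^sub>v (dim_col A)"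
  using mem_mat_kernel[of v A] by (simp add: inj_mat_def)

lemma inj_matI:
  "(\<And>v. dim_vec v = dim_col A \<Longrightarrow> A *\<^sub>v v = 0\<^sub>v (dim_row A) \<Longrightarrow> v = 0\<^sub>v (dim_col A)) \<Longrightarrow> inj_mat A"
  using mem_mat_kernel[of _ A] zero_mem_mat_kernel[of A] unfolding inj_mat_def by blast

lemma surj_matD: "surj_mat A \<Longrightarrow> dim_vec w = dim_row A \<Longrightarrow> \<exists>v. dim_vec v = dim_col A \<and> A *\<^sub>v v = w"
  by (metis carrier_vecI mem_mat_range surj_mat_def)

lemma surj_matI:
  "(\<And>w. dim_vec w = dim_row A \<Longrightarrow> \<exists>v. dim_vec v = dim_col A \<and> A *\<^sub>v v = w) \<Longrightarrow> surj_mat A"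
  using mat_range_carrier by (fastforce simp: surj_mat_def mem_mat_range )

lemma inj_mat_cancel:
  fixes A :: "'a :: comm_ring_1 mat"
  assumes "inj_mat A" "dim_vec v = dim_col A" "dim_vec w = dim_col A" "A *\<^sub>v v = A *\<^sub>v w"
  shows "v = w"
proof -
  have "A *\<^sub>v (v - w) = 0\<^sub>v (dim_row A)"
    using assms by (auto simp: mult_mat_vec_minus)
  then have "v - w = 0\<^sub>v (dim_col A)"
    using assms by (intro inj_matD) auto
  then show ?thesis
    using assms by (metis carrier_vec_dim_vec eq_vecI index_minus_vec(1) index_zero_vec(1) right_minus_eq)
qed

lemma inj_mat_mult:
  fixes A B :: "'a :: comm_ring_1 mat"
  assumes "inj_mat A" "inj_mat B" "dim_col A = dim_row B"
  shows "inj_mat (A * B)"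
proof (rule inj_matI)
  fix v :: "'a vec" assume v: "dim_vec v = dim_col (A * B)" "A * B *\<^sub>v v = 0\<^sub>v (dim_row (A * B))"
  then have "B *\<^sub>v v = 0\<^sub>v (dim_row B)"
    using assms inj_matD[OF assms(1), of "B *\<^sub>v v"] by (auto simp: mat_vec_assoc)
  then show "v = 0\<^sub>v (dim_col (A * B))"
    using v inj_matD[OF assms(2), of v] by auto
qed

lemma surj_mat_mult:
  fixes A B :: "'a :: comm_ring_1 mat"
  assumes "surj_mat A" "surj_mat B" "dim_col A = dim_row B"
  shows "surj_mat (A * B)"
proof (rule surj_matI)
  fix w :: "'a vec" assume "dim_vec w = dim_row (A * B)"
  then obtain v where v: "dim_vec v = dim_col A" "A *\<^sub>v v = w"
    using surj_matD[OF assms(1), of w] by auto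
  then obtain u where "dim_vec u = dim_col B" "B *\<^sub>v u = v"
    using surj_matD[OF assms(2), of v] assms(3) by auto
  then show "\<exists>v. dim_vec v = dim_col (A * B) \<and> A * B *\<^sub>v v = w"
    using v assms(3) by (intro exI[of _ u]) (simp add: mat_vec_assoc)
qed

lemma surj_mat_right_inverse:
  fixes A :: "'a :: comm_ring_1 mat"
  assumes "surj_mat A"
  shows "\<exists>B \<in> carrier_mat (dim_col A) (dim_row A). A * B = 1\<^sub>m (dim_row A)"
proof -
  have "\<exists>v. dim_vec v = dim_col A \<and> A *\<^sub>v v = unit_vec (dim_row A) i" for i
    by (rule surj_matD[OF assms]) simp
  then obtain f where f: "dim_vec (f i) = dim_col A" "A *\<^sub>v f i = unit_vec (dim_row A) i" for i
    by metis
  then have "A * mat (dim_col A) (dim_row A) (\<lambda>(i, j). f j $ i) = 1\<^sub>m (dim_row A)"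
    by (intro mult_mat_of_cols) auto
  then show ?thesis by (intro bexI) auto
qed

lemma left_inverse_inj_mat:
  fixes A :: "'a :: comm_ring_1 mat"
  assumes "B * A = 1\<^sub>m (dim_col A)" "dim_col B = dim_row A"
  shows "inj_mat A"
proof (rule inj_matI)
  fix v :: "'a vec" assume v: "dim_vec v = dim_col A" "A *\<^sub>v v = 0\<^sub>v (dim_row A)"
  have dim: "dim_row B = dim_col A"
    using assms(1) by (metis index_mult_mat(2) index_one_mat(2))
  have "v = B * A *\<^sub>v v"
    unfolding assms(1) using v by simp
  also have "\<dots> = 0\<^sub>v (dim_row B)"
    using v assms(2) by (simp add: mat_vec_assoc)
  finally show "v = 0\<^sub>v (dim_col A)"
    using dim by simp
qed

lemma card_kernel_translate:
  fixes A :: "'a :: {comm_ring_1, finite} mat"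
  assumes "w \<in> mat_range A"
  shows "card {v \<in> carrier_vec (dim_col A). A *\<^sub>v v = w} = card (mat_kernel A)"
proof -
  obtain u where u: "dim_vec u = dim_col A" "w = A *\<^sub>v u"
    using assms by (auto simp: mem_mat_range)
  have "bij_betw (\<lambda>v. u + v) (mat_kernel A) {v \<in> carrier_vec (dim_col A). A *\<^sub>v v = w}"
  proof (rule bij_betwI[of _ _ _ "\<lambda>v. v - u"])
    show "(\<lambda>v. u + v) \<in> mat_kernel A \<rightarrow> {v \<in> carrier_vec (dim_col A). A *\<^sub>v v = w}"
      using u by (auto simp: mem_mat_kernel mult_mat_vec_add)
    show "(\<lambda>v. v - u) \<in> {v \<in> carrier_vec (dim_col A). A *\<^sub>v v = w} \<rightarrow> mat_kernel A"
      using u by (auto simp: mem_mat_kernel mult_mat_vec_minus)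
  qed (use u in \<open>auto simp: mem_mat_kernel \<close>)
  then show ?thesis by (simp add: bij_betw_same_card)
qed

text \<open>The fibres over the points of \<open>S\<close> are cosets of the kernel, hence all of
  the same size.\<close>

lemma card_preimage_mat:
  fixes A :: "'a :: {comm_ring_1, finite} mat"
  assumes "S \<subseteq> mat_range A"
  shows "card {v \<in> carrier_vec (dim_col A). A *\<^sub>v v \<in> S} = card S * card (mat_kernel A)"
proof -
  have fin: "finite S" using assms finite_mat_range by (rule finite_subset)
  have "{v \<in> carrier_vec (dim_col A). A *\<^sub>v v \<in> S} =
      (\<Union>w\<in>S. {v \<in> carrier_vec (dim_col A). A *\<^sub>v v = w})"
    by auto
  also have "card \<dots> = (\<Sum>w\<in>S. card {v \<in> carrier_vec (dim_col A). A *\<^sub>v v = w})"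
    using fin by (rule card_UN_disjoint) (blast intro: finite_subset[OF _ finite_carrier_vec])+
  also have "\<dots> = (\<Sum>w\<in>S. card (mat_kernel A))"
    using assms by (intro sum.cong refl card_kernel_translate) auto
  finally show ?thesis by simp
qed

text \<open>Rank-nullity in terms of cardinalities; over a finite field this carries the dimension
  theory used below.\<close>

lemma card_range_kernel:
  fixes A :: "'a :: {comm_ring_1, finite} mat"
  shows "card (mat_range A) * card (mat_kernel A) = CARD('a) ^ dim_col A"
proof -
  have "{v \<in> carrier_vec (dim_col A). A *\<^sub>v v \<in> mat_range A} = carrier_vec (dim_col A)"
    by (auto simp: mat_range_def)
  then show ?thesis
    using card_preimage_mat[of "mat_range A" A] by (simp add: card_carrier_vec)
qed

lemma inj_mat_iff_card: "inj_mat (A :: 'a :: {comm_ring_1, finite} mat) \<longleftrightarrow> card (mat_kernel A) = 1"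
proof
  assume "card (mat_kernel A) = 1"
  then obtain x where "mat_kernel A = {x}" by (auto simp: card_1_singleton_iff)
  then show "inj_mat A"
    unfolding inj_mat_def using zero_mem_mat_kernel[of A] by auto
qed (simp add: inj_mat_def)

lemma surj_mat_iff_card:
  "surj_mat (A :: 'a :: {comm_ring_1, finite} mat) \<longleftrightarrow> card (mat_range A) = CARD('a) ^ dim_row A"
  unfolding surj_mat_def
  using card_subset_eq[OF _ mat_range_carrier[of A]] by (auto simp: card_carrier_vec)

text \<open>For a square matrix the product in \<open>card_range_kernel\<close> is the size of the
  target space, so the kernel has one element exactly when the range is everything.\<close>

lemma inj_iff_surj_square:
  fixes A :: "'a :: {comm_ring_1, finite} mat"
  assumes "dim_row A = dim_col A"
  shows "inj_mat A \<longleftrightarrow> surj_mat A"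
  using card_range_kernel[of A] assms zero_less_card_finite[where 'a = 'a]
  by (auto simp: inj_mat_iff_card surj_mat_iff_card)

lemma one_less_card_field: "1 < CARD('a :: {field, finite})"
proof -
  have "card {0, 1 :: 'a} \<le> CARD('a)" by (rule card_mono) auto
  then show ?thesis by simp
qed

lemma inj_mat_dim_le:
  fixes A :: "'a :: {field, finite} mat"
  assumes "inj_mat A"
  shows "dim_col A \<le> dim_row A"
proof -
  have "CARD('a) ^ dim_col A = card (mat_range A)"
    using card_range_kernel[of A] assms by (simp add: inj_mat_iff_card)
  also have "\<dots> \<le> CARD('a) ^ dim_row A"
    unfolding card_carrier_vec[symmetric] using mat_range_carrier by (intro card_mono) auto
  finally show ?thesis
    using one_less_card_field[where 'a = 'a] by (simp add: power_increasing_iff)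
qed

section \<open>Prepending columns and bordering\<close>

definition add_col :: "'a vec \<Rightarrow> 'a mat \<Rightarrow> 'a mat" where
  "add_col w W = mat (dim_row W) (Suc (dim_col W))
     (\<lambda>(i, j). case j of 0 \<Rightarrow> w $ i | Suc k \<Rightarrow> W $$ (i, k))"

text \<open>The block matrix with corner \<open>t\<close>, top row \<open>q\<close>, left column
  \<open>p\<close> and remaining block \<open>Y\<close>. New rows and columns come first, to match
  \<open>vCons\<close> on vectors.\<close>

definition border_mat :: "'a \<Rightarrow> 'a vec \<Rightarrow> 'a vec \<Rightarrow> 'a mat \<Rightarrow> 'a mat" where
  "border_mat t q p Y =
     add_col (vCons t p) ((add_col q (Y\<^sup>T))\<^sup>T)"

lemma dim_add_col [simp]:
  "dim_row (add_col w W) = dim_row W" "dim_col (add_col w W) = Suc (dim_col W)"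
  by (simp_all add: add_col_def)

lemma dim_border_mat [simp]:
  "dim_row (border_mat t q p Y) = Suc (dim_row Y)" "dim_col (border_mat t q p Y) = Suc (dim_col Y)"
  by (simp_all add: border_mat_def)

lemma row_add_col: "i < dim_row W \<Longrightarrow> row (add_col w W) i = vCons (w $ i) (row W i)"
  by (intro eq_vecI) (auto simp: add_col_def vec_index_vCons split: nat.splits)

lemma col_add_col:
  assumes "dim_vec w = dim_row W"
  shows "col (add_col w W) 0 = w" "j < dim_col W \<Longrightarrow> col (add_col w W) (Suc j) = col W j"
  using assms by (auto simp: add_col_def intro!: eq_vecI)

lemma add_col_mult_vCons:
  fixes W :: "'a :: comm_ring_1 mat"
  assumes "dim_vec w = dim_row W" "dim_vec v = dim_col W"
  shows "add_col w W *\<^sub>v vCons a v = a \<cdot>\<^sub>v w + W *\<^sub>v v"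
  using assms by (intro eq_vecI) (auto simp: row_add_col mult.commute)

lemma transpose_add_col_mult:
  fixes W :: "'a :: comm_ring_1 mat"
  assumes "dim_vec w = dim_row W" "dim_vec y = dim_row W"
  shows "(add_col w W)\<^sup>T *\<^sub>v y = vCons (w \<bullet> y) (W\<^sup>T *\<^sub>v y)"
proof (rule eq_vecI)
  fix i assume "i < dim_vec (vCons (w \<bullet> y) (W\<^sup>T *\<^sub>v y))"
  then show "((add_col w W)\<^sup>T *\<^sub>v y) $ i = vCons (w \<bullet> y) (W\<^sup>T *\<^sub>v y) $ i"
    using assms by (cases i) (auto simp: col_add_col)
qed auto

lemma border_mat_mult_vCons:
  fixes Y :: "'a :: comm_ring_1 mat"
  assumes "dim_vec p = dim_row Y" "dim_vec q = dim_col Y" "dim_vec v = dim_col Y"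
  shows "border_mat t q p Y *\<^sub>v vCons a v = vCons (t * a + q \<bullet> v) (a \<cdot>\<^sub>v p + Y *\<^sub>v v)"
proof -
  have "border_mat t q p Y *\<^sub>v vCons a v = a \<cdot>\<^sub>v vCons t p + vCons (q \<bullet> v) (Y *\<^sub>v v)"
    using assms unfolding border_mat_def
    by (subst add_col_mult_vCons) (auto simp: transpose_add_col_mult)
  also have "\<dots> = vCons (t * a + q \<bullet> v) (a \<cdot>\<^sub>v p + Y *\<^sub>v v)"
    using assms by (intro eq_vecI) (auto simp: vec_index_vCons mult.commute)
  finally show ?thesis .
qed

lemma transpose_border_mat:
  assumes "dim_vec p = dim_row Y" "dim_vec q = dim_col Y"
  shows "(border_mat t q p Y)\<^sup>T = border_mat t p q (Y\<^sup>T)"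
  using assms by (intro eq_matI)
    (auto simp: border_mat_def add_col_def vec_index_vCons split: nat.splits)

lemma ex_vCons: "dim_vec v = Suc n \<Longrightarrow> \<exists>a w. v = vCons a w \<and> dim_vec w = n"
  by (cases v) auto

lemma bij_betw_add_col:
  "bij_betw (\<lambda>(w, W). add_col w W) (carrier_vec n \<times> carrier_mat n k) (carrier_mat n (Suc k))"
proof (rule bij_betw_byWitness[where f' = "\<lambda>A. (col A 0, mat n k (\<lambda>(i, j). A $$ (i, Suc j)))"])
  show "\<forall>a\<in>carrier_vec n \<times> carrier_mat n k.
      (col ((\<lambda>(w, W). add_col w W) a) 0,
       mat n k (\<lambda>(i, j). (\<lambda>(w, W). add_col w W) a $$ (i, Suc j))) = a"
    by (auto simp: col_add_col ) (auto simp: add_col_def)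
qed (auto simp: add_col_def split: nat.splits)

lemma ex_add_col:
  assumes "A \<in> carrier_mat n (Suc k)"
  shows "\<exists>w W. A = add_col w W \<and> w \<in> carrier_vec n \<and> W \<in> carrier_mat n k"
proof -
  have "A \<in> (\<lambda>(w, W). add_col w W) ` (carrier_vec n \<times> carrier_mat n k)"
    unfolding bij_betw_imp_surj_on[OF bij_betw_add_col] by (rule assms)
  then show ?thesis by (elim imageE SigmaE) auto
qed

text \<open>A kernel vector with nonzero leading entry expresses \<open>w\<close> through the
  columns of \<open>W\<close>; one with leading entry 0 is a kernel vector of \<open>W\<close>. This
  is the inductive step whenever injective matrices are built column by column.\<close>

lemma inj_mat_add_col_iff:
  fixes W :: "'a :: field mat"
  assumes w: "dim_vec w = dim_row W"
  shows "inj_mat (add_col w W) \<longleftrightarrow> inj_mat W \<and> w \<notin> mat_range W"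
proof safe
  assume inj: "inj_mat (add_col w W)"
  show "inj_mat W"
  proof (rule inj_matI)
    fix v :: "'a vec" assume v: "dim_vec v = dim_col W" "W *\<^sub>v v = 0\<^sub>v (dim_row W)"
    have "vCons 0 v = 0\<^sub>v (dim_col (add_col w W))"
      by (rule inj_matD[OF inj]) (use v w in \<open>auto simp: add_col_mult_vCons\<close>)
    then show "v = 0\<^sub>v (dim_col W)" by (simp add: zero_vec_Suc)
  qed
  assume "w \<in> mat_range W"
  then obtain v where v: "dim_vec v = dim_col W" "w = W *\<^sub>v v" by (auto simp: mem_mat_range)
  have "vCons (-1) v = 0\<^sub>v (dim_col (add_col w W))"
    by (rule inj_matD[OF inj]) (use v w in \<open>auto simp: add_col_mult_vCons\<close>)
  then show False by (simp add: zero_vec_Suc)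
next
  assume inj: "inj_mat W" and notin: "w \<notin> mat_range W"
  show "inj_mat (add_col w W)"
  proof (rule inj_matI)
    fix u :: "'a vec" assume u: "dim_vec u = dim_col (add_col w W)" "add_col w W *\<^sub>v u = 0\<^sub>v (dim_row (add_col w W))"
    then obtain a v where av: "u = vCons a v" "dim_vec v = dim_col W"
      using ex_vCons[of u "dim_col W"] by auto
    have eq: "a \<cdot>\<^sub>v w + W *\<^sub>v v = 0\<^sub>v (dim_row W)"
      using u av w by (simp add: add_col_mult_vCons)
    have "a = 0"
    proof (rule ccontr)
      assume a: "a \<noteq> 0"
      have "W *\<^sub>v ((- inverse a) \<cdot>\<^sub>v v) = w"
      proof (rule eq_vecI)
        fix i assume "i < dim_vec w"
        then have "a * w $ i + (W *\<^sub>v v) $ i = 0"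
          using arg_cong[OF eq, of "\<lambda>x. x $ i"] w by simp
        then have "(W *\<^sub>v v) $ i = - (a * w $ i)" by (simp add: eq_neg_iff_add_eq_0 add.commute)
        then show "(W *\<^sub>v ((- inverse a) \<cdot>\<^sub>v v)) $ i = w $ i"
          using a av w \<open>i < dim_vec w\<close> by (subst mult_mat_vec_smult) auto
      qed (use w in auto)
      then show False
        using notin av mat_rangeI[of "(- inverse a) \<cdot>\<^sub>v v" W] by auto
    qed
    moreover have "W *\<^sub>v v = 0\<^sub>v (dim_row W)"
    proof (rule eq_vecI)
      fix i assume "i < dim_vec (0\<^sub>v (dim_row W) :: 'a vec)"
      then show "(W *\<^sub>v v) $ i = 0\<^sub>v (dim_row W) $ i"
        using arg_cong[OF eq, of "\<lambda>x. x $ i"] w \<open>a = 0\<close> by simp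
    qed simp
    then have "v = 0\<^sub>v (dim_col W)"
      using av by (intro inj_matD[OF inj])
    ultimately show "u = 0\<^sub>v (dim_col (add_col w W))"
      using av by (simp add: zero_vec_Suc)
  qed
qed

text \<open>Induction on the columns. A column in the range of \<open>L\<close> only adds its
  coordinates to \<open>R\<close>; any other column is added to \<open>L\<close> as a new basis
  vector of the range.\<close>

lemma rank_factorization:
  fixes A :: "'a :: field mat"
  assumes "A \<in> carrier_mat n m"
  shows "\<exists>r. \<exists>L \<in> carrier_mat n r. \<exists>R \<in> carrier_mat r m. inj_mat L \<and> surj_mat R \<and> A = L * R"
  using assms
proof (induction m arbitrary: A)
  case 0
  have "inj_mat A" "surj_mat (0\<^sub>m 0 0 :: 'a mat)"
    using 0 by (auto intro!: inj_matI surj_matI)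
  then show ?case
    using 0 by (intro exI[of _ 0] bexI[of _ A] bexI[of _ "0\<^sub>m 0 0"]) auto
next
  case (Suc m)
  obtain c A' where A: "A = add_col c A'" "c \<in> carrier_vec n" "A' \<in> carrier_mat n m"
    using ex_add_col[OF Suc.prems] by (elim exE conjE)
  obtain r L R where LR: "L \<in> carrier_mat n r" "R \<in> carrier_mat r m" "inj_mat L" "surj_mat R" "A' = L * R"
    using Suc.IH[OF A(3)] by blast
  note dims = A(2,3) LR(1,2)
  show ?case
  proof (cases "c \<in> mat_range L")
    case True
    then obtain d where d: "dim_vec d = r" "c = L *\<^sub>v d"
      using dims by (auto simp: mem_mat_range)
    have "A = L * add_col d R"
    proof (rule eq_mat_by_vec)
      fix v :: "'a vec" assume "dim_vec v = dim_col (L * add_col d R)"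
      then obtain a u where "v = vCons a u" "dim_vec u = m"
        using ex_vCons[of v m] dims by auto
      then show "A *\<^sub>v v = L * add_col d R *\<^sub>v v"
        using d dims LR(5) A(1)
        by (simp add: mat_vec_assoc add_col_mult_vCons mult_mat_vec_add mult_mat_vec_smult)
    qed (use dims A in auto)
    moreover have "surj_mat (add_col d R)"
    proof (rule surj_matI)
      fix w :: "'a vec" assume "dim_vec w = dim_row (add_col d R)"
      then obtain v where "dim_vec v = dim_col R" "R *\<^sub>v v = w"
        using surj_matD[OF LR(4)] by auto
      then show "\<exists>v. dim_vec v = dim_col (add_col d R) \<and> add_col d R *\<^sub>v v = w"
        using d dims by (intro exI[of _ "vCons 0 v"]) (auto simp: add_col_mult_vCons)
    qed
    ultimately show ?thesis
      using LR(1,3) dims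
      by (intro exI[of _ r] bexI[of _ L] bexI[of _ "add_col d R"]) auto
  next
    case False
    \<comment> \<open>The new column is its own coordinate, so \<open>R\<close> grows by a diagonal
      entry 1.\<close>
    let ?R = "border_mat 1 (0\<^sub>v m) (0\<^sub>v r) R"
    have mult: "?R *\<^sub>v vCons a v = vCons a (R *\<^sub>v v)" if "dim_vec v = m" for a v
      using dims that by (subst border_mat_mult_vCons) (auto simp: scalar_prod_left_zero )
    have "A = add_col c L * ?R"
    proof (rule eq_mat_by_vec)
      fix v :: "'a vec" assume "dim_vec v = dim_col (add_col c L * ?R)"
      then obtain a u where "v = vCons a u" "dim_vec u = m"
        using ex_vCons[of v m] dims by auto
      then show "A *\<^sub>v v = add_col c L * ?R *\<^sub>v v"
        using dims LR(5) A(1) by (simp add: mat_vec_assoc add_col_mult_vCons mult)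
    qed (use dims A in auto)
    moreover have "surj_mat ?R"
    proof (rule surj_matI)
      fix w :: "'a vec" assume "dim_vec w = dim_row ?R"
      then obtain b u where "w = vCons b u" "dim_vec u = dim_row R"
        using ex_vCons[of w r] dims by auto
      moreover obtain v where "dim_vec v = dim_col R" "R *\<^sub>v v = u"
        using surj_matD[OF LR(4)] calculation by auto
      ultimately show "\<exists>v. dim_vec v = dim_col ?R \<and> ?R *\<^sub>v v = w"
        using dims by (intro exI[of _ "vCons b v"]) (auto simp: mult)
    qed
    moreover have "inj_mat (add_col c L)"
      using LR(3) False dims by (subst inj_mat_add_col_iff) auto
    ultimately show ?thesis
      using dims by (intro exI[of _ "Suc r"] bexI[of _ "add_col c L"] bexI[of _ ?R]) auto
  qed
qed

section \<open>Transposition, one-sided inverses and square matrices\<close>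

lemma surj_mat_transpose_inj:
  fixes R :: "'a :: comm_ring_1 mat"
  assumes "surj_mat R"
  shows "inj_mat (R\<^sup>T)"
proof -
  obtain B where B: "B \<in> carrier_mat (dim_col R) (dim_row R)" "R * B = 1\<^sub>m (dim_row R)"
    using surj_mat_right_inverse[OF assms] by blast
  then have "B\<^sup>T * R\<^sup>T = 1\<^sub>m (dim_row R)"
    using arg_cong[OF B(2), of transpose_mat] transpose_mult'[of R B] B(1) by simp
  then show ?thesis
    using B by (intro left_inverse_inj_mat[of "B\<^sup>T"]) auto
qed

text \<open>In a rank factorization \<open>L\<^sup>T = L1 * R1\<close>, injectivity of
  \<open>L = R1\<^sup>T * L1\<^sup>T\<close> passes to \<open>L1\<^sup>T\<close>. As
  \<open>L1\<close> and \<open>L1\<^sup>T\<close> are both injective, \<open>L1\<close> is square,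
  hence surjective, and \<open>L\<^sup>T\<close> is a product of surjections.\<close>

lemma inj_mat_transpose_surj:
  fixes L :: "'a :: {field, finite} mat"
  assumes inj: "inj_mat L"
  shows "surj_mat (L\<^sup>T)"
proof -
  obtain n m where nm: "L \<in> carrier_mat n m" by blast
  then obtain s L1 R1 where *: "L1 \<in> carrier_mat m s" "R1 \<in> carrier_mat s n"
    "inj_mat L1" "surj_mat R1" "L\<^sup>T = L1 * R1"
    using rank_factorization[of "L\<^sup>T" m n] by auto
  have L: "L = R1\<^sup>T * L1\<^sup>T"
    using arg_cong[OF *(5), of transpose_mat] *(1,2) by (simp add: transpose_mult')
  have "inj_mat (L1\<^sup>T)"
  proof (rule inj_matI)
    fix v :: "'a vec" assume v: "dim_vec v = dim_col (L1\<^sup>T)"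
      "L1\<^sup>T *\<^sub>v v = 0\<^sub>v (dim_row (L1\<^sup>T))"
    have "L *\<^sub>v v = 0\<^sub>v n"
      using v *(1,2) by (subst L) (simp add: mat_vec_assoc)
    then show "v = 0\<^sub>v (dim_col (L1\<^sup>T))"
      using v *(1) nm inj_matD[OF inj, of v] by auto
  qed
  then have "s = m"
    using inj_mat_dim_le[of "L1\<^sup>T"] inj_mat_dim_le[of L1] *(1,3) by auto
  then have "surj_mat L1"
    using *(1,3) inj_iff_surj_square[of L1] by auto
  then show ?thesis
    unfolding *(5) using *(1,2,4) by (intro surj_mat_mult) auto
qed

lemma inj_mat_transpose_iff:
  fixes A :: "'a :: {field, finite} mat"
  shows "inj_mat (A\<^sup>T) \<longleftrightarrow> surj_mat A"
  using inj_mat_transpose_surj[of "A\<^sup>T"] surj_mat_transpose_inj[of A] by auto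

lemma surj_mat_transpose_iff:
  fixes A :: "'a :: {field, finite} mat"
  shows "surj_mat (A\<^sup>T) \<longleftrightarrow> inj_mat A"
  using inj_mat_transpose_surj[of A] surj_mat_transpose_inj[of "A\<^sup>T"] by auto

lemma inj_mat_left_inverse:
  fixes A :: "'a :: {field, finite} mat"
  assumes "inj_mat A"
  shows "\<exists>B \<in> carrier_mat (dim_col A) (dim_row A). B * A = 1\<^sub>m (dim_col A)"
proof -
  obtain B where B: "B \<in> carrier_mat (dim_row A) (dim_col A)" "A\<^sup>T * B = 1\<^sub>m (dim_col A)"
    using surj_mat_right_inverse[OF inj_mat_transpose_surj[OF assms]] by auto
  then have "B\<^sup>T * A = 1\<^sub>m (dim_col A)"
    using arg_cong[OF B(2), of transpose_mat] transpose_mult'[of "A\<^sup>T" B] B(1) by simp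
  then show ?thesis
    using B by (intro bexI[of _ "B\<^sup>T"]) auto
qed

lemma square_inj_mat_inverse:
  fixes A :: "'a :: {field, finite} mat"
  assumes "inj_mat A" "A \<in> carrier_mat n n"
  shows "\<exists>B \<in> carrier_mat n n. B * A = 1\<^sub>m n \<and> A * B = 1\<^sub>m n \<and> inj_mat B"
proof -
  obtain B where B: "B \<in> carrier_mat n n" "B * A = 1\<^sub>m n"
    using inj_mat_left_inverse[OF assms(1)] assms(2) by auto
  moreover have "A * B = 1\<^sub>m n"
    using mat_mult_left_right_inverse[OF B(1) assms(2) B(2)] .
  moreover have "inj_mat B"
    using B assms(2) calculation by (intro left_inverse_inj_mat[of A]) auto
  ultimately show ?thesis by blast
qed

lemma inj_mat_transpose_square:
  fixes A :: "'a :: {field, finite} mat"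
  assumes "dim_row A = dim_col A"
  shows "inj_mat (A\<^sup>T) \<longleftrightarrow> inj_mat A"
  using assms by (simp add: inj_mat_transpose_iff inj_iff_surj_square)

section \<open>The rank of a matrix\<close>

definition mrank :: "'a :: {field, finite} mat \<Rightarrow> nat" where
  "mrank A = (THE r. card (mat_range A) = CARD('a) ^ r)"

lemma mat_range_mult_surj:
  fixes A B :: "'a :: comm_ring_1 mat"
  assumes "surj_mat B" "dim_col A = dim_row B"
  shows "mat_range (A * B) = mat_range A"
proof (intro equalityI subsetI)
  fix w :: "'a vec" assume "w \<in> mat_range (A * B)"
  then obtain v where "dim_vec v = dim_col B" "w = A *\<^sub>v (B *\<^sub>v v)"
    using assms(2) by (auto simp: mem_mat_range mat_vec_assoc)
  then show "w \<in> mat_range A"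
    using assms(2) by (simp add: mat_rangeI)
next
  fix w :: "'a vec" assume "w \<in> mat_range A"
  then obtain v where v: "dim_vec v = dim_col A" "w = A *\<^sub>v v" by (auto simp: mem_mat_range)
  obtain u where u: "dim_vec u = dim_col B" "B *\<^sub>v u = v"
    using surj_matD[OF assms(1), of v] v assms(2) by auto
  then show "w \<in> mat_range (A * B)"
    using v assms by (auto simp: mem_mat_range mat_vec_assoc intro!: exI[of _ u])
qed

lemma card_mat_range_mult_inj:
  fixes A B :: "'a :: comm_ring_1 mat"
  assumes "inj_mat A" "dim_col A = dim_row B"
  shows "card (mat_range (A * B)) = card (mat_range B)"
proof -
  have "mat_range (A * B) = (\<lambda>v. A *\<^sub>v v) ` mat_range B"
    unfolding mat_range_def image_image
    using assms(2) by (intro image_cong) (auto simp: mat_vec_assoc)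
  moreover have "inj_on (\<lambda>v. A *\<^sub>v v) (mat_range B)"
    using assms mat_range_carrier[of B]
    by (auto intro!: inj_onI inj_mat_cancel[OF assms(1)] simp: subset_iff)
  ultimately show ?thesis by (simp add: card_image)
qed

text \<open>By rank factorization the range is that of an injective matrix, so its size is a power
  of the field size; this is what makes the \<open>THE\<close> in \<open>mrank\<close>
  meaningful.\<close>

lemma card_mat_range: "card (mat_range A) = CARD('a) ^ mrank (A :: 'a :: {field, finite} mat)"
proof -
  obtain n m where nm: "A \<in> carrier_mat n m" by blast
  obtain r L R where *: "L \<in> carrier_mat n r" "R \<in> carrier_mat r m"
    "inj_mat L" "surj_mat R" "A = L * R"
    using rank_factorization[OF nm] by auto
  have "card (mat_range A) = card (mat_range L)"
    unfolding *(5) using *(1,2,4) mat_range_mult_surj[of R L] by auto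
  also have "\<dots> = CARD('a) ^ r"
    using card_range_kernel[of L] *(1,3) by (simp add: inj_mat_iff_card)
  finally have r: "card (mat_range A) = CARD('a) ^ r" .
  show ?thesis
    unfolding mrank_def
    by (rule theI[of _ r]) (use r one_less_card_field[where 'a = 'a] in auto)
qed

lemma mrank_eqI:
  fixes A B :: "'a :: {field, finite} mat"
  shows "card (mat_range A) = card (mat_range B) \<Longrightarrow> mrank A = mrank B"
  by (simp add: mrank_def)

lemma mrank_mult_surj:
  fixes A B :: "'a :: {field, finite} mat"
  shows "surj_mat B \<Longrightarrow> dim_col A = dim_row B \<Longrightarrow> mrank (A * B) = mrank A"
  by (intro mrank_eqI) (simp add: mat_range_mult_surj)

lemma mrank_mult_inj:
  fixes A B :: "'a :: {field, finite} mat"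
  shows "inj_mat A \<Longrightarrow> dim_col A = dim_row B \<Longrightarrow> mrank (A * B) = mrank B"
  by (intro mrank_eqI card_mat_range_mult_inj)

lemma mrank_le_dim_col: "mrank (A :: 'a :: {field, finite} mat) \<le> dim_col A"
proof -
  have "card (mat_range A) \<le> card (carrier_vec (dim_col A) :: 'a vec set)"
    unfolding mat_range_def by (intro card_image_le) auto
  then have "CARD('a) ^ mrank A \<le> CARD('a) ^ dim_col A"
    by (simp add: card_mat_range card_carrier_vec)
  then show ?thesis using one_less_card_field[where 'a = 'a] by simp
qed

lemma card_mat_kernel:
  "card (mat_kernel A) = CARD('a) ^ (dim_col A - mrank (A :: 'a :: {field, finite} mat))"
proof -
  have "CARD('a) ^ mrank A * card (mat_kernel A) = CARD('a) ^ mrank A * CARD('a) ^ (dim_col A - mrank A)"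
    using card_range_kernel[of A] mrank_le_dim_col[of A]
    by (simp add: card_mat_range flip: power_add)
  then show ?thesis using one_less_card_field[where 'a = 'a] by simp
qed

lemma inj_mat_iff_mrank: "inj_mat (A :: 'a :: {field, finite} mat) \<longleftrightarrow> mrank A = dim_col A"
  using one_less_card_field[where 'a = 'a] mrank_le_dim_col[of A]
  by (auto simp: inj_mat_iff_card card_mat_kernel)

lemma surj_mat_iff_mrank: "surj_mat (A :: 'a :: {field, finite} mat) \<longleftrightarrow> mrank A = dim_row A"
  using one_less_card_field[where 'a = 'a]
  by (auto simp: surj_mat_iff_card card_mat_range)

text \<open>Transposing a rank factorization yields a rank factorization with the same inner
  dimension.\<close>

lemma mrank_transpose: "mrank (A\<^sup>T) = mrank (A :: 'a :: {field, finite} mat)"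
proof -
  obtain n m where nm: "A \<in> carrier_mat n m" by blast
  obtain r L R where *: "L \<in> carrier_mat n r" "R \<in> carrier_mat r m"
    "inj_mat L" "surj_mat R" "A = L * R"
    using rank_factorization[OF nm] by auto
  have "mrank A = r"
    unfolding *(5) using *(1-4) by (simp add: mrank_mult_surj) (simp add: inj_mat_iff_mrank)
  moreover have "mrank (R\<^sup>T * L\<^sup>T) = r"
    using *(1-4) inj_mat_transpose_surj[OF *(3)] surj_mat_transpose_inj[OF *(4)]
    by (simp add: mrank_mult_surj) (simp add: inj_mat_iff_mrank)
  ultimately show ?thesis
    using * by (simp add: transpose_mult')
qed

text \<open>Duality: a functional that vanishes on the range and is 1 at \<open>c\<close>. If
  \<open>M = L * R\<close> with \<open>L\<close> injective, prepending \<open>c\<close> to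
  \<open>L\<close> keeps it injective, so the transpose is onto and the first basis vector has a
  preimage.\<close>

lemma not_in_range_witness:
  fixes M :: "'a :: {field, finite} mat"
  assumes "c \<notin> mat_range M" "dim_vec c = dim_row M"
  shows "\<exists>v. v \<in> mat_kernel (M\<^sup>T) \<and> c \<bullet> v = 1"
proof -
  obtain n m where nm: "M \<in> carrier_mat n m" by blast
  obtain r L R where *: "L \<in> carrier_mat n r" "R \<in> carrier_mat r m"
    "inj_mat L" "surj_mat R" "M = L * R"
    using rank_factorization[OF nm] by auto
  have c: "dim_vec c = n" using assms(2) nm by simp
  have "mat_range M = mat_range L"
    using * mat_range_mult_surj[of R L] by simp
  then have "inj_mat (add_col c L)"
    using *(1,3) assms(1) c by (subst inj_mat_add_col_iff) auto
  then obtain v where v: "dim_vec v = dim_row L" "(add_col c L)\<^sup>T *\<^sub>v v = vCons 1 (0\<^sub>v r)"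
    using surj_matD[OF inj_mat_transpose_surj, of "add_col c L" "vCons 1 (0\<^sub>v r)"] *(1,2) by auto
  then have "c \<bullet> v = 1" "L\<^sup>T *\<^sub>v v = 0\<^sub>v r"
    using *(1) c by (auto simp: transpose_add_col_mult)
  moreover from this have "M\<^sup>T *\<^sub>v v = 0\<^sub>v m"
    using * v(1) by (simp add: transpose_mult' mat_vec_assoc)
  ultimately show ?thesis
    using v(1) *(1) nm by (intro exI[of _ v]) (simp add: mem_mat_kernel)
qed

text \<open>Completes a nonzero vector to a basis. For \<open>u\<close> with
  \<open>v \<bullet> u = 1\<close>, the matrix \<open>P\<close> is the projection along
  \<open>v\<close> onto the kernel of \<open>u\<close>, and the injective factor of \<open>P\<close>
  supplies the other basis vectors.\<close>

lemma extend_to_inj_mat: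
  fixes v :: "'a :: {field, finite} vec"
  assumes "dim_vec v = Suc n" "v \<noteq> 0\<^sub>v (Suc n)"
  shows "\<exists>L \<in> carrier_mat (Suc n) n. inj_mat (add_col v L)"
proof -
  \<comment> \<open>The empty matrix has zero range, so duality applied to it produces
    \<open>u\<close>.\<close>
  let ?V = "0\<^sub>m (Suc n) 0 :: 'a mat"
  have "v \<notin> mat_range ?V"
    using assms by (auto simp: mem_mat_range)
  then obtain u where u: "dim_vec u = Suc n" "v \<bullet> u = 1"
    using not_in_range_witness[of v ?V] assms by (auto simp: mem_mat_kernel)
  define P where "P = mat (Suc n) (Suc n) (\<lambda>(i, j). (if i = j then 1 else 0) - v $ i * u $ j)"
  have P: "P *\<^sub>v x = x - (u \<bullet> x) \<cdot>\<^sub>v v" if "dim_vec x = Suc n" for x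
  proof (rule eq_vecI)
    fix i assume "i < dim_vec (x - (u \<bullet> x) \<cdot>\<^sub>v v)"
    then have i: "i < Suc n" using assms by simp
    have "(P *\<^sub>v x) $ i = (\<Sum>j = 0..<Suc n. ((if i = j then 1 else 0) - v $ i * u $ j) * x $ j)"
      using i that by (simp add: P_def scalar_prod_def)
    also have "\<dots> = (\<Sum>j = 0..<Suc n. (if i = j then x $ j else 0)) - (\<Sum>j = 0..<Suc n. v $ i * (u $ j * x $ j))"
      unfolding sum_subtractf[symmetric] by (intro sum.cong) (auto simp: algebra_simps)
    also have "\<dots> = x $ i - v $ i * (u \<bullet> x)"
      using i that by (subst sum_distrib_left[symmetric]) (simp add: scalar_prod_def)
    finally show "(P *\<^sub>v x) $ i = (x - (u \<bullet> x) \<cdot>\<^sub>v v) $ i"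
      using i assms that by (simp add: mult.commute)
  qed (use assms in \<open>auto simp: P_def\<close>)
  have Pdim: "P \<in> carrier_mat (Suc n) (Suc n)" by (simp add: P_def)
  obtain r L R where *: "L \<in> carrier_mat (Suc n) r" "R \<in> carrier_mat r (Suc n)"
    "inj_mat L" "surj_mat R" "P = L * R"
    using rank_factorization[OF Pdim] by auto
  have range: "mat_range L = mat_range P"
    using * mat_range_mult_surj[of R L] by auto
  have "v \<notin> mat_range P"
  proof
    assume "v \<in> mat_range P"
    then obtain x where x: "dim_vec x = Suc n" "v = x - (u \<bullet> x) \<cdot>\<^sub>v v"
      using P Pdim by (auto simp: mem_mat_range)
    have "u \<bullet> v = u \<bullet> (x - (u \<bullet> x) \<cdot>\<^sub>v v)"
      using arg_cong[OF x(2)] .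
    also have "\<dots> = u \<bullet> x - (u \<bullet> x) * (u \<bullet> v)"
      using x(1) u(1) assms(1) by (subst scalar_prod_minus_distrib[where n = "Suc n"]) auto
    finally have "u \<bullet> v = u \<bullet> x - (u \<bullet> x) * (u \<bullet> v)" .
    then show False
      using u assms scalar_prod_commute[of u v] by simp
  qed
  then have inj: "inj_mat (add_col v L)"
    using range * assms by (subst inj_mat_add_col_iff) auto
  have "surj_mat (add_col v L)"
  proof (rule surj_matI)
    fix x :: "'a vec" assume "dim_vec x = dim_row (add_col v L)"
    then have x: "dim_vec x = Suc n" using * by simp
    then have "x - (u \<bullet> x) \<cdot>\<^sub>v v \<in> mat_range L"
      unfolding range using P[OF x] Pdim mat_rangeI[of x P] by simp
    then obtain y where "dim_vec y = r" "L *\<^sub>v y = x - (u \<bullet> x) \<cdot>\<^sub>v v"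
      using * by (auto simp: mem_mat_range)
    moreover have "(u \<bullet> x) \<cdot>\<^sub>v v + (x - (u \<bullet> x) \<cdot>\<^sub>v v) = x"
      using x assms by (intro eq_vecI) auto
    ultimately show "\<exists>w. dim_vec w = dim_col (add_col v L) \<and> add_col v L *\<^sub>v w = x"
      using * assms by (intro exI[of _ "vCons (u \<bullet> x) y"]) (auto simp: add_col_mult_vCons)
  qed
  then have "r = n"
    using inj * by (simp add: inj_mat_iff_mrank surj_mat_iff_mrank)
  then show ?thesis using inj * by blast
qed

text \<open>Write \<open>M = W * G\<close> with \<open>W\<close> injective and \<open>G\<close>
  surjective. The kernels of \<open>M\<close> and \<open>M\<^sup>T\<close> are those of
  \<open>G\<close> and \<open>W\<^sup>T\<close>, so by the inclusion \<open>W\<^sup>T\<close>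
  factors through \<open>G\<close> as \<open>Z * G\<close>. Comparing ranks, \<open>Z\<close> is
  invertible, and \<open>Y\<close> is its inverse.\<close>

lemma symmetric_kernel_factorization:
  fixes M :: "'a :: {field, finite} mat"
  assumes M: "M \<in> carrier_mat d d" and ker: "mat_kernel M \<subseteq> mat_kernel (M\<^sup>T)"
  shows "\<exists>W \<in> carrier_mat d (mrank M). \<exists>Y \<in> carrier_mat (mrank M) (mrank M).
    inj_mat W \<and> inj_mat Y \<and> M = W * Y * W\<^sup>T"
proof -
  obtain r W G where *: "W \<in> carrier_mat d r" "G \<in> carrier_mat r d"
    "inj_mat W" "surj_mat G" "M = W * G"
    using rank_factorization[OF M] by auto
  have r: "r = mrank M"
    using * by (simp add: mrank_mult_surj) (simp add: inj_mat_iff_mrank)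
  obtain B where B: "B \<in> carrier_mat d r" "G * B = 1\<^sub>m r"
    using surj_mat_right_inverse[OF *(4)] * by auto
  define Z where "Z = W\<^sup>T * B"
  have Z: "Z \<in> carrier_mat r r" using * B by (auto simp: Z_def)
  have WZ: "W\<^sup>T = Z * G"
  proof (rule eq_mat_by_vec)
    fix x :: "'a vec" assume "dim_vec x = dim_col (Z * G)"
    then have x: "dim_vec x = d" using * by simp
    \<comment> \<open>\<open>B\<close> is a right inverse of \<open>G\<close>, so the difference
      lies in the kernel of \<open>G\<close>, hence of \<open>M\<close>, hence of
      \<open>M\<^sup>T\<close>.\<close>
    have "G *\<^sub>v (x - B *\<^sub>v (G *\<^sub>v x)) = 0\<^sub>v r"
    proof -
      have "G *\<^sub>v (B *\<^sub>v (G *\<^sub>v x)) = G * B *\<^sub>v (G *\<^sub>v x)"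
        using *(1,2) B(1) x by (subst mat_vec_assoc) auto
      also have "\<dots> = G *\<^sub>v x"
        unfolding B(2) using *(2) by simp
      finally show ?thesis
        using *(1,2) B(1) x by (subst mult_mat_vec_minus) auto
    qed
    then have "M *\<^sub>v (x - B *\<^sub>v (G *\<^sub>v x)) = 0\<^sub>v d"
      using * B x by (simp add: mat_vec_assoc)
    then have "x - B *\<^sub>v (G *\<^sub>v x) \<in> mat_kernel (M\<^sup>T)"
      using ker M x B by (auto simp: mem_mat_kernel subset_iff)
    then have "G\<^sup>T *\<^sub>v (W\<^sup>T *\<^sub>v (x - B *\<^sub>v (G *\<^sub>v x))) = 0\<^sub>v d"
      using * B x by (simp add: mem_mat_kernel transpose_mult' mat_vec_assoc)
    then have "W\<^sup>T *\<^sub>v (x - B *\<^sub>v (G *\<^sub>v x)) = 0\<^sub>v r"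
      using inj_matD[OF surj_mat_transpose_inj[OF *(4)], of "W\<^sup>T *\<^sub>v (x - B *\<^sub>v (G *\<^sub>v x))"] * by auto
    then have "W\<^sup>T *\<^sub>v x - W\<^sup>T *\<^sub>v (B *\<^sub>v (G *\<^sub>v x)) = 0\<^sub>v r"
      using * B x by (simp add: mult_mat_vec_minus)
    then have "W\<^sup>T *\<^sub>v x = W\<^sup>T *\<^sub>v (B *\<^sub>v (G *\<^sub>v x))"
      using * B x by (metis carrier_matD(2) dim_mult_mat_vec eq_vecI index_minus_vec(1) index_transpose_mat(2)
          index_zero_vec(1) right_minus_eq)
    then show "W\<^sup>T *\<^sub>v x = Z * G *\<^sub>v x"
      using * B x by (simp add: Z_def mat_vec_assoc)
  qed (use * Z in auto)
  have "surj_mat (W\<^sup>T)"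
    using * by (simp add: surj_mat_transpose_iff)
  then have "surj_mat Z"
    using mrank_mult_surj[OF *(4), of Z] * Z by (simp add: WZ surj_mat_iff_mrank)
  then have "inj_mat Z" using inj_iff_surj_square[of Z] Z by auto
  then obtain Y where Y: "Y \<in> carrier_mat r r" "Y * Z = 1\<^sub>m r" "inj_mat Y"
    using square_inj_mat_inverse[OF _ Z] by blast
  have "G = Y * W\<^sup>T"
    unfolding WZ using Y Z * by (simp flip: mat_assoc)
  then have "M = W * Y * W\<^sup>T"
    using * Y by (simp add: mat_assoc)
  then show ?thesis
    using * Y unfolding r[symmetric] by blast
qed

subsection \<open>Bordered matrices\<close>

text \<open>No kernel vector of the bordered matrix can have a nonzero leading entry, for it would
  put \<open>c\<close> into the range. What remains is the part of the kernel of \<open>M\<close>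
  orthogonal to \<open>c\<close>, a hyperplane in it. The nullity drops by 1 while the size grows by
  1, so the rank rises by 2.\<close>

lemma card_border_kernel_outside:
  fixes M :: "'a :: {field, finite} mat"
  assumes M: "M \<in> carrier_mat d d" "mat_kernel (M\<^sup>T) = mat_kernel M"
    and c: "dim_vec c = d" "c \<notin> mat_range M"
  shows "mrank (border_mat t c c M) = Suc (Suc (mrank M))"
proof -
  let ?N = "{v \<in> mat_kernel M. c \<bullet> v = 0}"
  obtain v0 where v0: "dim_vec v0 = d" "M *\<^sub>v v0 = 0\<^sub>v d" "c \<bullet> v0 = 1"
    using not_in_range_witness[of c M] c M(1) unfolding M(2) by (auto simp: mem_mat_kernel)
  have "mat_kernel (border_mat t c c M) = vCons 0 ` ?N"
  proof (intro equalityI subsetI)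
    fix u assume u: "u \<in> mat_kernel (border_mat t c c M)"
    then obtain a v where av: "u = vCons a v" "dim_vec v = d"
      using ex_vCons[of u d] M(1) by (auto simp: mem_mat_kernel)
    have eq: "t * a + c \<bullet> v = 0" "a \<cdot>\<^sub>v c + M *\<^sub>v v = 0\<^sub>v d"
      using u av M(1) c by (auto simp: mem_mat_kernel border_mat_mult_vCons zero_vec_Suc)
    have "a = 0"
    proof (rule ccontr)
      assume a: "a \<noteq> 0"
      have "M *\<^sub>v ((- inverse a) \<cdot>\<^sub>v v) = c"
      proof (rule eq_vecI)
        fix i assume i: "i < dim_vec c"
        then have "a * c $ i + (M *\<^sub>v v) $ i = 0"
          using arg_cong[OF eq(2), of "\<lambda>x. x $ i"] c M(1) by simp
        then have "(M *\<^sub>v v) $ i = - (a * c $ i)" by (simp add: eq_neg_iff_add_eq_0 add.commute)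
        then show "(M *\<^sub>v ((- inverse a) \<cdot>\<^sub>v v)) $ i = c $ i"
          using a av M(1) c i by (subst mult_mat_vec_smult) auto
      qed (use M c in auto)
      then show False
        using c(2) av M(1) mat_rangeI[of "(- inverse a) \<cdot>\<^sub>v v" M] by auto
    qed
    moreover have "0 \<cdot>\<^sub>v c + M *\<^sub>v v = M *\<^sub>v v"
      using M(1) c by (intro eq_vecI) auto
    ultimately show "u \<in> vCons 0 ` ?N"
      using eq av M(1) by (auto simp: mem_mat_kernel)
  next
    fix u assume "u \<in> vCons 0 ` ?N"
    moreover have "0 \<cdot>\<^sub>v c = 0\<^sub>v d" using c by (intro eq_vecI) auto
    ultimately show "u \<in> mat_kernel (border_mat t c c M)"
      using M(1) c by (auto simp: mem_mat_kernel border_mat_mult_vCons zero_vec_Suc)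
  qed
  then have card1: "card (mat_kernel (border_mat t c c M)) = card ?N"
    by (simp add: card_image inj_on_def)
  \<comment> \<open>The kernel of \<open>M\<close> is the hyperplane plus the line through
    \<open>v0\<close>, where \<open>c \<bullet> v0 = 1\<close>.\<close>
  have "bij_betw (\<lambda>(s, v). v + s \<cdot>\<^sub>v v0) (UNIV \<times> ?N) (mat_kernel M)"
  proof (rule bij_betw_byWitness[where f' = "\<lambda>v. (c \<bullet> v, v - (c \<bullet> v) \<cdot>\<^sub>v v0)"])
    have lin: "c \<bullet> (v + s \<cdot>\<^sub>v v0) = c \<bullet> v + s" if "dim_vec v = d" for v s
      using v0 c that by (subst scalar_prod_add_distrib[of _ d]) auto
    have lin': "c \<bullet> (v - s \<cdot>\<^sub>v v0) = c \<bullet> v - s" if "dim_vec v = d" for v s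
      using v0 c that by (subst scalar_prod_minus_distrib[of _ d]) auto
    have ker: "M *\<^sub>v (v + s \<cdot>\<^sub>v v0) = M *\<^sub>v v" if "dim_vec v = d" for v s
      using v0 M(1) that by (subst mult_mat_vec_add) (auto simp: mult_mat_vec_smult)
    have ker': "M *\<^sub>v (v - s \<cdot>\<^sub>v v0) = M *\<^sub>v v" if "dim_vec v = d" for v s
      using v0 M(1) that by (subst mult_mat_vec_minus) (auto simp: mult_mat_vec_smult)
    show "\<forall>a\<in>UNIV \<times> ?N. (c \<bullet> (case a of (s, v) \<Rightarrow> v + s \<cdot>\<^sub>v v0),
        (case a of (s, v) \<Rightarrow> v + s \<cdot>\<^sub>v v0) - (c \<bullet> (case a of (s, v) \<Rightarrow> v + s \<cdot>\<^sub>v v0)) \<cdot>\<^sub>v v0) = a"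
      using M(1) v0 by (auto simp: mem_mat_kernel lin)
    show "\<forall>a'\<in>mat_kernel M. (case (c \<bullet> a', a' - (c \<bullet> a') \<cdot>\<^sub>v v0) of (s, v) \<Rightarrow> v + s \<cdot>\<^sub>v v0) = a'"
      using M(1) v0 by (auto simp: mem_mat_kernel)
    show "(\<lambda>(s, v). v + s \<cdot>\<^sub>v v0) ` (UNIV \<times> ?N) \<subseteq> mat_kernel M"
      using M(1) v0 by (auto simp: mem_mat_kernel ker)
    show "(\<lambda>v. (c \<bullet> v, v - (c \<bullet> v) \<cdot>\<^sub>v v0)) ` mat_kernel M \<subseteq> UNIV \<times> ?N"
      using M(1) v0 by (auto simp: mem_mat_kernel ker' lin')
  qed
  then have "card (mat_kernel M) = CARD('a) * card (mat_kernel (border_mat t c c M))"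
    using card1 by (simp add: bij_betw_same_card[symmetric] card_cartesian_product)
  then have "CARD('a) ^ (d - mrank M) = CARD('a) ^ Suc (Suc d - mrank (border_mat t c c M))"
    using M(1) by (simp add: card_mat_kernel)
  then have "d - mrank M = Suc (Suc d - mrank (border_mat t c c M))"
    using one_less_card_field[where 'a = 'a] by (simp only: power_inject_exp)
  then show ?thesis
    using mrank_le_dim_col[of "border_mat t c c M"] M(1) by simp
qed

text \<open>A Schur complement: for \<open>c = M w\<close>, the substitution of
  \<open>v - a w\<close> for \<open>v\<close> decouples the system into the scalar equation
  \<open>a * (t - c \<bullet> w) = 0\<close> and the kernel of \<open>M\<close>. Exactly one corner
  \<open>t\<close> leaves the rank unchanged.\<close>

lemma card_border_kernel_inside:
  fixes M :: "'a :: {field, finite} mat"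
  assumes M: "M \<in> carrier_mat d d" "mat_kernel (M\<^sup>T) = mat_kernel M"
    and w: "dim_vec w = d" "c = M *\<^sub>v w"
  shows "mrank (border_mat t c c M) = (if t = c \<bullet> w then mrank M else Suc (mrank M))"
proof -
  let ?A = "{a. a * (t - c \<bullet> w) = 0}"
  have c: "dim_vec c = d" using w M(1) by simp
  \<comment> \<open>\<open>c\<close> lies in the range of \<open>M\<close>, so it is orthogonal to
    the kernel of \<open>M\<^sup>T\<close>, which is the kernel of \<open>M\<close>.\<close>
  have cv: "c \<bullet> v = 0" if "v \<in> mat_kernel M" for v
  proof -
    have v: "dim_vec v = d" "M\<^sup>T *\<^sub>v v = 0\<^sub>v d"
      using that M(1) unfolding M(2)[symmetric] by (auto simp: mem_mat_kernel)
    have "c \<bullet> v = v \<bullet> (M *\<^sub>v w)"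
      using v c w by (simp add: scalar_prod_commute)
    also have "\<dots> = (M\<^sup>T *\<^sub>v v) \<bullet> w"
      using v(1) w(1) M(1) transpose_scalar_prod[of w M v] by simp
    finally show ?thesis using v w by (simp add: scalar_prod_left_zero)
  qed
  have "bij_betw (\<lambda>(a, v). vCons a (v - a \<cdot>\<^sub>v w)) (?A \<times> mat_kernel M) (mat_kernel (border_mat t c c M))"
  proof (rule bij_betw_imageI)
    show "inj_on (\<lambda>(a, v). vCons a (v - a \<cdot>\<^sub>v w)) (?A \<times> mat_kernel M)"
    proof (rule inj_onI)
      fix x y
      assume "x \<in> ?A \<times> mat_kernel M" "y \<in> ?A \<times> mat_kernel M"
        "(case x of (a, v) \<Rightarrow> vCons a (v - a \<cdot>\<^sub>v w)) = (case y of (a, v) \<Rightarrow> vCons a (v - a \<cdot>\<^sub>v w))"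
      then obtain a v v' where xy: "x = (a, v)" "y = (a, v')"
        and v: "v \<in> mat_kernel M" "v' \<in> mat_kernel M" and eq: "v - a \<cdot>\<^sub>v w = v' - a \<cdot>\<^sub>v w"
        by auto
      have "v = v'"
      proof (rule eq_vecI)
        fix i assume i: "i < dim_vec v'"
        have "(v - a \<cdot>\<^sub>v w) $ i = (v' - a \<cdot>\<^sub>v w) $ i" using eq by simp
        then show "v $ i = v' $ i"
          using i v w M(1) by (simp add: mem_mat_kernel)
      qed (use v in \<open>simp add: mem_mat_kernel\<close>)
      then show "x = y" by (simp add: xy)
    qed
    show "(\<lambda>(a, v). vCons a (v - a \<cdot>\<^sub>v w)) ` (?A \<times> mat_kernel M) = mat_kernel (border_mat t c c M)"
    proof (intro equalityI subsetI)
      fix u assume "u \<in> (\<lambda>(a, v). vCons a (v - a \<cdot>\<^sub>v w)) ` (?A \<times> mat_kernel M)"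
      then obtain a v where u: "u = vCons a (v - a \<cdot>\<^sub>v w)" "a * (t - c \<bullet> w) = 0" "v \<in> mat_kernel M"
        by auto
      have v: "dim_vec v = d" "M *\<^sub>v v = 0\<^sub>v d" using u(3) M(1) by (auto simp: mem_mat_kernel)
      have "t * a + c \<bullet> (v - a \<cdot>\<^sub>v w) = a * (t - c \<bullet> w)"
        using v w c M(1) cv[OF u(3)]
        by (subst scalar_prod_minus_distrib[of _ d]) (auto simp: algebra_simps)
      moreover have "a \<cdot>\<^sub>v c + M *\<^sub>v (v - a \<cdot>\<^sub>v w) = 0\<^sub>v d"
        using v w c M(1) by (subst mult_mat_vec_minus) (auto simp: mult_mat_vec_smult)
      ultimately show "u \<in> mat_kernel (border_mat t c c M)"
        using u v w c M(1) by (simp add: mem_mat_kernel border_mat_mult_vCons zero_vec_Suc)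
    next
      fix u assume u: "u \<in> mat_kernel (border_mat t c c M)"
      then obtain a v where av: "u = vCons a v" "dim_vec v = d"
        using ex_vCons[of u d] M(1) by (auto simp: mem_mat_kernel)
      have eq: "t * a + c \<bullet> v = 0" "a \<cdot>\<^sub>v c + M *\<^sub>v v = 0\<^sub>v d"
        using u av M(1) c by (auto simp: mem_mat_kernel border_mat_mult_vCons zero_vec_Suc)
      have "M *\<^sub>v (v + a \<cdot>\<^sub>v w) = a \<cdot>\<^sub>v c + M *\<^sub>v v"
        using av w M(1) by (subst mult_mat_vec_add) (auto simp: mult_mat_vec_smult intro: eq_vecI)
      then have ker: "v + a \<cdot>\<^sub>v w \<in> mat_kernel M"
        using eq av w M(1) by (simp add: mem_mat_kernel)
      have "c \<bullet> (v + a \<cdot>\<^sub>v w) = c \<bullet> v + a * (c \<bullet> w)"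
        using av w c M(1) by (subst scalar_prod_add_distrib[of _ d]) auto
      then have "c \<bullet> v = - (a * (c \<bullet> w))"
        using cv[OF ker] by (simp add: eq_neg_iff_add_eq_0)
      then have "a * (t - c \<bullet> w) = 0"
        using eq(1) by (simp add: algebra_simps)
      moreover have "v = (v + a \<cdot>\<^sub>v w) - a \<cdot>\<^sub>v w"
        using av w by (intro eq_vecI) auto
      ultimately show "u \<in> (\<lambda>(a, v). vCons a (v - a \<cdot>\<^sub>v w)) ` (?A \<times> mat_kernel M)"
        using ker av by (intro image_eqI[of _ _ "(a, v + a \<cdot>\<^sub>v w)"]) auto
    qed
  qed
  then have card: "card (mat_kernel (border_mat t c c M)) = card ?A * card (mat_kernel M)"
    by (simp add: bij_betw_same_card[symmetric] card_cartesian_product)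
  have le: "mrank M \<le> d" "mrank (border_mat t c c M) \<le> Suc d"
    using mrank_le_dim_col[of M] mrank_le_dim_col[of "border_mat t c c M"] M(1) by auto
  show ?thesis
  proof (cases "t = c \<bullet> w")
    case True
    then have "CARD('a) ^ (Suc d - mrank (border_mat t c c M)) = CARD('a) ^ Suc (d - mrank M)"
      using card M(1) by (simp add: card_mat_kernel)
    then have "Suc d - mrank (border_mat t c c M) = Suc (d - mrank M)"
      using one_less_card_field[where 'a = 'a] by (simp only: power_inject_exp)
    then show ?thesis using True le by simp
  next
    case False
    then have "?A = {0}" by auto
    then have "CARD('a) ^ (Suc d - mrank (border_mat t c c M)) = CARD('a) ^ (d - mrank M)"
      using card M(1) by (simp add: card_mat_kernel)
    then have "Suc d - mrank (border_mat t c c M) = d - mrank M"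
      using one_less_card_field[where 'a = 'a] by (simp only: power_inject_exp)
    then show ?thesis using False le by simp
  qed
qed

text \<open>The transition law of a random symmetric bordering. The weight \<open>f\<close> is
  arbitrary so that the law can be iterated.\<close>

lemma sum_border_rank:
  fixes M :: "'a :: {field, finite} mat" and f :: "nat \<Rightarrow> real"
  assumes M: "M \<in> carrier_mat d d" "mat_kernel (M\<^sup>T) = mat_kernel M"
  shows "(\<Sum>c\<in>carrier_vec d. \<Sum>t\<in>UNIV. f (mrank (border_mat t c c M))) =
    (real CARD('a) ^ d - real CARD('a) ^ mrank M) * real CARD('a) * f (Suc (Suc (mrank M))) +
    real CARD('a) ^ mrank M * ((real CARD('a) - 1) * f (Suc (mrank M)) + f (mrank M))"
proof -
  let ?R = "mat_range M" and ?q = "real CARD('a)"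
  have sub: "?R \<subseteq> carrier_vec d" using mat_range_carrier[of M] M(1) by auto
  have "(\<Sum>t\<in>UNIV. f (mrank (border_mat t c c M))) = (?q - 1) * f (Suc (mrank M)) + f (mrank M)"
    if c: "c \<in> ?R" for c
  proof -
    obtain w where w: "dim_vec w = d" "c = M *\<^sub>v w" using c M(1) by (auto simp: mem_mat_range)
    have "(\<Sum>t\<in>UNIV. f (mrank (border_mat t c c M))) =
        (\<Sum>t\<in>UNIV. if t = c \<bullet> w then f (mrank M) else f (Suc (mrank M)))"
      by (intro sum.cong refl) (simp add: card_border_kernel_inside[OF M w])
    also have "\<dots> = f (mrank M) + (\<Sum>t\<in>UNIV - {c \<bullet> w}. f (Suc (mrank M)))"
      by (subst sum.remove[of _ "c \<bullet> w"]) (auto intro!: sum.cong)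
    also have "real (card (UNIV - {c \<bullet> w})) = ?q - 1"
      using one_less_card_field[where 'a = 'a] by (simp add: card_Diff_singleton of_nat_diff)
    then have "(\<Sum>t\<in>UNIV - {c \<bullet> w}. f (Suc (mrank M))) = (?q - 1) * f (Suc (mrank M))"
      by simp
    finally show ?thesis by simp
  qed
  then have "(\<Sum>c\<in>?R. \<Sum>t\<in>UNIV. f (mrank (border_mat t c c M))) =
      ?q ^ mrank M * ((?q - 1) * f (Suc (mrank M)) + f (mrank M))"
    by (simp add: card_mat_range)
  moreover have "(\<Sum>c\<in>carrier_vec d - ?R. \<Sum>t\<in>UNIV. f (mrank (border_mat t c c M))) =
      (\<Sum>c\<in>carrier_vec d - ?R. ?q * f (Suc (Suc (mrank M))))"
    by (intro sum.cong refl) (simp add: card_border_kernel_outside[OF M])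
  moreover have "real (card (carrier_vec d - ?R)) = ?q ^ d - ?q ^ mrank M"
  proof -
    have "card ?R \<le> card (carrier_vec d :: 'a vec set)"
      using sub by (intro card_mono) auto
    then show ?thesis
      using sub by (simp add: card_Diff_subset card_carrier_vec card_mat_range of_nat_diff)
  qed
  ultimately show ?thesis
    using sum.subset_diff[OF sub finite_carrier_vec, of "\<lambda>c. \<Sum>t\<in>UNIV. f (mrank (border_mat t c c M))"]
    by simp
qed

lemma mrank_border_zero:
  fixes G :: "'a :: {field, finite} mat"
  assumes "G \<in> carrier_mat n m"
  shows "mrank (border_mat 0 (0\<^sub>v m) (0\<^sub>v n) G) = mrank G"
proof -
  let ?B = "border_mat 0 (0\<^sub>v m) (0\<^sub>v n) G"
  have mult: "?B *\<^sub>v vCons a v = vCons 0 (G *\<^sub>v v)" if "dim_vec v = m" for a v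
    using that assms by (subst border_mat_mult_vCons) (auto simp: scalar_prod_left_zero)
  have "mat_range ?B = vCons 0 ` mat_range G"
  proof (intro equalityI subsetI)
    fix w assume "w \<in> mat_range ?B"
    then obtain u where "dim_vec u = Suc m" "w = ?B *\<^sub>v u"
      using assms by (auto simp: mem_mat_range)
    moreover from this obtain a v where "u = vCons a v" "dim_vec v = m"
      using ex_vCons by blast
    ultimately show "w \<in> vCons 0 ` mat_range G"
      using assms by (simp add: mult mat_rangeI)
  next
    fix w assume "w \<in> vCons 0 ` mat_range G"
    then obtain v where "dim_vec v = m" "w = vCons 0 (G *\<^sub>v v)"
      using assms by (auto simp: mem_mat_range)
    then show "w \<in> mat_range ?B"
      using assms mat_rangeI[of "vCons 0 v" ?B] by (simp add: mult)
  qed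
  then have "card (mat_range ?B) = card (mat_range G)"
    by (simp add: card_image inj_on_def)
  then show ?thesis by (rule mrank_eqI)
qed

subsection \<open>Wall forms\<close>

text \<open>In characteristic 2 a skew-symmetric form need not vanish on pairs of equal vectors, so
  that condition is imposed explicitly.\<close>

definition alternating_mat :: "'a :: comm_ring_1 mat \<Rightarrow> bool" where
  "alternating_mat C \<longleftrightarrow> C\<^sup>T = - C \<and> (\<forall>v. dim_vec v = dim_col C \<longrightarrow> v \<bullet> (C *\<^sub>v v) = 0)"

text \<open>For invertible \<open>Y\<close> the equation says that the inverse transpose of
  \<open>Y\<close> minus its inverse is \<open>C\<close>: up to sign, the inverse is a bilinear form
  whose alternation is \<open>C\<close>, as in Wall's parametrization. Clearing inverses admits
  singular \<open>Y\<close>.\<close>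

definition wall_forms :: "'a :: comm_ring_1 mat \<Rightarrow> 'a mat set" where
  "wall_forms C = {Y \<in> carrier_mat (dim_row C) (dim_row C).
     Y - Y\<^sup>T = Y * C * Y\<^sup>T}"

text \<open>The type is read off \<open>C (Y C)\<^sup>i\<close> rather than \<open>(Y C)\<^sup>i\<close> because the former is merely bordered by
  zeros when \<open>C\<close> and \<open>Y\<close> are bordered.\<close>

definition wall_type :: "'a :: {field, finite} mat \<Rightarrow> (nat \<Rightarrow> nat) \<Rightarrow> 'a mat set" where
  "wall_type C \<tau> = {Y \<in> wall_forms C. \<forall>i. mrank (C * (Y * C) ^\<^sub>m i) = \<tau> i}"

lemma finite_wall_type [simp]: "finite (wall_type C \<tau>)"
  by (rule finite_subset[of _ "carrier_mat (dim_row C) (dim_row C)"])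
    (auto simp: wall_type_def wall_forms_def)

lemma alternating_mat_square: "alternating_mat C \<Longrightarrow> C \<in> carrier_mat (dim_row C) (dim_row C)"
  unfolding alternating_mat_def
  by (metis carrier_matI index_transpose_mat(2) index_uminus_mat(2))

lemma alternating_mat_dim: "alternating_mat C \<Longrightarrow> dim_col C = dim_row C"
  by (rule carrier_matD(2)[OF alternating_mat_square])

lemma alternating_mat_vec:
  fixes C :: "'a :: comm_ring_1 mat"
  assumes "alternating_mat C" "dim_vec v = dim_row C"
  shows "v \<bullet> (C *\<^sub>v v) = 0"
  using assms(1) alternating_mat_dim[OF assms(1)] assms(2) unfolding alternating_mat_def by metis

lemma alternating_mat_swap:
  fixes C :: "'a :: comm_ring_1 mat"
  assumes C: "alternating_mat C" and v: "dim_vec v = dim_row C" and w: "dim_vec w = dim_row C"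
  shows "(C *\<^sub>v v) \<bullet> w = - (v \<bullet> (C *\<^sub>v w))"
proof -
  have sq: "dim_col C = dim_row C" by (rule alternating_mat_dim[OF C])
  have "v \<bullet> (C *\<^sub>v w) = (C\<^sup>T *\<^sub>v v) \<bullet> w"
    using v w sq by (simp add: transpose_scalar_prod)
  also have "C\<^sup>T *\<^sub>v v = - (C *\<^sub>v v)"
    using C v sq by (simp add: alternating_mat_def)
  also have "\<dots> \<bullet> w = - ((C *\<^sub>v v) \<bullet> w)"
    using v w sq by simp
  finally show ?thesis by simp
qed

lemma alternating_mat_kernel_transpose:
  fixes C :: "'a :: comm_ring_1 mat"
  assumes C: "alternating_mat C"
  shows "mat_kernel (C\<^sup>T) = mat_kernel C"
proof -
  have sq: "dim_col C = dim_row C" by (rule alternating_mat_dim[OF C])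
  have "C\<^sup>T *\<^sub>v v = 0\<^sub>v (dim_row C) \<longleftrightarrow> C *\<^sub>v v = 0\<^sub>v (dim_row C)"
    if "dim_vec v = dim_row C" for v
    using C that sq by (auto simp: alternating_mat_def uminus_zero_vec_eq[where n = "dim_row C"])
  then show ?thesis using sq by (auto simp: mem_mat_kernel)
qed

lemma alternating_mat_congruence:
  fixes C :: "'a :: comm_ring_1 mat"
  assumes C: "alternating_mat C" and W: "dim_row W = dim_row C"
  shows "alternating_mat (W\<^sup>T * C * W)"
proof -
  have sq: "dim_col C = dim_row C" by (rule alternating_mat_dim[OF C])
  have "(W\<^sup>T * C * W)\<^sup>T = - (W\<^sup>T * C * W)"
    using W sq C
    by (simp add: transpose_mult' alternating_mat_def mat_assoc)
  moreover have "v \<bullet> (W\<^sup>T * C * W *\<^sub>v v) = 0" if v: "dim_vec v = dim_col W" for v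
  proof -
    have "v \<bullet> (W\<^sup>T * C * W *\<^sub>v v) = (C *\<^sub>v (W *\<^sub>v v)) \<bullet> (W *\<^sub>v v)"
      using W sq v scalar_prod_commute[of v "W\<^sup>T *\<^sub>v (C *\<^sub>v (W *\<^sub>v v))"]
        transpose_scalar_prod[of v W "C *\<^sub>v (W *\<^sub>v v)"]
      by (simp add: mat_vec_assoc)
    also have "\<dots> = (W *\<^sub>v v) \<bullet> (C *\<^sub>v (W *\<^sub>v v))"
      using W sq v by (simp add: scalar_prod_commute)
    also have "\<dots> = 0" using W sq v by (intro alternating_mat_vec[OF C]) simp
    finally show ?thesis .
  qed
  ultimately show ?thesis by (simp add: alternating_mat_def)
qed

lemma wall_forms_vec:
  fixes C :: "'a :: comm_ring_1 mat"
  assumes C: "alternating_mat C" and Y: "Y \<in> carrier_mat (dim_row C) (dim_row C)"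
  shows "Y \<in> wall_forms C \<longleftrightarrow>
    (\<forall>v. dim_vec v = dim_row C \<longrightarrow>
      Y *\<^sub>v v - Y\<^sup>T *\<^sub>v v = Y *\<^sub>v (C *\<^sub>v (Y\<^sup>T *\<^sub>v v)))"
    (is "_ = ?R")
proof -
  have sq: "dim_col C = dim_row C" by (rule alternating_mat_dim[OF C])
  have l: "(Y - Y\<^sup>T) *\<^sub>v v = Y *\<^sub>v v - Y\<^sup>T *\<^sub>v v" if "dim_vec v = dim_row C" for v
    using Y that by (intro minus_mult_distrib_mat_vec[of _ "dim_row C" "dim_row C"]) auto
  have r: "(Y * C * Y\<^sup>T) *\<^sub>v v = Y *\<^sub>v (C *\<^sub>v (Y\<^sup>T *\<^sub>v v))"
    if "dim_vec v = dim_row C" for v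
    using Y sq that by (simp add: mat_vec_assoc)
  have "(Y - Y\<^sup>T = Y * C * Y\<^sup>T) \<longleftrightarrow> ?R"
  proof
    assume "Y - Y\<^sup>T = Y * C * Y\<^sup>T"
    then show ?R using l r by metis
  next
    assume ?R
    then show "Y - Y\<^sup>T = Y * C * Y\<^sup>T"
      using Y sq by (intro eq_mat_by_vec) (auto simp: l r)
  qed
  then show ?thesis using Y by (auto simp: wall_forms_def)
qed

text \<open>On a vector killed by \<open>Y\<^sup>T\<close> the right side of the equation vanishes,
  so \<open>Y\<close> kills it too. Equality follows because transposition preserves the rank. It
  makes both the bordering lemmas and \<open>symmetric_kernel_factorization\<close> applicable to
  \<open>Y\<close>.\<close>

lemma wall_forms_kernel_transpose:
  fixes C :: "'a :: {field, finite} mat"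
  assumes C: "alternating_mat C" and Y: "Y \<in> wall_forms C"
  shows "mat_kernel (Y\<^sup>T) = mat_kernel Y"
proof (rule card_subset_eq)
  have sq: "dim_col C = dim_row C" by (rule alternating_mat_dim[OF C])
  have Yc: "Y \<in> carrier_mat (dim_row C) (dim_row C)" using Y by (simp add: wall_forms_def)
  show "card (mat_kernel (Y\<^sup>T)) = card (mat_kernel Y)"
    using Yc by (simp add: card_mat_kernel mrank_transpose)
  show "mat_kernel (Y\<^sup>T) \<subseteq> mat_kernel Y"
  proof
    fix v assume "v \<in> mat_kernel (Y\<^sup>T)"
    then have v: "dim_vec v = dim_row C" "Y\<^sup>T *\<^sub>v v = 0\<^sub>v (dim_row C)"
      using Yc by (auto simp: mem_mat_kernel)
    have "Y *\<^sub>v v - Y\<^sup>T *\<^sub>v v = Y *\<^sub>v (C *\<^sub>v (Y\<^sup>T *\<^sub>v v))"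
      using Y v(1) wall_forms_vec[OF C Yc] by blast
    then have "Y *\<^sub>v v = 0\<^sub>v (dim_row C)"
      using v Yc sq by simp
    then show "v \<in> mat_kernel Y" using v Yc by (simp add: mem_mat_kernel)
  qed
qed simp

section \<open>Adjoining a radical vector to the form\<close>

definition border_zero :: "'a :: comm_ring_1 mat \<Rightarrow> 'a mat" where
  "border_zero C = border_mat 0 (0\<^sub>v (dim_col C)) (0\<^sub>v (dim_row C)) C"

lemma dim_border_zero [simp]:
  "dim_row (border_zero C) = Suc (dim_row C)" "dim_col (border_zero C) = Suc (dim_col C)"
  by (simp_all add: border_zero_def)

lemma border_zero_mult:
  fixes C :: "'a :: comm_ring_1 mat"
  shows "dim_vec v = dim_col C \<Longrightarrow> border_zero C *\<^sub>v vCons a v = vCons 0 (C *\<^sub>v v)"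
  unfolding border_zero_def
  by (subst border_mat_mult_vCons) (auto simp: scalar_prod_left_zero intro!: eq_vecI)

lemma alternating_border_zero:
  fixes C :: "'a :: comm_ring_1 mat"
  assumes C: "alternating_mat C"
  shows "alternating_mat (border_zero C)"
proof -
  have sq: "dim_col C = dim_row C" by (rule alternating_mat_dim[OF C])
  have "(border_zero C)\<^sup>T = border_zero (- C)"
    using C sq unfolding border_zero_def
    by (subst transpose_border_mat) (auto simp: alternating_mat_def)
  also have "\<dots> = - border_zero C"
    using sq by (intro eq_matI)
      (auto simp: border_zero_def border_mat_def add_col_def vec_index_vCons split: nat.splits)
  finally have "(border_zero C)\<^sup>T = - border_zero C" .
  moreover have "u \<bullet> (border_zero C *\<^sub>v u) = 0" if u: "dim_vec u = Suc (dim_row C)" for u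
  proof -
    obtain a v where av: "u = vCons a v" "dim_vec v = dim_row C" using ex_vCons[OF u] by blast
    then show ?thesis
      using sq alternating_mat_vec[OF C av(2)] by (simp add: border_zero_mult)
  qed
  ultimately show ?thesis using sq by (simp add: alternating_mat_def)
qed

lemma ex_border_mat:
  assumes "Z \<in> carrier_mat (Suc n) (Suc m)"
  shows "\<exists>t q p Y. Z = border_mat t q p Y \<and> dim_vec q = m \<and> dim_vec p = n \<and> Y \<in> carrier_mat n m"
proof -
  obtain w W where w: "Z = add_col w W" "dim_vec w = Suc n" "W \<in> carrier_mat (Suc n) m"
    using ex_add_col[OF assms] by auto
  obtain t p where tp: "w = vCons t p" "dim_vec p = n" using ex_vCons[OF w(2)] by blast
  obtain q V where q: "W\<^sup>T = add_col q V" "dim_vec q = m" "V \<in> carrier_mat m n"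
    using ex_add_col[of "W\<^sup>T" m n] w by auto
  have "W = (add_col q ((V\<^sup>T)\<^sup>T))\<^sup>T"
    using arg_cong[OF q(1), of transpose_mat] by simp
  then have "Z = border_mat t q p (V\<^sup>T)"
    using w tp by (simp add: border_mat_def)
  then show ?thesis
    using tp q by (intro exI[of _ t] exI[of _ q] exI[of _ p] exI[of _ "V\<^sup>T"]) auto
qed

lemma border_mat_index:
  assumes "dim_vec p = n" "dim_vec q = m" "Y \<in> carrier_mat n m"
  shows "border_mat t q p Y $$ (0, 0) = t"
    "j < m \<Longrightarrow> border_mat t q p Y $$ (0, Suc j) = q $ j"
    "i < n \<Longrightarrow> border_mat t q p Y $$ (Suc i, 0) = p $ i"
    "i < n \<Longrightarrow> j < m \<Longrightarrow> border_mat t q p Y $$ (Suc i, Suc j) = Y $$ (i, j)"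
  using assms by (auto simp: border_mat_def add_col_def)

lemma border_mat_inject:
  fixes Y :: "'a :: comm_ring_1 mat"
  assumes eq: "border_mat t q p Y = border_mat t' q' p' Y'"
    and 1: "dim_vec p = n" "dim_vec q = m" "Y \<in> carrier_mat n m"
    and 2: "dim_vec p' = n" "dim_vec q' = m" "Y' \<in> carrier_mat n m"
  shows "t = t' \<and> q = q' \<and> p = p' \<and> Y = Y'"
proof -
  have "t = t'"
    using border_mat_index(1)[OF 1, of t] border_mat_index(1)[OF 2, of t'] unfolding eq by simp
  moreover have "q = q'"
  proof (rule eq_vecI)
    fix j assume "j < dim_vec q'"
    then show "q $ j = q' $ j"
      using border_mat_index(2)[OF 1, of j t] border_mat_index(2)[OF 2, of j t'] 2(2)
      unfolding eq by simp
  qed (use 1 2 in simp)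
  moreover have "p = p'"
  proof (rule eq_vecI)
    fix j assume "j < dim_vec p'"
    then show "p $ j = p' $ j"
      using border_mat_index(3)[OF 1, of j t] border_mat_index(3)[OF 2, of j t'] 2(1)
      unfolding eq by simp
  qed (use 1 2 in simp)
  moreover have "Y = Y'"
  proof (rule eq_matI)
    fix i j assume "i < dim_row Y'" "j < dim_col Y'"
    then show "Y $$ (i, j) = Y' $$ (i, j)"
      using border_mat_index(4)[OF 1, of i j t] border_mat_index(4)[OF 2, of i j t'] 2(3)
      unfolding eq by simp
  qed (use 1 2 in simp_all)
  ultimately show ?thesis by blast
qed

lemma all_vCons: "(\<forall>x. dim_vec x = Suc d \<longrightarrow> P x) \<longleftrightarrow> (\<forall>a v. dim_vec v = d \<longrightarrow> P (vCons a v))"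
  using ex_vCons[of _ d] by force

text \<open>Blockwise, the corner reads \<open>0 = q \<bullet> C q\<close>, which alternation
  guarantees, so \<open>t\<close> is free. The left column determines \<open>p\<close>, the top row
  then follows by alternation, and the remaining block is the equation for \<open>Y\<close>.\<close>

lemma border_mem_wall_forms_iff:
  fixes C :: "'a :: field mat"
  assumes C: "alternating_mat C" and Y: "Y \<in> carrier_mat (dim_row C) (dim_row C)"
    and q: "dim_vec q = dim_row C" and p: "dim_vec p = dim_row C"
  shows "border_mat t q p Y \<in> wall_forms (border_zero C) \<longleftrightarrow>
    Y \<in> wall_forms C \<and> p = q + Y *\<^sub>v (C *\<^sub>v q)"
proof -
  let ?d = "dim_row C" and ?Z = "border_mat t q p Y" and ?B = "border_zero C"
  have sq: "dim_col C = ?d" by (rule alternating_mat_dim[OF C])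
  have Zt: "?Z\<^sup>T = border_mat t p q (Y\<^sup>T)"
    using Y q p by (intro transpose_border_mat) auto
  have Zv: "?Z *\<^sub>v vCons a v = vCons (t * a + q \<bullet> v) (a \<cdot>\<^sub>v p + Y *\<^sub>v v)" if "dim_vec v = ?d" for a v
    using Y q p that by (intro border_mat_mult_vCons) auto
  have Ztv: "?Z\<^sup>T *\<^sub>v vCons a v = vCons (t * a + p \<bullet> v) (a \<cdot>\<^sub>v q + Y\<^sup>T *\<^sub>v v)"
    if "dim_vec v = ?d" for a v
    unfolding Zt using Y q p that by (intro border_mat_mult_vCons) auto
  let ?u = "\<lambda>a v. C *\<^sub>v (a \<cdot>\<^sub>v q + Y\<^sup>T *\<^sub>v v)"
  have "?Z \<in> wall_forms ?B \<longleftrightarrow> (\<forall>x. dim_vec x = Suc ?d \<longrightarrow>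
      ?Z *\<^sub>v x - ?Z\<^sup>T *\<^sub>v x = ?Z *\<^sub>v (?B *\<^sub>v (?Z\<^sup>T *\<^sub>v x)))"
    using Y by (subst wall_forms_vec[OF alternating_border_zero[OF C]]) auto
  also have "\<dots> \<longleftrightarrow> (\<forall>a v. dim_vec v = ?d \<longrightarrow>
      ?Z *\<^sub>v vCons a v - ?Z\<^sup>T *\<^sub>v vCons a v = ?Z *\<^sub>v (?B *\<^sub>v (?Z\<^sup>T *\<^sub>v vCons a v)))"
    by (rule all_vCons)
  also have "\<dots> \<longleftrightarrow> (\<forall>a v. dim_vec v = ?d \<longrightarrow>
      q \<bullet> v - p \<bullet> v = q \<bullet> ?u a v \<and>
      (a \<cdot>\<^sub>v p + Y *\<^sub>v v) - (a \<cdot>\<^sub>v q + Y\<^sup>T *\<^sub>v v) = Y *\<^sub>v ?u a v)"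
  proof (intro all_cong1 imp_cong refl)
    fix a and v :: "'a vec" assume v: "dim_vec v = ?d"
    have "?Z *\<^sub>v vCons a v - ?Z\<^sup>T *\<^sub>v vCons a v = vCons (q \<bullet> v - p \<bullet> v)
        ((a \<cdot>\<^sub>v p + Y *\<^sub>v v) - (a \<cdot>\<^sub>v q + Y\<^sup>T *\<^sub>v v))"
      unfolding Zv[OF v] Ztv[OF v] using Y v q p
      by (intro eq_vecI) (auto simp: vec_index_vCons)
    moreover have "?Z *\<^sub>v (?B *\<^sub>v (?Z\<^sup>T *\<^sub>v vCons a v)) = vCons (q \<bullet> ?u a v) (Y *\<^sub>v ?u a v)"
      unfolding Ztv[OF v] using Y v q p sq
      by (subst border_zero_mult) (auto simp: Zv intro!: eq_vecI)
    ultimately show "(?Z *\<^sub>v vCons a v - ?Z\<^sup>T *\<^sub>v vCons a v =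
        ?Z *\<^sub>v (?B *\<^sub>v (?Z\<^sup>T *\<^sub>v vCons a v))) \<longleftrightarrow>
        q \<bullet> v - p \<bullet> v = q \<bullet> ?u a v \<and>
        (a \<cdot>\<^sub>v p + Y *\<^sub>v v) - (a \<cdot>\<^sub>v q + Y\<^sup>T *\<^sub>v v) = Y *\<^sub>v ?u a v"
      by simp
  qed
  also have "\<dots> \<longleftrightarrow> Y \<in> wall_forms C \<and> p = q + Y *\<^sub>v (C *\<^sub>v q)" (is "?L \<longleftrightarrow> ?R")
  proof
    assume L: ?L
    have "Y *\<^sub>v v - Y\<^sup>T *\<^sub>v v = Y *\<^sub>v (C *\<^sub>v (Y\<^sup>T *\<^sub>v v))" if v: "dim_vec v = ?d" for v
    proof -
      \<comment> \<open>The leading entry \<open>a = 0\<close> isolates the equation for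
        \<open>Y\<close>.\<close>
      have "0 \<cdot>\<^sub>v p + Y *\<^sub>v v = Y *\<^sub>v v" "0 \<cdot>\<^sub>v q + Y\<^sup>T *\<^sub>v v = Y\<^sup>T *\<^sub>v v"
        using Y p q by (auto intro!: eq_vecI)
      then show ?thesis using L v by metis
    qed
    moreover have "p = q + Y *\<^sub>v (C *\<^sub>v q)"
    proof -
      \<comment> \<open>The leading entry 1 above the zero vector isolates the left column, which
        gives \<open>p\<close>.\<close>
      have "1 \<cdot>\<^sub>v p + Y *\<^sub>v 0\<^sub>v ?d = p" "1 \<cdot>\<^sub>v q + Y\<^sup>T *\<^sub>v 0\<^sub>v ?d = q"
        using Y p q by (auto intro!: eq_vecI)
      then have e: "p - q = Y *\<^sub>v (C *\<^sub>v q)" using L by (metis index_zero_vec(2))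
      show ?thesis
        unfolding e[symmetric] using p q by (intro eq_vecI) auto
    qed
    ultimately show ?R using wall_forms_vec[OF C Y] by blast
  next
    assume R: ?R
    show ?L
    proof (intro allI impI conjI)
      fix a and v :: "'a vec" assume v: "dim_vec v = ?d"
      have wf: "Y *\<^sub>v v - Y\<^sup>T *\<^sub>v v = Y *\<^sub>v (C *\<^sub>v (Y\<^sup>T *\<^sub>v v))"
        using R v wall_forms_vec[OF C Y] by blast
      have u: "?u a v = a \<cdot>\<^sub>v (C *\<^sub>v q) + C *\<^sub>v (Y\<^sup>T *\<^sub>v v)"
        using Y q v sq by (subst mult_mat_vec_add) (auto simp: mult_mat_vec_smult)
      have "p \<bullet> v = q \<bullet> v + (Y *\<^sub>v (C *\<^sub>v q)) \<bullet> v"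
        using R Y q v sq add_scalar_prod_distrib[of q ?d "Y *\<^sub>v (C *\<^sub>v q)" v] by simp
      also have "(Y *\<^sub>v (C *\<^sub>v q)) \<bullet> v = (C *\<^sub>v q) \<bullet> (Y\<^sup>T *\<^sub>v v)"
        using transpose_scalar_prod[of v "Y\<^sup>T" "C *\<^sub>v q"] Y q v sq by simp
      also have "\<dots> = - (q \<bullet> (C *\<^sub>v (Y\<^sup>T *\<^sub>v v)))"
        using Y q v by (intro alternating_mat_swap[OF C]) auto
      finally show "q \<bullet> v - p \<bullet> v = q \<bullet> ?u a v"
        unfolding u using q v Y sq alternating_mat_vec[OF C q]
        by (subst scalar_prod_add_distrib[of _ ?d]) auto
      have "Y *\<^sub>v ?u a v = a \<cdot>\<^sub>v (Y *\<^sub>v (C *\<^sub>v q)) + (Y *\<^sub>v v - Y\<^sup>T *\<^sub>v v)"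
        unfolding u wf using Y q v sq by (subst mult_mat_vec_add) (auto simp: mult_mat_vec_smult)
      then show "(a \<cdot>\<^sub>v p + Y *\<^sub>v v) - (a \<cdot>\<^sub>v q + Y\<^sup>T *\<^sub>v v) = Y *\<^sub>v ?u a v"
        using R Y q v sq by (intro eq_vecI) (auto simp: algebra_simps)
    qed
  qed
  finally show ?thesis .
qed

lemma bij_betw_border_wall_forms:
  fixes C :: "'a :: field mat"
  assumes C: "alternating_mat C"
  shows "bij_betw (\<lambda>(Y, q, t). border_mat t q (q + Y *\<^sub>v (C *\<^sub>v q)) Y)
    (wall_forms C \<times> carrier_vec (dim_row C) \<times> UNIV) (wall_forms (border_zero C))"
proof (rule bij_betw_imageI)
  let ?d = "dim_row C" and ?f = "\<lambda>(Y, q, t). border_mat t q (q + Y *\<^sub>v (C *\<^sub>v q)) Y"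
  have sq: "dim_col C = ?d" by (rule alternating_mat_dim[OF C])
  have wf: "Y \<in> carrier_mat ?d ?d" if "Y \<in> wall_forms C" for Y
    using that by (simp add: wall_forms_def)
  show "inj_on ?f (wall_forms C \<times> carrier_vec ?d \<times> UNIV)"
  proof (rule inj_onI)
    fix x y assume xy: "x \<in> wall_forms C \<times> carrier_vec ?d \<times> UNIV"
      "y \<in> wall_forms C \<times> carrier_vec ?d \<times> UNIV" and eq: "?f x = ?f y"
    obtain Y q t Y' q' t' where s: "x = (Y, q, t)" "y = (Y', q', t')"
      by (metis prod_cases3)
    then have m: "Y \<in> carrier_mat ?d ?d" "dim_vec q = ?d" "Y' \<in> carrier_mat ?d ?d" "dim_vec q' = ?d"
      using xy wf by auto
    have "t = t' \<and> q = q' \<and> q + Y *\<^sub>v (C *\<^sub>v q) = q' + Y' *\<^sub>v (C *\<^sub>v q') \<and> Y = Y'"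
      by (rule border_mat_inject[of _ _ _ _ _ _ _ _ ?d ?d]) (use eq s m in auto)
    then show "x = y" using s by simp
  qed
  show "?f ` (wall_forms C \<times> carrier_vec ?d \<times> UNIV) = wall_forms (border_zero C)"
  proof (intro equalityI subsetI)
    fix Z assume "Z \<in> ?f ` (wall_forms C \<times> carrier_vec ?d \<times> UNIV)"
    then obtain Y q t where *: "Y \<in> wall_forms C" "dim_vec q = ?d"
      "Z = border_mat t q (q + Y *\<^sub>v (C *\<^sub>v q)) Y"
      by auto
    then show "Z \<in> wall_forms (border_zero C)"
      using border_mem_wall_forms_iff[OF C wf[OF *(1)] *(2)] wf[OF *(1)] by auto
  next
    fix Z assume Z: "Z \<in> wall_forms (border_zero C)"
    then have "Z \<in> carrier_mat (Suc ?d) (Suc ?d)" by (simp add: wall_forms_def)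
    then obtain t q p Y where *: "Z = border_mat t q p Y" "dim_vec q = ?d" "dim_vec p = ?d"
      "Y \<in> carrier_mat ?d ?d"
      using ex_border_mat by blast
    then have "Y \<in> wall_forms C" "p = q + Y *\<^sub>v (C *\<^sub>v q)"
      using Z border_mem_wall_forms_iff[OF C *(4,2,3)] by auto
    then show "Z \<in> ?f ` (wall_forms C \<times> carrier_vec ?d \<times> UNIV)"
      using * by (intro image_eqI[of _ _ "(Y, q, t)"]) auto
  qed
qed

text \<open>Every factor of the border is multiplied by the zero row and column of the form, so
  \<open>t\<close>, \<open>q\<close> and \<open>p\<close> disappear. Hence all borderings of
  \<open>Y\<close> have the type of \<open>Y\<close>.\<close>

lemma border_gram_power:
  fixes C :: "'a :: field mat"
  assumes C: "C \<in> carrier_mat d d" and Y: "Y \<in> carrier_mat d d"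
    and q: "dim_vec q = d" and p: "dim_vec p = d"
  shows "border_zero C * (border_mat t q p Y * border_zero C) ^\<^sub>m i = border_zero (C * (Y * C) ^\<^sub>m i)"
proof (induction i)
  case 0
  then show ?case using C Y by simp
next
  case (Suc i)
  let ?G = "C * (Y * C) ^\<^sub>m i" and ?Z = "border_mat t q p Y"
  have G: "?G \<in> carrier_mat d d" using C Y by simp
  have "border_zero C * (?Z * border_zero C) ^\<^sub>m Suc i =
      border_zero C * (?Z * border_zero C) ^\<^sub>m i * (?Z * border_zero C)"
    using C Y by (simp add: mat_assoc)
  also have "\<dots> = border_zero ?G * (?Z * border_zero C)"
    by (simp only: Suc)
  also have "\<dots> = border_zero (?G * (Y * C))"
  proof (rule eq_mat_by_vec)
    fix x :: "'a vec" assume "dim_vec x = dim_col (border_zero (?G * (Y * C)))"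
    then obtain a v where x: "x = vCons a v" "dim_vec v = d" using ex_vCons[of x d] C by auto
    have "0 \<cdot>\<^sub>v p + Y *\<^sub>v (C *\<^sub>v v) = Y *\<^sub>v (C *\<^sub>v v)" using Y p by (intro eq_vecI) auto
    then show "border_zero ?G * (?Z * border_zero C) *\<^sub>v x = border_zero (?G * (Y * C)) *\<^sub>v x"
      using x C Y q p by (simp add: mat_vec_assoc border_zero_mult border_mat_mult_vCons)
  qed (use C Y in auto)
  also have "?G * (Y * C) = C * (Y * C) ^\<^sub>m Suc i"
    using C Y by (simp add: mat_assoc)
  finally show ?case .
qed

text \<open>Reduces the skewed border to a symmetric one, for which the rank is known. After
  transposing, a kernel vector satisfies \<open>Y\<^sup>T v = - a q\<close>, and on such
  \<open>v\<close> the rows \<open>q + Y C q\<close> and \<open>q\<close> agree, their difference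
  being a multiple of \<open>C q \<bullet> q = 0\<close>.\<close>

lemma mrank_border_wall:
  fixes C :: "'a :: {field, finite} mat"
  assumes C: "alternating_mat C" and Y: "Y \<in> wall_forms C" and q: "dim_vec q = dim_row C"
  shows "mrank (border_mat t q (q + Y *\<^sub>v (C *\<^sub>v q)) Y) = mrank (border_mat t q q (Y\<^sup>T))"
proof -
  let ?d = "dim_row C" and ?p = "q + Y *\<^sub>v (C *\<^sub>v q)"
  have sq: "dim_col C = ?d" by (rule alternating_mat_dim[OF C])
  have Yc: "Y \<in> carrier_mat ?d ?d" using Y by (simp add: wall_forms_def)
  have "mat_kernel (border_mat t ?p q (Y\<^sup>T)) = mat_kernel (border_mat t q q (Y\<^sup>T))"
  proof -
    have "border_mat t ?p q (Y\<^sup>T) *\<^sub>v x = 0\<^sub>v (Suc ?d) \<longleftrightarrow>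
        border_mat t q q (Y\<^sup>T) *\<^sub>v x = 0\<^sub>v (Suc ?d)" if x: "dim_vec x = Suc ?d" for x
    proof -
      obtain a v where av: "x = vCons a v" "dim_vec v = ?d" using ex_vCons[OF x] by blast
      have "?p \<bullet> v = q \<bullet> v" if e: "a \<cdot>\<^sub>v q + Y\<^sup>T *\<^sub>v v = 0\<^sub>v ?d"
      proof -
        have "?p \<bullet> v = q \<bullet> v + (Y *\<^sub>v (C *\<^sub>v q)) \<bullet> v"
          using Yc q av sq by (subst add_scalar_prod_distrib[of _ ?d]) auto
        also have "(Y *\<^sub>v (C *\<^sub>v q)) \<bullet> v = (C *\<^sub>v q) \<bullet> (Y\<^sup>T *\<^sub>v v)"
          using transpose_scalar_prod[of v "Y\<^sup>T" "C *\<^sub>v q"] Yc q av sq by simp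
        also have "Y\<^sup>T *\<^sub>v v = (- a) \<cdot>\<^sub>v q"
        proof (rule eq_vecI)
          fix i assume "i < dim_vec ((- a) \<cdot>\<^sub>v q)"
          then show "(Y\<^sup>T *\<^sub>v v) $ i = ((- a) \<cdot>\<^sub>v q) $ i"
            using arg_cong[OF e, of "\<lambda>z. z $ i"] Yc q by (simp add: eq_neg_iff_add_eq_0 add.commute)
        qed (use Yc q in auto)
        also have "(C *\<^sub>v q) \<bullet> ((- a) \<cdot>\<^sub>v q) = 0"
          using q alternating_mat_vec[OF C q] scalar_prod_commute[of "C *\<^sub>v q" q] by simp
        finally show ?thesis by simp
      qed
      then show ?thesis
        using av Yc q by (auto simp: border_mat_mult_vCons zero_vec_Suc)
    qed
    then show ?thesis using Yc by (auto simp: mem_mat_kernel)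
  qed
  then have "card (mat_kernel (border_mat t ?p q (Y\<^sup>T))) =
      card (mat_kernel (border_mat t q q (Y\<^sup>T)))"
    by simp
  then have "Suc ?d - mrank (border_mat t ?p q (Y\<^sup>T)) = Suc ?d - mrank (border_mat t q q (Y\<^sup>T))"
    using one_less_card_field[where 'a = 'a] Yc by (simp add: card_mat_kernel)
  then have "mrank (border_mat t ?p q (Y\<^sup>T)) = mrank (border_mat t q q (Y\<^sup>T))"
    using mrank_le_dim_col[of "border_mat t ?p q (Y\<^sup>T)"]
      mrank_le_dim_col[of "border_mat t q q (Y\<^sup>T)"] Yc by simp
  moreover have "(border_mat t q ?p Y)\<^sup>T = border_mat t ?p q (Y\<^sup>T)"
    using Yc q by (intro transpose_border_mat) auto
  ultimately show ?thesis by (metis mrank_transpose)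
qed

subsection \<open>Counting extensions of Wall forms\<close>

definition qfac :: "real \<Rightarrow> nat \<Rightarrow> real" where
  "qfac t n = (\<Prod>i = 1..n. 1 - t ^ i)"

lemma qfac_0 [simp]: "qfac t 0 = 1"
  by (simp add: qfac_def)

lemma qfac_Suc: "qfac t (Suc n) = qfac t n * (1 - t ^ Suc n)"
  by (simp add: qfac_def)

lemma qfac_pos: "0 < t \<Longrightarrow> t < 1 \<Longrightarrow> 0 < qfac t n"
  unfolding qfac_def by (intro prod_pos) (auto intro!: power_Suc_less_one simp: power_less_one_iff)

lemma qfac_square_pos: "0 < t \<Longrightarrow> t < 1 \<Longrightarrow> 0 < qfac (t\<^sup>2) n"
  by (intro qfac_pos) (auto simp: power_less_one_iff)

text \<open>The probability that a solution of corank \<open>\<kappa>\<close> becomes nonsingular after \<open>r\<close> random borderings, for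
  \<open>t = 1/q\<close>.\<close>

definition ext_prob :: "real \<Rightarrow> nat \<Rightarrow> nat \<Rightarrow> real" where
  "ext_prob t r \<kappa> = (if \<kappa> \<le> r then qfac t r / qfac (t\<^sup>2) ((r - \<kappa>) div 2) else 0)"

text \<open>First-step analysis: one bordering lowers the corank with probability
  \<open>1 - t ^ \<kappa>\<close>, keeps it with \<open>t ^ \<kappa> * (1 - t)\<close> and raises it
  with \<open>t ^ Suc \<kappa>\<close>. The parity of \<open>j = r - \<kappa>\<close> decides which
  terms share a denominator; over a common one the claim is a decomposition of
  \<open>1 - t ^ Suc r\<close>.\<close>

lemma ext_prob_Suc:
  assumes t: "0 < t" "t < 1"
  shows "ext_prob t (Suc r) \<kappa> = (1 - t ^ \<kappa>) * ext_prob t r (\<kappa> - 1) +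
    t ^ \<kappa> * (1 - t) * ext_prob t r \<kappa> + t ^ Suc \<kappa> * ext_prob t r (Suc \<kappa>)"
proof -
  have pos: "qfac (t\<^sup>2) a \<noteq> 0" for a using qfac_square_pos[OF t] by (metis less_irrefl)
  have gen: "Q * (x + y + z * u) / E = x * Q / E + y * (Q / E) + z * (Q * u / E)"
    "Q * (x + y * u + z * u) / E = x * Q / E + y * (Q * u / E) + z * (Q * u / E)"
    for Q x y z u E :: real
    by (simp_all add: add_divide_distrib algebra_simps)
  have tn: "1 - t ^ Suc n \<noteq> 0" for n
    using power_Suc_less_one[of t n] t by simp
  show ?thesis
  proof (cases "\<kappa> \<le> r")
    case True
    then obtain j where r: "r = \<kappa> + j" using le_Suc_ex by blast
    \<comment> \<open>For \<open>\<kappa> = 0\<close> the truncated \<open>\<kappa> - 1\<close> is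
      harmless because the factor \<open>1 - t ^ 0\<close> is zero.\<close>
    have fst: "(1 - t ^ \<kappa>) * ext_prob t r (\<kappa> - 1) = (1 - t ^ \<kappa>) * qfac t r / qfac (t\<^sup>2) (Suc j div 2)"
      using r by (cases \<kappa>) (auto simp: ext_prob_def)
    show ?thesis
    proof (cases "even j")
      case True
      then obtain a where j: "j = 2 * a" by blast
      show ?thesis
      proof (cases a)
        case 0
        then show ?thesis
          unfolding fst using r j by (simp add: ext_prob_def qfac_Suc) (simp add: algebra_simps)
      next
        case (Suc b)
        have e: "ext_prob t r (Suc \<kappa>) = qfac t r / qfac (t\<^sup>2) b"
          using r j Suc by (simp add: ext_prob_def)
        have b: "qfac (t\<^sup>2) a = qfac (t\<^sup>2) b * (1 - t ^ j)"
          using j Suc by (simp add: qfac_Suc power2_eq_square power_mult_distrib mult_2 power_add)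
        have nz: "1 - t ^ j \<noteq> 0" using tn[of "Suc (2 * b)"] j Suc by simp
        have e2: "ext_prob t r (Suc \<kappa>) = qfac t r * (1 - t ^ j) / qfac (t\<^sup>2) a"
          unfolding e b using nz by simp
        have d: "Suc j div 2 = a" using j by simp
        have "ext_prob t (Suc r) \<kappa> = qfac t r * (1 - t ^ Suc r) / qfac (t\<^sup>2) a"
          using r j by (simp add: ext_prob_def qfac_Suc)
        moreover have "ext_prob t r \<kappa> = qfac t r / qfac (t\<^sup>2) a"
          using r j by (simp add: ext_prob_def)
        moreover have "1 - t ^ Suc r = (1 - t ^ \<kappa>) + t ^ \<kappa> * (1 - t) + t ^ Suc \<kappa> * (1 - t ^ j)"
          using r by (simp add: algebra_simps power_add)
        ultimately show ?thesis
          unfolding fst e2 d by (simp only: gen(1))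
      qed
    next
      case False
      then obtain a where j: "j = Suc (2 * a)" by (metis oddE Suc_eq_plus1)
      have b: "qfac (t\<^sup>2) (Suc a) = qfac (t\<^sup>2) a * (1 - t ^ Suc j)"
        using j by (simp add: qfac_Suc power2_eq_square power_mult_distrib mult_2 power_add)
      have nz: "1 - t ^ Suc j \<noteq> 0" by (rule tn)
      have d: "Suc j div 2 = Suc a" using j by simp
      have "ext_prob t (Suc r) \<kappa> = qfac t r * (1 - t ^ Suc r) / qfac (t\<^sup>2) (Suc a)"
        using r j by (simp add: ext_prob_def qfac_Suc)
      moreover have "ext_prob t r \<kappa> = qfac t r * (1 - t ^ Suc j) / qfac (t\<^sup>2) (Suc a)"
        unfolding b using r j nz by (simp add: ext_prob_def)
      moreover have "ext_prob t r (Suc \<kappa>) = qfac t r * (1 - t ^ Suc j) / qfac (t\<^sup>2) (Suc a)"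
        unfolding b using r j nz by (simp add: ext_prob_def)
      moreover have "1 - t ^ Suc r = (1 - t ^ \<kappa>) + t ^ \<kappa> * (1 - t) * (1 - t ^ Suc j) + t ^ Suc \<kappa> * (1 - t ^ Suc j)"
        using r by (simp add: algebra_simps power_add)
      ultimately show ?thesis
        unfolding fst d by (simp only: gen(2))
    qed
  next
    case False
    then show ?thesis
      by (cases "\<kappa> = Suc r") (auto simp: ext_prob_def qfac_Suc)
  qed
qed

text \<open>The parametrization of all solutions by \<open>(Y, q, t)\<close> restricts to each type,
  since bordering preserves the type.\<close>

lemma sum_wall_type_border:
  fixes C :: "'a :: {field, finite} mat" and g :: "nat \<Rightarrow> real"
  assumes C: "alternating_mat C"
  shows "(\<Sum>Z\<in>wall_type (border_zero C) \<tau>. g (mrank Z)) =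
    (\<Sum>Y\<in>wall_type C \<tau>. \<Sum>q\<in>carrier_vec (dim_row C). \<Sum>t\<in>UNIV. g (mrank (border_mat t q q (Y\<^sup>T))))"
proof -
  let ?d = "dim_row C" and ?f = "\<lambda>(Y, q, t). border_mat t q (q + Y *\<^sub>v (C *\<^sub>v q)) Y"
  let ?S = "wall_type C \<tau> \<times> carrier_vec ?d \<times> UNIV"
  note bij = bij_betw_border_wall_forms[OF C]
  have Cc: "C \<in> carrier_mat ?d ?d" by (rule alternating_mat_square[OF C])
  have type_iff: "?f (Y, q, t) \<in> wall_type (border_zero C) \<tau> \<longleftrightarrow> Y \<in> wall_type C \<tau>"
    if "Y \<in> wall_forms C" "dim_vec q = ?d" for Y q t
  proof -
    have Y: "Y \<in> carrier_mat ?d ?d" using that by (simp add: wall_forms_def)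
    have "mrank (border_zero C * (?f (Y, q, t) * border_zero C) ^\<^sub>m i) = mrank (C * (Y * C) ^\<^sub>m i)" for i
    proof -
      have "border_zero C * (?f (Y, q, t) * border_zero C) ^\<^sub>m i = border_zero (C * (Y * C) ^\<^sub>m i)"
        unfolding prod.case by (rule border_gram_power[OF Cc Y]) (use that Y in auto)
      moreover have "mrank (border_zero (C * (Y * C) ^\<^sub>m i)) = mrank (C * (Y * C) ^\<^sub>m i)"
        unfolding border_zero_def by (rule mrank_border_zero) auto
      ultimately show ?thesis by simp
    qed
    moreover have "?f (Y, q, t) \<in> wall_forms (border_zero C)"
      using border_mem_wall_forms_iff[OF C Y that(2)] that Y by simp
    ultimately show ?thesis using that(1) by (simp add: wall_type_def)
  qed
  have sub: "?S \<subseteq> wall_forms C \<times> carrier_vec ?d \<times> UNIV"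
    by (auto simp: wall_type_def)
  have img: "?f ` ?S = wall_type (border_zero C) \<tau>"
  proof (intro equalityI subsetI)
    fix Z assume "Z \<in> ?f ` ?S"
    then obtain Y q t where "Z = ?f (Y, q, t)" "Y \<in> wall_type C \<tau>" "dim_vec q = ?d" by auto
    then show "Z \<in> wall_type (border_zero C) \<tau>"
      using type_iff[of Y q t] by (simp add: wall_type_def)
  next
    fix Z assume Z: "Z \<in> wall_type (border_zero C) \<tau>"
    then have "Z \<in> ?f ` (wall_forms C \<times> carrier_vec ?d \<times> UNIV)"
      unfolding bij_betw_imp_surj_on[OF bij] by (simp add: wall_type_def)
    then obtain Y q t where *: "Z = ?f (Y, q, t)" "Y \<in> wall_forms C" "dim_vec q = ?d" by auto
    then have "Y \<in> wall_type C \<tau>" using Z type_iff[OF *(2,3), of t] unfolding *(1) by blast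
    then show "Z \<in> ?f ` ?S" using * by (intro image_eqI[of _ _ "(Y, q, t)"]) auto
  qed
  have "(\<Sum>Z\<in>wall_type (border_zero C) \<tau>. g (mrank Z)) = (\<Sum>x\<in>?S. g (mrank (?f x)))"
    unfolding img[symmetric]
    by (rule sum.reindex_cong[OF inj_on_subset[OF bij_betw_imp_inj_on[OF bij] sub]]) auto
  also have "\<dots> = (\<Sum>(Y, q, t)\<in>?S. g (mrank (border_mat t q q (Y\<^sup>T))))"
  proof (rule sum.cong[OF refl])
    fix x :: "'a mat \<times> 'a vec \<times> 'a" assume "x \<in> ?S"
    then obtain Y q t where x: "x = (Y, q, t)" "Y \<in> wall_forms C" "dim_vec q = ?d"
      by (auto simp: wall_type_def)
    then show "g (mrank (?f x)) = (case x of (Y, q, t) \<Rightarrow> g (mrank (border_mat t q q (Y\<^sup>T))))"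
      by (simp add: mrank_border_wall[OF C])
  qed
  finally show ?thesis by (simp add: sum.cartesian_product)
qed

text \<open>The power of \<open>q\<close> counts all \<open>r\<close>-fold borderings: the step from
  size \<open>d\<close> offers \<open>q ^ Suc d\<close> pairs of row and corner, and
  \<open>d\<close> grows by 1 each time. The factor \<open>ext_prob\<close> is the proportion that
  ends nonsingular.\<close>

lemma card_inj_wall_type_border:
  fixes C :: "'a :: {field, finite} mat"
  assumes "alternating_mat C"
  defines "q \<equiv> real CARD('a)"
  shows "real (card {Y \<in> wall_type ((border_zero ^^ r) C) \<tau>. inj_mat Y}) =
    (\<Sum>Y\<in>wall_type C \<tau>. q ^ (r * dim_row C + \<Sum>{..r}) * ext_prob (1 / q) r (dim_row C - mrank Y))"
  using assms(1)
proof (induction r arbitrary: C)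
  case 0
  have "inj_mat Y \<longleftrightarrow> dim_row C - mrank Y = 0" if "Y \<in> wall_type C \<tau>" for Y
  proof -
    have "Y \<in> carrier_mat (dim_row C) (dim_row C)"
      using that by (simp add: wall_type_def wall_forms_def)
    then have "dim_col Y = dim_row C" by (rule carrier_matD)
    then show ?thesis using mrank_le_dim_col[of Y] by (auto simp: inj_mat_iff_mrank)
  qed
  then have "{Y \<in> wall_type C \<tau>. inj_mat Y} = {Y \<in> wall_type C \<tau>. dim_row C - mrank Y = 0}"
    by auto
  then have "real (card {Y \<in> wall_type C \<tau>. inj_mat Y}) = (\<Sum>Y\<in>wall_type C \<tau>. if dim_row C - mrank Y = 0 then 1 else 0)"
    by (simp add: sum.If_cases Int_def)
  also have "\<dots> = (\<Sum>Y\<in>wall_type C \<tau>. ext_prob (1 / q) 0 (dim_row C - mrank Y))"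
    by (intro sum.cong refl) (simp add: ext_prob_def)
  finally show ?case by simp
next
  case (Suc r)
  let ?d = "dim_row C" and ?t = "1 / q"
  let ?g = "\<lambda>x. q ^ (r * Suc ?d + \<Sum>{..r}) * ext_prob ?t r (Suc ?d - x)"
  have q: "1 < q" using one_less_card_field[where 'a = 'a] by (simp add: q_def)
  \<comment> \<open>The innermost bordering is split off, so the induction hypothesis is applied to
    \<open>border_zero C\<close>, whose size is larger by 1.\<close>
  have "real (card {Y \<in> wall_type ((border_zero ^^ Suc r) C) \<tau>. inj_mat Y}) =
      (\<Sum>Z\<in>wall_type (border_zero C) \<tau>. ?g (mrank Z))"
    unfolding funpow_Suc_right o_def
    using Suc.IH[OF alternating_border_zero[OF Suc.prems]] by simp
  also have "\<dots> = (\<Sum>Y\<in>wall_type C \<tau>. \<Sum>v\<in>carrier_vec ?d. \<Sum>t\<in>UNIV. ?g (mrank (border_mat t v v (Y\<^sup>T))))"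
    by (rule sum_wall_type_border[OF Suc.prems])
  also have "\<dots> = (\<Sum>Y\<in>wall_type C \<tau>. q ^ (Suc r * ?d + \<Sum>{..Suc r}) * ext_prob ?t (Suc r) (?d - mrank Y))"
  proof (rule sum.cong[OF refl])
    fix Y assume "Y \<in> wall_type C \<tau>"
    then have Y: "Y \<in> wall_forms C" "Y \<in> carrier_mat ?d ?d"
      by (auto simp: wall_type_def wall_forms_def)
    define \<rho> \<kappa> where "\<rho> = mrank Y" and "\<kappa> = ?d - mrank Y"
    have d: "?d = \<rho> + \<kappa>" using mrank_le_dim_col[of Y] Y by (simp add: \<rho>_def \<kappa>_def)
    have "(\<Sum>v\<in>carrier_vec ?d. \<Sum>t\<in>UNIV. ?g (mrank (border_mat t v v (Y\<^sup>T)))) =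
        (q ^ ?d - q ^ \<rho>) * q * ?g (Suc (Suc \<rho>)) + q ^ \<rho> * ((q - 1) * ?g (Suc \<rho>) + ?g \<rho>)"
      unfolding q_def \<rho>_def mrank_transpose[of Y, symmetric]
      by (rule sum_border_rank) (use Y wall_forms_kernel_transpose[OF Suc.prems Y(1)] in auto)
    also have "\<dots> = (q ^ ?d - q ^ \<rho>) * q * (q ^ (r * Suc ?d + \<Sum>{..r}) * ext_prob ?t r (\<kappa> - 1)) +
        q ^ \<rho> * ((q - 1) * (q ^ (r * Suc ?d + \<Sum>{..r}) * ext_prob ?t r \<kappa>) +
        q ^ (r * Suc ?d + \<Sum>{..r}) * ext_prob ?t r (Suc \<kappa>))"
    proof -
      have "Suc ?d - Suc (Suc \<rho>) = \<kappa> - 1" "Suc ?d - Suc \<rho> = \<kappa>" "Suc ?d - \<rho> = Suc \<kappa>"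
        using d by auto
      then show ?thesis by (simp only:)
    qed
    also have "(q ^ ?d - q ^ \<rho>) * q * (q ^ (r * Suc ?d + \<Sum>{..r}) * ext_prob ?t r (\<kappa> - 1)) +
        q ^ \<rho> * ((q - 1) * (q ^ (r * Suc ?d + \<Sum>{..r}) * ext_prob ?t r \<kappa>) +
        q ^ (r * Suc ?d + \<Sum>{..r}) * ext_prob ?t r (Suc \<kappa>)) =
        q ^ (r * Suc ?d + \<Sum>{..r}) * q ^ Suc ?d * ((1 - ?t ^ \<kappa>) * ext_prob ?t r (\<kappa> - 1) +
          ?t ^ \<kappa> * (1 - ?t) * ext_prob ?t r \<kappa> + ?t ^ Suc \<kappa> * ext_prob ?t r (Suc \<kappa>))"
    proof -
      \<comment> \<open>Dividing by the number \<open>q ^ Suc d\<close> of borderings turns the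
        counts into transition probabilities.\<close>
      have "q ^ Suc ?d * (1 - ?t ^ \<kappa>) = (q ^ ?d - q ^ \<rho>) * q"
        "q ^ Suc ?d * (?t ^ \<kappa> * (1 - ?t)) = q ^ \<rho> * (q - 1)"
        "q ^ Suc ?d * ?t ^ Suc \<kappa> = q ^ \<rho>"
        unfolding d using q by (auto simp: power_add power_divide field_simps)
      note e = this
      have gen: "a * (x * e1 + y * e2 + z * e3) = (a * x) * e1 + (a * y) * e2 + (a * z) * e3"
        "A * (K * e1) + B * (D * (K * e2) + K * e3) = K * (A * e1 + B * D * e2 + B * e3)"
        for a x y z e1 e2 e3 A B D K :: real
        by (simp_all add: algebra_simps)
      show ?thesis unfolding gen(2) mult.assoc[of "q ^ (r * Suc ?d + \<Sum>{..r})"] gen(1) e ..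
    qed
    also have "(1 - ?t ^ \<kappa>) * ext_prob ?t r (\<kappa> - 1) +
          ?t ^ \<kappa> * (1 - ?t) * ext_prob ?t r \<kappa> + ?t ^ Suc \<kappa> * ext_prob ?t r (Suc \<kappa>) = ext_prob ?t (Suc r) \<kappa>"
      using q by (intro ext_prob_Suc[symmetric]) auto
    also have "q ^ (r * Suc ?d + \<Sum>{..r}) * q ^ Suc ?d = q ^ (Suc r * ?d + \<Sum>{..Suc r})"
      by (simp add: power_add[symmetric] algebra_simps)
    finally show "(\<Sum>v\<in>carrier_vec ?d. \<Sum>t\<in>UNIV. ?g (mrank (border_mat t v v (Y\<^sup>T)))) =
        q ^ (Suc r * ?d + \<Sum>{..Suc r}) * ext_prob ?t (Suc r) (?d - mrank Y)"
      by (simp only: \<kappa>_def)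
  qed
  finally show ?case .
qed

subsection \<open>Reduction to nondegenerate alternating forms\<close>

text \<open>A change of basis \<open>g\<close> of the form acts on solutions through its inverse
  \<open>h\<close>, as \<open>Y \<mapsto> h * Y * h\<^sup>T\<close>. The opposite inequality comes
  from exchanging \<open>g\<close> and \<open>h\<close>.\<close>

lemma card_inj_wall_type_congruence_le:
  fixes C :: "'a :: {field, finite} mat"
  assumes C: "C \<in> carrier_mat d d" and g: "g \<in> carrier_mat d d" and h: "h \<in> carrier_mat d d"
    and gh: "g * h = 1\<^sub>m d" and hg: "h * g = 1\<^sub>m d" and inj: "inj_mat g" "inj_mat h"
  shows "card {Y \<in> wall_type C \<tau>. inj_mat Y} \<le>
    card {Y \<in> wall_type (g\<^sup>T * C * g) \<tau>. inj_mat Y}"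
proof (rule card_inj_on_le[where f = "\<lambda>Y. h * Y * h\<^sup>T"])
  have gh': "g * (h * X) = X" if "dim_row X = d" for X
    using g h that gh by (metis carrier_matD mat_assoc left_mult_one_mat')
  have hg': "h * (g * X) = X" if "dim_row X = d" for X
    using g h that hg by (metis carrier_matD mat_assoc left_mult_one_mat')
  have htgt: "h\<^sup>T * g\<^sup>T = 1\<^sub>m d"
    using transpose_mult'[of g h] g h gh by simp
  have htgt': "h\<^sup>T * (g\<^sup>T * X) = X" if "dim_row X = d" for X
    using g h that htgt by (metis carrier_matD index_transpose_mat mat_assoc left_mult_one_mat')
  have gtht: "g\<^sup>T * h\<^sup>T = 1\<^sub>m d"
    using transpose_mult'[of h g] g h hg by simp
  have dims [simp]: "dim_row g = d" "dim_col g = d" "dim_row h = d" "dim_col h = d"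
    "dim_row C = d" "dim_col C = d"
    using g h C by auto
  let ?f = "\<lambda>Y. h * Y * h\<^sup>T" and ?C = "g\<^sup>T * C * g"
  have mem: "?f Y \<in> wall_type ?C \<tau> \<and> inj_mat (?f Y)" if "Y \<in> wall_type C \<tau>" "inj_mat Y" for Y
  proof -
    have Yc: "Y \<in> carrier_mat d d" and Yw: "Y - Y\<^sup>T = Y * C * Y\<^sup>T"
      and Yt: "\<And>i. mrank (C * (Y * C) ^\<^sub>m i) = \<tau> i"
      using that(1) by (auto simp: wall_type_def wall_forms_def)
    have Yd [simp]: "dim_row Y = d" "dim_col Y = d" using Yc by auto
    have ft: "(?f Y)\<^sup>T = h * Y\<^sup>T * h\<^sup>T"
      by (simp add: transpose_mult' mat_assoc)
    have fC: "?f Y * ?C = h * (Y * C * g)"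
      by (simp add: mat_assoc htgt')
    have "?f Y - (?f Y)\<^sup>T = h * (Y - Y\<^sup>T) * h\<^sup>T"
      unfolding ft using Yc h
      by (simp add: mult_minus_distrib_mat[of _ d d] minus_mult_distrib_mat[of _ d d _ _ d])
    also have "\<dots> = ?f Y * ?C * (?f Y)\<^sup>T"
      unfolding ft fC Yw by (simp add: mat_assoc gh')
    finally have wf: "?f Y \<in> wall_forms ?C"
      by (auto simp: wall_forms_def)
    have pow: "(?f Y * ?C) ^\<^sub>m i = h * ((Y * C) ^\<^sub>m i * g)" for i
    proof (induction i)
      case 0
      then show ?case using hg by simp
    next
      case (Suc i)
      show ?case
        unfolding pow_mat.simps Suc unfolding fC by (simp add: mat_assoc gh')
    qed
    have "mrank (?C * (?f Y * ?C) ^\<^sub>m i) = \<tau> i" for i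
    proof -
      have "?C * (?f Y * ?C) ^\<^sub>m i = g\<^sup>T * ((C * (Y * C) ^\<^sub>m i) * g)"
        unfolding pow by (simp add: mat_assoc gh')
      also have "mrank \<dots> = mrank (C * (Y * C) ^\<^sub>m i)"
        using inj(1) inj_mat_transpose_square[of g] inj_iff_surj_square[of g]
        by (simp add: mrank_mult_inj mrank_mult_surj)
      finally show ?thesis using Yt by simp
    qed
    moreover have "inj_mat (?f Y)"
      using inj(2) that(2) inj_mat_transpose_square[of h] by (intro inj_mat_mult) auto
    ultimately show ?thesis using wf by (simp add: wall_type_def)
  qed
  then show "?f ` {Y \<in> wall_type C \<tau>. inj_mat Y} \<subseteq> {Y \<in> wall_type ?C \<tau>. inj_mat Y}" by auto
  show "inj_on ?f {Y \<in> wall_type C \<tau>. inj_mat Y}"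
  proof (rule inj_on_inverseI[where g = "\<lambda>Z. g * Z * g\<^sup>T"])
    fix Y assume "Y \<in> {Y \<in> wall_type C \<tau>. inj_mat Y}"
    then have "Y \<in> carrier_mat d d" by (simp add: wall_type_def wall_forms_def)
    then have [simp]: "dim_row Y = d" "dim_col Y = d" by auto
    show "g * ?f Y * g\<^sup>T = Y"
      by (simp add: mat_assoc gh' htgt)
  qed
qed simp

lemma card_inj_wall_type_congruence:
  fixes C :: "'a :: {field, finite} mat"
  assumes C: "C \<in> carrier_mat d d" and g: "g \<in> carrier_mat d d" "inj_mat g"
  shows "card {Y \<in> wall_type (g\<^sup>T * C * g) \<tau>. inj_mat Y} =
    card {Y \<in> wall_type C \<tau>. inj_mat Y}"
proof (rule antisym)
  obtain h where h: "h \<in> carrier_mat d d" "h * g = 1\<^sub>m d" "g * h = 1\<^sub>m d" "inj_mat h"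
    using square_inj_mat_inverse[OF g(2,1)] by blast
  let ?C = "g\<^sup>T * C * g"
  have "h\<^sup>T * ?C * h = (h\<^sup>T * g\<^sup>T) * C * (g * h)"
    using C g h(1) by (simp add: mat_assoc)
  also have "h\<^sup>T * g\<^sup>T = 1\<^sub>m d"
    using transpose_mult'[of g h] g h by simp
  finally have undo_g: "h\<^sup>T * ?C * h = C"
    using C h by simp
  show "card {Y \<in> wall_type ?C \<tau>. inj_mat Y} \<le> card {Y \<in> wall_type C \<tau>. inj_mat Y}"
    using card_inj_wall_type_congruence_le[of ?C d h g \<tau>] C g h unfolding undo_g by simp
  show "card {Y \<in> wall_type C \<tau>. inj_mat Y} \<le> card {Y \<in> wall_type ?C \<tau>. inj_mat Y}"
    using card_inj_wall_type_congruence_le[of C d g h \<tau>] C g h by simp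
qed

lemma mrank_congruence:
  fixes C :: "'a :: {field, finite} mat"
  assumes "C \<in> carrier_mat d d" "g \<in> carrier_mat d d" "inj_mat g"
  shows "mrank (g\<^sup>T * C * g) = mrank C"
proof -
  have "inj_mat (g\<^sup>T)" "surj_mat g"
    using assms inj_mat_transpose_square[of g] inj_iff_surj_square[of g] by auto
  then show ?thesis
    using assms by (simp add: mrank_mult_surj mrank_mult_inj)
qed

lemma inj_mat_one [simp]: "inj_mat (1\<^sub>m d :: 'a :: comm_ring_1 mat)"
  by (rule inj_matI) simp

lemma mrank_one [simp]: "mrank (1\<^sub>m d :: 'a :: {field, finite} mat) = d"
  by (metis inj_mat_one inj_mat_iff_mrank index_one_mat(3))

text \<open>A kernel vector, taken as the first vector of a basis, contributes a zero column, and by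
  alternation a zero row.\<close>

lemma alternating_split_kernel:
  fixes C :: "'a :: {field, finite} mat"
  assumes C: "alternating_mat C" "dim_row C = Suc d" and ninj: "\<not> inj_mat C"
  shows "\<exists>g \<in> carrier_mat (Suc d) (Suc d). \<exists>C1. inj_mat g \<and> alternating_mat C1 \<and> dim_row C1 = d \<and>
    g\<^sup>T * C * g = border_zero C1"
proof -
  have sq: "dim_col C = Suc d" using alternating_mat_dim[OF C(1)] C(2) by simp
  obtain v where v: "dim_vec v = Suc d" "C *\<^sub>v v = 0\<^sub>v (Suc d)" "v \<noteq> 0\<^sub>v (Suc d)"
    using ninj inj_matI[of C] sq C(2) by auto
  obtain L where L: "L \<in> carrier_mat (Suc d) d" "inj_mat (add_col v L)"
    using extend_to_inj_mat[OF v(1,3)] by blast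
  let ?g = "add_col v L" and ?C1 = "L\<^sup>T * C * L"
  have alt: "alternating_mat ?C1" using L C by (intro alternating_mat_congruence) auto
  have "?g\<^sup>T * C * ?g = border_zero ?C1"
  proof (rule eq_mat_by_vec)
    fix x :: "'a vec" assume "dim_vec x = dim_col (border_zero ?C1)"
    then obtain a y where x: "x = vCons a y" "dim_vec y = d"
      using ex_vCons[of x d] L by auto
    have z: "a \<cdot>\<^sub>v 0\<^sub>v (Suc d) = (0\<^sub>v (Suc d) :: 'a vec)" by auto
    have "C *\<^sub>v (?g *\<^sub>v x) = C *\<^sub>v (L *\<^sub>v y)"
      using x v z sq L C(2) by (simp add: add_col_mult_vCons mult_mat_vec_add mult_mat_vec_smult)
    moreover have "v \<bullet> (C *\<^sub>v (L *\<^sub>v y)) = 0"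
      using alternating_mat_swap[OF C(1), of v "L *\<^sub>v y"] v L C(2) by (simp add: scalar_prod_left_zero)
    ultimately show "?g\<^sup>T * C * ?g *\<^sub>v x = border_zero ?C1 *\<^sub>v x"
      using x v L C(2) sq
      by (simp add: mat_vec_assoc transpose_add_col_mult border_zero_mult)
  qed (use L in auto)
  then show ?thesis using L alt by (intro bexI[of _ ?g] exI[of _ ?C1]) auto
qed

lemma border_one_congruence:
  fixes C :: "'a :: field mat"
  assumes C: "C \<in> carrier_mat d d" and g: "g \<in> carrier_mat d d" "inj_mat g"
  shows "\<exists>G \<in> carrier_mat (Suc d) (Suc d). inj_mat G \<and>
    G\<^sup>T * border_zero C * G = border_zero (g\<^sup>T * C * g)"
proof (intro bexI conjI)
  let ?G = "border_mat 1 (0\<^sub>v d) (0\<^sub>v d) g"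
  have mult: "border_mat 1 (0\<^sub>v d) (0\<^sub>v d) k *\<^sub>v vCons a v = vCons a (k *\<^sub>v v)"
    if "k \<in> carrier_mat d d" "dim_vec v = d" for a v and k :: "'a mat"
    using that by (subst border_mat_mult_vCons) (auto simp: scalar_prod_left_zero)
  have t: "?G\<^sup>T = border_mat 1 (0\<^sub>v d) (0\<^sub>v d) (g\<^sup>T)"
    using g by (intro transpose_border_mat) auto
  show "?G \<in> carrier_mat (Suc d) (Suc d)" using g by auto
  show "inj_mat ?G"
  proof (rule inj_matI)
    fix u :: "'a vec" assume u: "dim_vec u = dim_col ?G" "?G *\<^sub>v u = 0\<^sub>v (dim_row ?G)"
    then obtain a v where av: "u = vCons a v" "dim_vec v = d" using ex_vCons[of u d] g by auto
    then show "u = 0\<^sub>v (dim_col ?G)"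
      using u g inj_matD[OF g(2), of v] by (simp add: mult zero_vec_Suc)
  qed
  show "?G\<^sup>T * border_zero C * ?G = border_zero (g\<^sup>T * C * g)"
  proof (rule eq_mat_by_vec)
    fix x :: "'a vec" assume "dim_vec x = dim_col (border_zero (g\<^sup>T * C * g))"
    then obtain a y where x: "x = vCons a y" "dim_vec y = d"
      using ex_vCons[of x d] g by auto
    then show "?G\<^sup>T * border_zero C * ?G *\<^sub>v x = border_zero (g\<^sup>T * C * g) *\<^sub>v x"
      using C g unfolding t by (simp add: mat_vec_assoc mult border_zero_mult)
  qed (use C g in auto)
qed

text \<open>Splits off the radical one vector at a time. The nondegenerate part \<open>J\<close>
  stays abstract; accordingly the final induction is for all nondegenerate alternating forms of a
  given size.\<close>

lemma alternating_normal_form: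
  fixes C :: "'a :: {field, finite} mat"
  assumes "alternating_mat C" "dim_row C = d"
  shows "\<exists>g \<in> carrier_mat d d. \<exists>J. inj_mat g \<and> alternating_mat J \<and> inj_mat J \<and> dim_row J = mrank C \<and>
    g\<^sup>T * C * g = (border_zero ^^ (d - mrank C)) J"
  using assms
proof (induction d arbitrary: C)
  case 0
  have "inj_mat C"
    using alternating_mat_dim[OF 0(1)] 0(2) by (intro inj_matI) auto
  moreover have "C \<in> carrier_mat 0 0" using alternating_mat_square[OF 0(1)] 0(2) by simp
  ultimately show ?case
    using 0 by (intro bexI[of _ "1\<^sub>m 0"] exI[of _ C]) (auto simp: inj_mat_iff_mrank)
next
  case (Suc d)
  have Cc: "C \<in> carrier_mat (Suc d) (Suc d)"
    using alternating_mat_square[OF Suc.prems(1)] Suc.prems(2) by simp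
  show ?case
  proof (cases "inj_mat C")
    case True
    then show ?thesis
      using Suc.prems Cc by (intro bexI[of _ "1\<^sub>m (Suc d)"] exI[of _ C]) (auto simp: inj_mat_iff_mrank)
  next
    case False
    obtain g1 C1 where 1: "g1 \<in> carrier_mat (Suc d) (Suc d)" "inj_mat g1" "alternating_mat C1"
      "dim_row C1 = d" "g1\<^sup>T * C * g1 = border_zero C1"
      using alternating_split_kernel[OF Suc.prems False] by blast
    have C1: "C1 \<in> carrier_mat d d" using alternating_mat_square[OF 1(3)] 1(4) by simp
    have rank: "mrank C1 = mrank C"
      using mrank_congruence[OF Cc 1(1,2)] mrank_border_zero[OF C1] C1
      unfolding 1(5) border_zero_def by simp
    have le: "mrank C1 \<le> d" using mrank_le_dim_col[of C1] C1 by simp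
    obtain g2 J where 2: "g2 \<in> carrier_mat d d" "inj_mat g2" "alternating_mat J" "inj_mat J"
      "dim_row J = mrank C1" "g2\<^sup>T * C1 * g2 = (border_zero ^^ (d - mrank C1)) J"
      using Suc.IH[OF 1(3,4)] by blast
    obtain G where G: "G \<in> carrier_mat (Suc d) (Suc d)" "inj_mat G"
      "G\<^sup>T * border_zero C1 * G = border_zero (g2\<^sup>T * C1 * g2)"
      using border_one_congruence[OF C1 2(1,2)] by blast
    have "(g1 * G)\<^sup>T * C * (g1 * G) = G\<^sup>T * (g1\<^sup>T * C * g1) * G"
      using 1(1) G(1) Cc by (simp add: transpose_mult' mat_assoc)
    also have "\<dots> = (border_zero ^^ Suc (d - mrank C1)) J"
      unfolding 1(5) G(3) 2(6) by simp
    also have "Suc (d - mrank C1) = Suc d - mrank C"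
      using rank le by simp
    finally have "(g1 * G)\<^sup>T * C * (g1 * G) = (border_zero ^^ (Suc d - mrank C)) J" .
    moreover have "inj_mat (g1 * G)" using 1(1,2) G(1,2) by (intro inj_mat_mult) auto
    ultimately show ?thesis
      using 1(1) G(1) 2 rank by (intro bexI[of _ "g1 * G"] exI[of _ J]) auto
  qed
qed

text \<open>For invertible \<open>J\<close> the rank of \<open>J (Y J)\<close> is that of
  \<open>Y\<close>. Hence all solutions of one type have the same corank
  \<open>e - \<tau> 1\<close>, and the sum over starting points of the chain collapses to a multiple
  of their number.\<close>

lemma card_inj_wall_type_degenerate:
  fixes C :: "'a :: {field, finite} mat"
  assumes C: "alternating_mat C" "dim_row C = k"
  defines "q \<equiv> real CARD('a)" and "e \<equiv> mrank C"
  shows "\<exists>J :: 'a mat. alternating_mat J \<and> inj_mat J \<and> dim_row J = e \<and>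
    real (card {Y \<in> wall_type C \<tau>. inj_mat Y}) =
      real (card (wall_type J \<tau>)) * q ^ ((k - e) * e + \<Sum>{..k - e}) * ext_prob (1 / q) (k - e) (e - \<tau> 1)"
proof -
  have Cc: "C \<in> carrier_mat k k" using alternating_mat_square[OF C(1)] C(2) by simp
  obtain g J where g: "g \<in> carrier_mat k k" "inj_mat g" and J: "alternating_mat J" "inj_mat J" "dim_row J = e"
    and gJ: "g\<^sup>T * C * g = (border_zero ^^ (k - e)) J"
    using alternating_normal_form[OF C] unfolding e_def by blast
  have Jc: "J \<in> carrier_mat e e" using alternating_mat_square[OF J(1)] J(3) by simp
  have "mrank Y = \<tau> 1" if "Y \<in> wall_type J \<tau>" for Y
  proof -
    have Y: "Y \<in> carrier_mat e e" using that J(3) by (simp add: wall_type_def wall_forms_def)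
    have "\<tau> 1 = mrank (J * (Y * J) ^\<^sub>m 1)" using that unfolding wall_type_def by (metis (mono_tags, lifting) mem_Collect_eq)
    also have "\<dots> = mrank (J * (Y * J))" using Jc Y by (simp add: left_mult_one_mat[of _ e e])
    also have "\<dots> = mrank Y"
      using Jc Y J(2) inj_iff_surj_square[of J] by (simp add: mrank_mult_inj mrank_mult_surj)
    finally show ?thesis by simp
  qed
  then have "(\<Sum>Y\<in>wall_type J \<tau>. q ^ ((k - e) * e + \<Sum>{..k - e}) * ext_prob (1 / q) (k - e) (e - mrank Y)) =
      real (card (wall_type J \<tau>)) * q ^ ((k - e) * e + \<Sum>{..k - e}) * ext_prob (1 / q) (k - e) (e - \<tau> 1)"
    by simp
  moreover have "real (card {Y \<in> wall_type C \<tau>. inj_mat Y}) =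
      (\<Sum>Y\<in>wall_type J \<tau>. q ^ ((k - e) * e + \<Sum>{..k - e}) * ext_prob (1 / q) (k - e) (e - mrank Y))"
    using card_inj_wall_type_border[OF J(1), of "k - e" \<tau>] card_inj_wall_type_congruence[OF Cc g, of \<tau>]
    unfolding gJ J(3) q_def by simp
  ultimately have "real (card {Y \<in> wall_type C \<tau>. inj_mat Y}) =
      real (card (wall_type J \<tau>)) * q ^ ((k - e) * e + \<Sum>{..k - e}) * ext_prob (1 / q) (k - e) (e - \<tau> 1)"
    by (rule trans[rotated])
  then show ?thesis using J by blast
qed

subsection \<open>Parametrization by injective matrices\<close>

definition inj_mats :: "nat \<Rightarrow> nat \<Rightarrow> 'a :: comm_ring_1 mat set" where
  "inj_mats d k = {W \<in> carrier_mat d k. inj_mat W}"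

lemma finite_inj_mats [simp]: "finite (inj_mats d k :: 'a :: {comm_ring_1, finite} mat set)"
  by (rule finite_subset[of _ "carrier_mat d k"]) (auto simp: inj_mats_def)

text \<open>This explains the loss of two columns: up to outer factors that do not change the rank,
  the power \<open>i + 2\<close> for \<open>Z = W * Y * W\<^sup>T\<close> is the \<open>i\<close>-th
  matrix in the type of \<open>Y\<close>.\<close>

lemma wall_power_factor:
  fixes J :: "'a :: comm_ring_1 mat"
  assumes W: "W \<in> carrier_mat d k" and Y: "Y \<in> carrier_mat k k" and J: "J \<in> carrier_mat d d"
  defines "C \<equiv> W\<^sup>T * J * W"
  shows "(W * Y * W\<^sup>T * J) ^\<^sub>m Suc (Suc i) = (W * Y) * (C * (Y * C) ^\<^sub>m i) * (Y * W\<^sup>T * J)"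
proof (induction i)
  case 0
  have "(W * Y * W\<^sup>T * J) ^\<^sub>m Suc (Suc 0) =
      W * Y * W\<^sup>T * J * (W * Y * W\<^sup>T * J)"
    using W by simp
  also have "\<dots> = (W * Y) * (C * (Y * C) ^\<^sub>m 0) * (Y * W\<^sup>T * J)"
    using W Y J by (simp add: C_def mat_assoc)
  finally show ?case .
next
  case (Suc i)
  have "(W * Y * W\<^sup>T * J) ^\<^sub>m Suc (Suc (Suc i)) =
      (W * Y * W\<^sup>T * J) ^\<^sub>m Suc (Suc i) * (W * Y * W\<^sup>T * J)"
    by (rule pow_mat.simps(2))
  also have "\<dots> = (W * Y) * (C * (Y * C) ^\<^sub>m i) * (Y * W\<^sup>T * J) * (W * Y * W\<^sup>T * J)"
    unfolding Suc ..
  also have "\<dots> = (W * Y) * (C * ((Y * C) ^\<^sub>m i * (Y * C))) * (Y * W\<^sup>T * J)"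
    using W Y J by (simp add: C_def mat_assoc)
  finally show ?case by simp
qed

text \<open>A left inverse of \<open>W\<close> cancels \<open>W\<close> and \<open>W\<^sup>T\<close>
  from the equation. The ranks at 0 and 1 are automatically \<open>d\<close> and \<open>k\<close>,
  and all later ones are ranks for \<open>Y\<close>.\<close>

lemma wall_type_factor_iff:
  fixes J :: "'a :: {field, finite} mat"
  assumes J: "alternating_mat J" "inj_mat J" "dim_row J = d"
    and W: "W \<in> inj_mats d k" and Y: "Y \<in> carrier_mat k k" "inj_mat Y"
    and \<rho>: "\<rho> 0 = d" "\<rho> 1 = k"
  shows "W * Y * W\<^sup>T \<in> wall_type J \<rho> \<longleftrightarrow>
    Y \<in> wall_type (W\<^sup>T * J * W) (\<lambda>i. \<rho> (Suc (Suc i)))"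
proof -
  let ?Z = "W * Y * W\<^sup>T" and ?C = "W\<^sup>T * J * W"
  have Wc: "W \<in> carrier_mat d k" "inj_mat W" using W by (auto simp: inj_mats_def)
  have Jc: "J \<in> carrier_mat d d" using alternating_mat_square[OF J(1)] J(3) by simp
  have [simp]: "dim_row W = d" "dim_col W = k" "dim_row Y = k" "dim_col Y = k" "dim_row J = d" "dim_col J = d"
    using Wc Y Jc by auto
  obtain L where L: "L \<in> carrier_mat k d" "L * W = 1\<^sub>m k"
    using inj_mat_left_inverse[OF Wc(2)] by auto
  have [simp]: "dim_row L = k" "dim_col L = d" using L by auto
  have LW: "L * (W * X) = X" if "dim_row X = k" for X
    using L that by (metis mat_assoc left_mult_one_mat' \<open>dim_col L = d\<close> \<open>dim_row W = d\<close> \<open>dim_col W = k\<close>)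
  have WL: "W\<^sup>T * L\<^sup>T = 1\<^sub>m k"
    using transpose_mult'[of L W] L by simp
  have Zt: "?Z\<^sup>T = W * Y\<^sup>T * W\<^sup>T"
    by (simp add: transpose_mult' mat_assoc)
  have lhs: "?Z - ?Z\<^sup>T = W * (Y - Y\<^sup>T) * W\<^sup>T"
    unfolding Zt using Wc Y
    by (simp add: mult_minus_distrib_mat[of _ d k _ k] minus_mult_distrib_mat[of _ d k _ _ d])
  have rhs: "?Z * J * ?Z\<^sup>T = W * (Y * ?C * Y\<^sup>T) * W\<^sup>T"
    unfolding Zt by (simp add: mat_assoc)
  have cancel: "A = B" if "W * A * W\<^sup>T = W * B * W\<^sup>T" "A \<in> carrier_mat k k" "B \<in> carrier_mat k k" for A B
  proof -
    have [simp]: "dim_row A = k" "dim_col A = k" "dim_row B = k" "dim_col B = k" using that by auto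
    have "L * (W * A * W\<^sup>T) * L\<^sup>T = L * (W * B * W\<^sup>T) * L\<^sup>T"
      using that by simp
    then show ?thesis by (simp add: mat_assoc LW WL)
  qed
  have "Y - Y\<^sup>T \<in> carrier_mat k k" "Y * ?C * Y\<^sup>T \<in> carrier_mat k k"
    by (rule carrier_matI; simp)+
  then have "?Z - ?Z\<^sup>T = ?Z * J * ?Z\<^sup>T \<longleftrightarrow>
      Y - Y\<^sup>T = Y * ?C * Y\<^sup>T"
    unfolding lhs rhs using cancel by metis
  moreover have "?Z \<in> carrier_mat (dim_row J) (dim_row J)" "Y \<in> carrier_mat (dim_row ?C) (dim_row ?C)"
    by (rule carrier_matI; simp)+
  ultimately have forms: "?Z \<in> wall_forms J \<longleftrightarrow> Y \<in> wall_forms ?C"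
    unfolding wall_forms_def mem_Collect_eq by blast
  have surj: "surj_mat (W\<^sup>T)" "surj_mat J" "surj_mat Y"
    using Wc J(2) Y inj_iff_surj_square[of J] inj_iff_surj_square[of Y]
    by (auto simp: surj_mat_transpose_iff)
  have r0: "mrank (J * (?Z * J) ^\<^sub>m 0) = d"
    using J(2) by (simp add: right_mult_one_mat[of _ d d] inj_mat_iff_mrank)
  have r1: "mrank (J * (?Z * J) ^\<^sub>m Suc 0) = k"
  proof -
    have "J * (?Z * J) ^\<^sub>m Suc 0 = (J * W) * (Y * (W\<^sup>T * J))"
      by (simp add: mat_assoc)
    moreover have "mrank ((J * W) * (Y * (W\<^sup>T * J))) = mrank (J * W)"
      using surj by (intro mrank_mult_surj surj_mat_mult) auto
    moreover have "mrank (J * W) = k"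
      using J(2) Wc(2) by (simp add: mrank_mult_inj) (simp add: inj_mat_iff_mrank)
    ultimately show ?thesis by simp
  qed
  have r2: "mrank (J * (?Z * J) ^\<^sub>m Suc (Suc i)) = mrank (?C * (Y * ?C) ^\<^sub>m i)" for i
  proof -
    let ?G = "?C * (Y * ?C) ^\<^sub>m i"
    have "J * (?Z * J) ^\<^sub>m Suc (Suc i) = (J * (W * Y)) * (?G * (Y * (W\<^sup>T * J)))"
      unfolding wall_power_factor[OF Wc(1) Y(1) Jc] by (simp add: mat_assoc)
    moreover have "mrank ((J * (W * Y)) * (?G * (Y * (W\<^sup>T * J)))) =
        mrank (?G * (Y * (W\<^sup>T * J)))"
      using J(2) Wc(2) Y(2) by (intro mrank_mult_inj inj_mat_mult) auto
    moreover have "mrank (?G * (Y * (W\<^sup>T * J))) = mrank ?G"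
      using surj by (intro mrank_mult_surj surj_mat_mult) auto
    ultimately show ?thesis by simp
  qed
  have "(\<forall>i. mrank (J * (?Z * J) ^\<^sub>m i) = \<rho> i) \<longleftrightarrow> (\<forall>i. mrank (?C * (Y * ?C) ^\<^sub>m i) = \<rho> (Suc (Suc i)))"
    (is "?L \<longleftrightarrow> ?R")
  proof
    assume ?L
    then show ?R unfolding r2[symmetric] by blast
  next
    assume R: ?R
    show ?L
    proof
      fix i show "mrank (J * (?Z * J) ^\<^sub>m i) = \<rho> i"
      proof (cases i)
        case 0
        then show ?thesis using r0 \<rho>(1) by (simp only:)
      next
        case (Suc j)
        then show ?thesis using r1 \<rho>(2) r2 R by (cases j) (simp_all only: One_nat_def)
      qed
    qed
  qed
  then show ?thesis unfolding wall_type_def mem_Collect_eq forms by blast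
qed

text \<open>Counts the pairs \<open>(W, Y)\<close> in two ways. Over a fixed \<open>Z\<close>, the
  matrix \<open>W\<close> determines \<open>Y\<close>, and the possible \<open>W\<close> are the
  products \<open>W0 * g\<close> with \<open>g\<close> invertible of size \<open>k\<close>.\<close>

lemma card_wall_type_mult_GL:
  fixes J :: "'a :: {field, finite} mat"
  assumes J: "alternating_mat J" "inj_mat J" "dim_row J = d" and \<rho>: "\<rho> 0 = d" "\<rho> 1 = k"
  shows "card (wall_type J \<rho>) * card (inj_mats k k :: 'a mat set) =
    (\<Sum>W\<in>inj_mats d k. card {Y \<in> wall_type (W\<^sup>T * J * W) (\<lambda>i. \<rho> (Suc (Suc i))). inj_mat Y})"
proof -
  let ?N = "\<lambda>W. {Y \<in> wall_type (W\<^sup>T * J * W) (\<lambda>i. \<rho> (Suc (Suc i))). inj_mat Y}"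
  let ?P = "Sigma (inj_mats d k) ?N" and ?\<Phi> = "\<lambda>(W, Y). W * Y * W\<^sup>T"
  have Jc: "J \<in> carrier_mat d d" using alternating_mat_square[OF J(1)] J(3) by simp
  have memP: "(W, Y) \<in> ?P \<longleftrightarrow> W \<in> inj_mats d k \<and> Y \<in> carrier_mat k k \<and> inj_mat Y \<and>
      W * Y * W\<^sup>T \<in> wall_type J \<rho>" for W Y
  proof (cases "W \<in> inj_mats d k \<and> Y \<in> carrier_mat k k \<and> inj_mat Y")
    case True
    then show ?thesis using wall_type_factor_iff[OF J, of W k Y \<rho>] \<rho> by auto
  next
    case False
    then show ?thesis by (auto simp: wall_type_def wall_forms_def inj_mats_def)
  qed
  have fibre: "card {p \<in> ?P. ?\<Phi> p = Z} = card (inj_mats k k :: 'a mat set)" if Z: "Z \<in> wall_type J \<rho>" for Z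
  proof -
    have Zc: "Z \<in> carrier_mat d d" and Zw: "Z \<in> wall_forms J"
      using Z J(3) by (auto simp: wall_type_def wall_forms_def)
    have "mrank (J * (Z * J) ^\<^sub>m 1) = k"
      using Z \<rho>(2) unfolding wall_type_def by (metis (mono_tags, lifting) mem_Collect_eq)
    moreover have "mrank (J * (Z * J) ^\<^sub>m 1) = mrank Z"
      using Zc Jc J(2) inj_iff_surj_square[of J]
      by (simp add: mrank_mult_inj mrank_mult_surj left_mult_one_mat[of _ d d])
    ultimately have rk: "mrank Z = k" by simp
    obtain W0 Y0 where 0: "W0 \<in> carrier_mat d k" "Y0 \<in> carrier_mat k k" "inj_mat W0" "inj_mat Y0"
      "Z = W0 * Y0 * W0\<^sup>T"
      using symmetric_kernel_factorization[OF Zc] wall_forms_kernel_transpose[OF J(1) Zw] rk by auto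
    let ?F = "{p \<in> ?P. ?\<Phi> p = Z}"
    have "inj_on fst ?F"
    proof (rule inj_onI)
      fix x y assume xy: "x \<in> ?F" "y \<in> ?F" "fst x = fst y"
      obtain W Y Y' where s: "x = (W, Y)" "y = (W, Y')" using xy(3) by (metis prod.collapse)
      then have m: "W \<in> carrier_mat d k" "inj_mat W" "Y \<in> carrier_mat k k" "Y' \<in> carrier_mat k k"
        and eq: "W * Y * W\<^sup>T = W * Y' * W\<^sup>T"
        using xy(1,2) by (auto simp: memP[simplified] inj_mats_def wall_type_def wall_forms_def)
      obtain L where L: "L \<in> carrier_mat k d" "L * W = 1\<^sub>m k"
        using inj_mat_left_inverse[OF m(2)] m(1) by auto
      have WL: "W\<^sup>T * L\<^sup>T = 1\<^sub>m k"
        using transpose_mult'[of L W] L m(1) by simp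
      have "L * (W * X * W\<^sup>T) * L\<^sup>T = X" if "X \<in> carrier_mat k k" for X
      proof -
        have "L * (W * X * W\<^sup>T) * L\<^sup>T = (L * W) * X * (W\<^sup>T * L\<^sup>T)"
          using that m(1) L(1) by (simp add: mat_assoc)
        then show ?thesis unfolding L(2) WL using that by simp
      qed
      then show "x = y" using eq m s by metis
    qed
    then have "card ?F = card (fst ` ?F)" by (simp add: card_image)
    also have "fst ` ?F = (\<lambda>g. W0 * g) ` inj_mats k k"
    proof (intro equalityI subsetI)
      fix W assume "W \<in> fst ` ?F"
      then obtain Y where *: "W \<in> carrier_mat d k" "inj_mat W" "Y \<in> carrier_mat k k" "inj_mat Y"
        "W * Y * W\<^sup>T = Z"
        by (auto simp: memP[simplified] inj_mats_def wall_type_def wall_forms_def)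
      \<comment> \<open>A right inverse \<open>B\<close> of \<open>Y * W\<^sup>T\<close> recovers
        \<open>W\<close> as \<open>Z * B\<close>; substituting the factorization of \<open>Z\<close>
        through \<open>W0\<close> exhibits the required \<open>g\<close>.\<close>
      have "surj_mat (Y * W\<^sup>T)"
        using * inj_iff_surj_square[of Y] by (intro surj_mat_mult) (auto simp: surj_mat_transpose_iff)
      then obtain B where B: "B \<in> carrier_mat d k" "Y * W\<^sup>T * B = 1\<^sub>m k"
        using surj_mat_right_inverse[of "Y * W\<^sup>T"] *(1,3) by auto
      define g where "g = Y0 * W0\<^sup>T * B"
      have g: "g \<in> carrier_mat k k" using 0 B by (auto simp: g_def)
      have "W = W * (Y * W\<^sup>T * B)" unfolding B(2) using *(1) by simp
      also have "\<dots> = Z * B" unfolding *(5)[symmetric] using *(1,3) B(1) by (simp add: mat_assoc)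
      also have "\<dots> = W0 * g" unfolding 0(5) g_def using 0(1,2) B(1) by (simp add: mat_assoc)
      finally have Wg: "W = W0 * g" .
      have "inj_mat g"
      proof (rule inj_matI)
        fix v :: "'a vec" assume v: "dim_vec v = dim_col g" "g *\<^sub>v v = 0\<^sub>v (dim_row g)"
        have "W *\<^sub>v v = 0\<^sub>v d" unfolding Wg using v g 0(1) by (simp add: mat_vec_assoc)
        then show "v = 0\<^sub>v (dim_col g)" using inj_matD[OF *(2), of v] v g *(1) by simp
      qed
      then show "W \<in> (\<lambda>g. W0 * g) ` inj_mats k k" using Wg g by (auto simp: inj_mats_def)
    next
      fix W assume "W \<in> (\<lambda>g. W0 * g) ` inj_mats k k"
      then obtain g where g: "W = W0 * g" "g \<in> carrier_mat k k" "inj_mat g" by (auto simp: inj_mats_def)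
      obtain h where h: "h \<in> carrier_mat k k" "g * h = 1\<^sub>m k" "inj_mat h"
        using square_inj_mat_inverse[OF g(3,2)] by blast
      have hg: "h\<^sup>T * g\<^sup>T = 1\<^sub>m k"
        using transpose_mult'[of g h] g h by simp
      \<comment> \<open>The inverse change of basis on \<open>Y0\<close> compensates the passage
        from \<open>W0\<close> to \<open>W0 * g\<close>.\<close>
      let ?Y = "h * Y0 * h\<^sup>T"
      have "W * ?Y * W\<^sup>T = W0 * (g * h) * Y0 * (h\<^sup>T * g\<^sup>T) * W0\<^sup>T"
        using 0(1,2) g(1,2) h(1) by (simp add: transpose_mult' mat_assoc)
      also have "\<dots> = Z" unfolding h(2) hg 0(5) using 0(1,2) by simp
      finally have Z': "W * ?Y * W\<^sup>T = Z" .
      have "inj_mat ?Y"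
        using h 0 inj_mat_transpose_square[of h] by (intro inj_mat_mult) auto
      moreover have "inj_mat W" unfolding g(1) using 0 g by (intro inj_mat_mult) auto
      ultimately have "(W, ?Y) \<in> ?P"
        using Z Z' 0(1,2) g(1,2) h(1) unfolding memP by (auto simp: inj_mats_def)
      then show "W \<in> fst ` ?F" using Z' by (intro image_eqI[of _ _ "(W, ?Y)"]) auto
    qed
    also have "card \<dots> = card (inj_mats k k :: 'a mat set)"
    proof (rule card_image, rule inj_onI)
      fix g g' assume g: "g \<in> inj_mats k k" "g' \<in> inj_mats k k" and eq: "W0 * g = W0 * g'"
      obtain L where L: "L \<in> carrier_mat k d" "L * W0 = 1\<^sub>m k"
        using inj_mat_left_inverse[OF 0(3)] 0(1) by auto
      have "L * (W0 * x) = x" if "x \<in> inj_mats k k" for x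
      proof -
        have "L * (W0 * x) = (L * W0) * x"
          using that L(1) 0(1) by (auto simp: inj_mats_def mat_assoc)
        then show ?thesis unfolding L(2) using that by (auto simp: inj_mats_def)
      qed
      then show "g = g'" using g eq by metis
    qed
    finally show ?thesis .
  qed
  have finP: "finite ?P" by (intro finite_SigmaI) auto
  have "?\<Phi> ` ?P \<subseteq> wall_type J \<rho>" using memP by auto
  then have "card ?P = (\<Sum>Z\<in>wall_type J \<rho>. card {p \<in> ?P. ?\<Phi> p = Z})"
    using card_eq_sum[of ?P] sum.group[OF finP finite_wall_type[of J \<rho>], of ?\<Phi> "\<lambda>_. 1 :: nat"] by simp
  also have "\<dots> = card (wall_type J \<rho>) * card (inj_mats k k :: 'a mat set)"
    using fibre by simp
  finally show ?thesis by (simp add: card_SigmaI)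
qed

subsection \<open>Counting injective matrices by the rank of their Gram matrix\<close>

lemma sum_inj_mats_Suc:
  fixes f :: "'a :: {field, finite} mat \<Rightarrow> 'b :: comm_monoid_add"
  shows "(\<Sum>A\<in>inj_mats d (Suc k). f A) =
    (\<Sum>W\<in>inj_mats d k. \<Sum>w\<in>carrier_vec d - mat_range W. f (add_col w W))"
proof -
  let ?S = "Sigma (inj_mats d k :: 'a mat set) (\<lambda>W. carrier_vec d - mat_range W)"
  have "bij_betw (\<lambda>(W, w). add_col w W) ?S (inj_mats d (Suc k))"
  proof (rule bij_betw_imageI)
    have inj: "inj_on (\<lambda>(w, W). add_col w W) (carrier_vec d \<times> (carrier_mat d k :: 'a mat set))"
      by (rule bij_betw_imp_inj_on[OF bij_betw_add_col])
    show "inj_on (\<lambda>(W, w). add_col w W) ?S"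
    proof (rule inj_onI)
      fix x y :: "'a mat \<times> 'a vec"
      assume xy: "x \<in> ?S" "y \<in> ?S"
        "(\<lambda>(W, w). add_col w W) x = (\<lambda>(W, w). add_col w W) y"
      obtain W w W' w' where s: "x = (W, w)" "y = (W', w')" by (metis prod.collapse)
      then have m: "W \<in> carrier_mat d k" "W' \<in> carrier_mat d k" "w \<in> carrier_vec d" "w' \<in> carrier_vec d"
        using xy by (auto simp: inj_mats_def)
      show "x = y"
        using inj_onD[OF inj, of "(w, W)" "(w', W')"] m xy(3) s by auto
    qed
    show "(\<lambda>(W, w). add_col w W) ` ?S = inj_mats d (Suc k)"
    proof (intro equalityI subsetI)
      fix A assume "A \<in> (\<lambda>(W, w). add_col w W) ` ?S"
      then obtain W w where *: "A = add_col w W" "W \<in> inj_mats d k" "dim_vec w = d" "w \<notin> mat_range W"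
        by auto
      then have W: "W \<in> carrier_mat d k" "inj_mat W" by (auto simp: inj_mats_def)
      have "inj_mat A" unfolding *(1) using * W by (subst inj_mat_add_col_iff) auto
      moreover have "A \<in> carrier_mat d (Suc k)"
        unfolding *(1) using W(1) by (intro carrier_matI) auto
      ultimately show "A \<in> inj_mats d (Suc k)" by (simp add: inj_mats_def)
    next
      fix A :: "'a mat" assume "A \<in> inj_mats d (Suc k)"
      then have A: "A \<in> carrier_mat d (Suc k)" "inj_mat A" by (auto simp: inj_mats_def)
      obtain w W where *: "A = add_col w W" "w \<in> carrier_vec d" "W \<in> carrier_mat d k"
        using ex_add_col[OF A(1)] by blast
      have "inj_mat W \<and> w \<notin> mat_range W"
        using A(2) *(2,3) inj_mat_add_col_iff[of w W] unfolding *(1) by auto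
      then show "A \<in> (\<lambda>(W, w). add_col w W) ` ?S"
        using * by (intro image_eqI[of _ _ "(W, w)"]) (auto simp: inj_mats_def)
    qed
  qed
  then have "(\<Sum>A\<in>inj_mats d (Suc k). f A) = (\<Sum>x\<in>?S. f ((\<lambda>(W, w). add_col w W) x))"
    by (rule sum.reindex_bij_betw[symmetric])
  also have "\<dots> = (\<Sum>(W, w)\<in>?S. f (add_col w W))" by (intro sum.cong) auto
  finally show ?thesis
    by (subst sum.Sigma) auto
qed

lemma inj_mats_0: "inj_mats d 0 = {0\<^sub>m d 0 :: 'a :: comm_ring_1 mat}"
proof -
  have "inj_mat (0\<^sub>m d 0 :: 'a mat)" by (rule inj_matI) auto
  moreover have "A = 0\<^sub>m d 0" if "A \<in> carrier_mat d 0" for A :: "'a mat"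
    using that by (intro eq_matI) auto
  ultimately show ?thesis by (auto simp: inj_mats_def)
qed

lemma mrank_inj_mats: "W \<in> inj_mats d k \<Longrightarrow> mrank (W :: 'a :: {field, finite} mat) = k"
  by (auto simp: inj_mats_def inj_mat_iff_mrank)

lemma inj_mats_le: "(W :: 'a :: {field, finite} mat) \<in> inj_mats d k \<Longrightarrow> k \<le> d"
  using inj_mat_dim_le[of W] by (auto simp: inj_mats_def)

lemma card_outside_range:
  assumes "(W :: 'a :: {field, finite} mat) \<in> inj_mats d k"
  shows "real (card (carrier_vec d - mat_range W)) = real CARD('a) ^ d - real CARD('a) ^ k"
proof -
  have sub: "mat_range W \<subseteq> carrier_vec d"
    using mat_range_carrier[of W] assms by (auto simp: inj_mats_def)
  then have "card (mat_range W) \<le> card (carrier_vec d :: 'a vec set)" by (intro card_mono) auto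
  then show ?thesis
    using sub mrank_inj_mats[OF assms]
    by (simp add: card_Diff_subset card_carrier_vec card_mat_range of_nat_diff)
qed

text \<open>The order of the general linear group: the column added after \<open>i\<close> others
  avoids the \<open>q ^ i\<close> vectors in their span.\<close>

lemma card_inj_mats_square:
  defines "q \<equiv> real CARD('a :: {field, finite})"
  shows "real (card (inj_mats k k :: 'a mat set)) = q ^ (k * k) * qfac (1 / q) k"
proof -
  have q: "q > 1" using one_less_card_field[where 'a = 'a] by (simp add: q_def)
  have prod: "real (card (inj_mats d j :: 'a mat set)) = (\<Prod>i<j. q ^ d - q ^ i)" for d j
  proof (induction j)
    case 0
    then show ?case by (simp add: inj_mats_0)
  next
    case (Suc j)
    have "real (card (inj_mats d (Suc j) :: 'a mat set)) =
        (\<Sum>W\<in>(inj_mats d j :: 'a mat set). \<Sum>w\<in>carrier_vec d - mat_range W. 1)"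
      using sum_inj_mats_Suc[of "\<lambda>_ :: 'a mat. 1 :: real" d j] by simp
    also have "\<dots> = (\<Sum>W\<in>(inj_mats d j :: 'a mat set). q ^ d - q ^ j)"
      by (intro sum.cong refl) (simp add: card_outside_range q_def)
    finally show ?case using Suc by simp
  qed
  have "(\<Prod>i<k. q ^ k - q ^ i) = (\<Prod>i<k. q ^ k * (1 - (1 / q) ^ (k - i)))"
    using q by (intro prod.cong refl) (auto simp: power_diff power_divide field_simps)
  also have "\<dots> = q ^ (k * k) * (\<Prod>i<k. 1 - (1 / q) ^ (k - i))"
    by (simp add: prod.distrib power_mult)
  also have "(\<Prod>i<k. 1 - (1 / q) ^ (k - i)) = qfac (1 / q) k"
    unfolding qfac_def
    by (rule prod.reindex_bij_witness[of _ "\<lambda>i. k - i" "\<lambda>i. k - i"]) auto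
  finally show ?thesis by (simp add: prod)
qed

lemma gram_add_col:
  fixes J :: "'a :: {field, finite} mat"
  assumes J: "alternating_mat J" "dim_row J = d" and W: "W \<in> carrier_mat d k" and w: "dim_vec w = d"
  defines "C \<equiv> W\<^sup>T * J * W"
  shows "(add_col w W)\<^sup>T * J * add_col w W =
    border_mat 0 (- (W\<^sup>T * J *\<^sub>v w)) (W\<^sup>T * J *\<^sub>v w) C"
proof -
  let ?A = "add_col w W" and ?c = "W\<^sup>T * J *\<^sub>v w"
  have [simp]: "dim_row W = d" "dim_col W = k" "dim_row J = d" "dim_col J = d"
    using W J alternating_mat_dim[OF J(1)] by auto
  have C: "C \<in> carrier_mat k k" "dim_row C = k" "dim_col C = k" "alternating_mat C"
    using alternating_mat_congruence[OF J(1), of W] by (auto simp: C_def)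
  have c: "dim_vec ?c = k" by simp
  have mult: "?A\<^sup>T * J * ?A *\<^sub>v vCons a v = vCons (- (?c \<bullet> v)) (a \<cdot>\<^sub>v ?c + C *\<^sub>v v)"
    if v: "dim_vec v = k" for a v
  proof -
    have Av: "J *\<^sub>v (?A *\<^sub>v vCons a v) = a \<cdot>\<^sub>v (J *\<^sub>v w) + J *\<^sub>v (W *\<^sub>v v)"
      using v w by (simp add: add_col_mult_vCons mult_mat_vec_add mult_mat_vec_smult)
    have "w \<bullet> (a \<cdot>\<^sub>v (J *\<^sub>v w) + J *\<^sub>v (W *\<^sub>v v)) = w \<bullet> (J *\<^sub>v (W *\<^sub>v v))"
      using v w alternating_mat_vec[OF J(1), of w] by (subst scalar_prod_add_distrib[of _ d]) auto
    also have "\<dots> = - ((J *\<^sub>v w) \<bullet> (W *\<^sub>v v))"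
      using alternating_mat_swap[OF J(1), of w "W *\<^sub>v v"] v w by simp
    also have "(J *\<^sub>v w) \<bullet> (W *\<^sub>v v) = ?c \<bullet> v"
      using transpose_scalar_prod[of v W "J *\<^sub>v w"] v w by (simp add: mat_vec_assoc)
    finally have 1: "w \<bullet> (a \<cdot>\<^sub>v (J *\<^sub>v w) + J *\<^sub>v (W *\<^sub>v v)) = - (?c \<bullet> v)" .
    have 2: "W\<^sup>T *\<^sub>v (a \<cdot>\<^sub>v (J *\<^sub>v w) + J *\<^sub>v (W *\<^sub>v v)) = a \<cdot>\<^sub>v ?c + C *\<^sub>v v"
      using v w by (simp add: C_def mat_vec_assoc mult_mat_vec_add mult_mat_vec_smult)
    have "?A\<^sup>T * J * ?A *\<^sub>v vCons a v = ?A\<^sup>T *\<^sub>v (J *\<^sub>v (?A *\<^sub>v vCons a v))"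
      using v w by (simp add: mat_vec_assoc)
    also have "\<dots> = vCons (- (?c \<bullet> v)) (a \<cdot>\<^sub>v ?c + C *\<^sub>v v)"
      unfolding Av using v w 1 2 by (simp add: transpose_add_col_mult)
    finally show ?thesis .
  qed
  show ?thesis
  proof (rule eq_mat_by_vec)
    fix x :: "'a vec" assume "dim_vec x = dim_col (border_mat 0 (- ?c) ?c C)"
    then obtain a v where "x = vCons a v" "dim_vec v = k" using ex_vCons[of x k] C(3) by auto
    then show "?A\<^sup>T * J * ?A *\<^sub>v x = border_mat 0 (- ?c) ?c C *\<^sub>v x"
      using C(2,3) c by (simp add: mult border_mat_mult_vCons)
  qed (use C in auto)
qed

text \<open>The Gram matrix is bordered with opposite signs in row and column; this changes only the
  sign of its first row against the symmetric border, so the kernels agree. A jump by exactly 1 is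
  excluded by alternation.\<close>

lemma mrank_gram_add_col:
  fixes J :: "'a :: {field, finite} mat"
  assumes J: "alternating_mat J" "dim_row J = d" and W: "W \<in> carrier_mat d k" and w: "dim_vec w = d"
  defines "C \<equiv> W\<^sup>T * J * W"
  shows "mrank ((add_col w W)\<^sup>T * J * add_col w W) =
    (if W\<^sup>T * J *\<^sub>v w \<in> mat_range C then mrank C else Suc (Suc (mrank C)))"
proof -
  let ?A = "add_col w W" and ?c = "W\<^sup>T * J *\<^sub>v w"
  have [simp]: "dim_row W = d" "dim_col W = k" "dim_row J = d" "dim_col J = d"
    using W J alternating_mat_dim[OF J(1)] by auto
  have C: "C \<in> carrier_mat k k" "dim_row C = k" "dim_col C = k" "alternating_mat C"
    using alternating_mat_congruence[OF J(1), of W] by (auto simp: C_def)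
  have c: "dim_vec ?c = k" by simp
  have mult: "?A\<^sup>T * J * ?A *\<^sub>v vCons a v = vCons (- (?c \<bullet> v)) (a \<cdot>\<^sub>v ?c + C *\<^sub>v v)"
    if v: "dim_vec v = k" for a v
    unfolding gram_add_col[OF J W w] C_def[symmetric] using C c v by (subst border_mat_mult_vCons) auto
  have "mat_kernel (?A\<^sup>T * J * ?A) = mat_kernel (border_mat 0 ?c ?c C)"
  proof -
    have "?A\<^sup>T * J * ?A *\<^sub>v x = 0\<^sub>v (Suc k) \<longleftrightarrow> border_mat 0 ?c ?c C *\<^sub>v x = 0\<^sub>v (Suc k)"
      if x: "dim_vec x = Suc k" for x
    proof -
      obtain a v where "x = vCons a v" "dim_vec v = k" using ex_vCons[OF x] by blast
      then show ?thesis
        using C c by (simp add: mult border_mat_mult_vCons zero_vec_Suc)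
    qed
    then show ?thesis using C by (auto simp: mem_mat_kernel)
  qed
  then have "card (mat_kernel (?A\<^sup>T * J * ?A)) = card (mat_kernel (border_mat 0 ?c ?c C))"
    by simp
  then have "Suc k - mrank (?A\<^sup>T * J * ?A) = Suc k - mrank (border_mat 0 ?c ?c C)"
    using one_less_card_field[where 'a = 'a] C by (simp add: card_mat_kernel)
  then have eq: "mrank (?A\<^sup>T * J * ?A) = mrank (border_mat 0 ?c ?c C)"
    using mrank_le_dim_col[of "?A\<^sup>T * J * ?A"] mrank_le_dim_col[of "border_mat 0 ?c ?c C"] C
    by simp
  note ker = alternating_mat_kernel_transpose[OF C(4)]
  show ?thesis
  proof (cases "?c \<in> mat_range C")
    case False
    then show ?thesis
      using eq card_border_kernel_outside[OF C(1) ker c False] by simp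
  next
    case True
    then obtain u where u: "dim_vec u = k" "?c = C *\<^sub>v u" using C(3) by (auto simp: mem_mat_range)
    \<comment> \<open>By this vanishing, the corner 0 is precisely the exceptional value that keeps
      the rank.\<close>
    have "(C *\<^sub>v u) \<bullet> u = 0"
      using alternating_mat_vec[OF C(4), of u] scalar_prod_commute[of "C *\<^sub>v u" u] u(1) C(2) by simp
    then show ?thesis
      using True eq card_border_kernel_inside[OF C(1) ker u(1), of ?c 0] u(2) by simp
  qed
qed

text \<open>The map \<open>W\<^sup>T * J\<close> is onto with kernel of size
  \<open>q ^ (d - k)\<close>, so the preimage of the range of \<open>C\<close> is counted by the
  rank of \<open>C\<close>. It contains the range of \<open>W\<close>, whose \<open>q ^ k\<close>
  vectors must be discarded.\<close>

lemma card_gram_in_range: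
  fixes J :: "'a :: {field, finite} mat"
  assumes J: "alternating_mat J" "inj_mat J" "dim_row J = d" and W: "W \<in> inj_mats d k"
  defines "C \<equiv> W\<^sup>T * J * W"
  shows "real (card {w \<in> carrier_vec d - mat_range W. W\<^sup>T * J *\<^sub>v w \<in> mat_range C}) =
    real CARD('a) ^ (mrank C + d - k) - real CARD('a) ^ k"
proof -
  have Wc: "W \<in> carrier_mat d k" "inj_mat W" using W by (auto simp: inj_mats_def)
  have [simp]: "dim_row W = d" "dim_col W = k" "dim_row J = d" "dim_col J = d"
    using Wc J alternating_mat_dim[OF J(1)] by auto
  have kd: "k \<le> d" using inj_mats_le[OF W] .
  let ?B = "W\<^sup>T * J"
  let ?S = "{w \<in> carrier_vec d. ?B *\<^sub>v w \<in> mat_range C}"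
  have surj: "surj_mat ?B"
    using Wc J(2) inj_iff_surj_square[of J] by (intro surj_mat_mult) (auto simp: surj_mat_transpose_iff)
  have "mat_range C \<subseteq> mat_range ?B"
  proof
    fix u assume "u \<in> mat_range C"
    then obtain y where y: "dim_vec y = k" "u = C *\<^sub>v y" by (auto simp: mem_mat_range C_def)
    have "u = ?B *\<^sub>v (W *\<^sub>v y)"
      unfolding y(2) C_def using y(1) by (subst mat_vec_assoc) auto
    then show "u \<in> mat_range ?B" using y(1) mat_rangeI[of "W *\<^sub>v y" ?B] by simp
  qed
  then have "card {w \<in> carrier_vec (dim_col ?B). ?B *\<^sub>v w \<in> mat_range C} = card (mat_range C) * card (mat_kernel ?B)"
    by (rule card_preimage_mat)
  moreover have "mrank ?B = k" using surj by (simp add: surj_mat_iff_mrank)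
  ultimately have S: "card ?S = CARD('a) ^ (mrank C + (d - k))"
    by (simp add: card_mat_range card_mat_kernel power_add)
  have sub: "mat_range W \<subseteq> ?S"
  proof
    fix w assume "w \<in> mat_range W"
    then obtain y where y: "dim_vec y = k" "w = W *\<^sub>v y" by (auto simp: mem_mat_range)
    then have "?B *\<^sub>v w = C *\<^sub>v y" by (simp add: C_def mat_vec_assoc)
    then show "w \<in> ?S" using y mat_rangeI[of y C] by (simp add: C_def)
  qed
  have fin: "finite ?S" by (rule finite_subset[OF _ finite_carrier_vec[of d]]) blast
  have "{w \<in> carrier_vec d - mat_range W. ?B *\<^sub>v w \<in> mat_range C} = ?S - mat_range W" by blast
  moreover have "card (?S - mat_range W) = card ?S - card (mat_range W)"
    using sub by (intro card_Diff_subset) auto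
  moreover have "card (mat_range W) \<le> card ?S" using sub fin by (intro card_mono)
  ultimately show ?thesis
    using S kd mrank_inj_mats[OF W] by (simp add: of_nat_diff card_mat_range)
qed

text \<open>A second Markov chain, on the ranks of Gram matrices, with jumps 0 and 2.\<close>

lemma sum_gram_rank_Suc:
  fixes J :: "'a :: {field, finite} mat" and f :: "nat \<Rightarrow> real"
  assumes J: "alternating_mat J" "inj_mat J" "dim_row J = d"
  defines "q \<equiv> real CARD('a)" and "e \<equiv> \<lambda>W. mrank (W\<^sup>T * J * W)"
  shows "(\<Sum>A\<in>inj_mats d (Suc k). f (e A)) =
    (\<Sum>W\<in>inj_mats d k. (q ^ (e W + d - k) - q ^ k) * f (e W) + (q ^ d - q ^ (e W + d - k)) * f (Suc (Suc (e W))))"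
  unfolding sum_inj_mats_Suc
proof (rule sum.cong[OF refl])
  fix W :: "'a mat" assume W: "W \<in> inj_mats d k"
  let ?C = "W\<^sup>T * J * W"
  let ?S = "{w \<in> carrier_vec d - mat_range W. W\<^sup>T * J *\<^sub>v w \<in> mat_range ?C}"
  let ?T = "carrier_vec d - mat_range W"
  have Wc: "W \<in> carrier_mat d k" using W by (simp add: inj_mats_def)
  have "(\<Sum>w\<in>?T. f (e (add_col w W))) =
      (\<Sum>w\<in>?T. if W\<^sup>T * J *\<^sub>v w \<in> mat_range ?C then f (e W) else f (Suc (Suc (e W))))"
    unfolding e_def by (intro sum.cong refl) (use mrank_gram_add_col[OF J(1,3) Wc] in auto)
  also have "\<dots> = real (card ?S) * f (e W) + real (card (?T - ?S)) * f (Suc (Suc (e W)))"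
  proof -
    have "?T \<inter> {w. W\<^sup>T * J *\<^sub>v w \<in> mat_range ?C} = ?S"
      "?T \<inter> - {w. W\<^sup>T * J *\<^sub>v w \<in> mat_range ?C} = ?T - ?S"
      by blast+
    then show ?thesis by (subst sum.If_cases) simp_all
  qed
  also have "real (card (?T - ?S)) = real (card ?T) - real (card ?S)"
  proof -
    have fin: "finite ?T" by (rule finite_Diff) simp
    have sub: "?S \<subseteq> ?T" by blast
    have "card (?T - ?S) = card ?T - card ?S" "card ?S \<le> card ?T"
      using card_Diff_subset[OF finite_subset[OF sub fin] sub] card_mono[OF fin sub] by auto
    then show ?thesis by (simp add: of_nat_diff)
  qed
  finally show "(\<Sum>w\<in>?T. f (e (add_col w W))) = (q ^ (e W + d - k) - q ^ k) * f (e W) +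
      (q ^ d - q ^ (e W + d - k)) * f (Suc (Suc (e W)))"
    unfolding card_gram_in_range[OF J W] card_outside_range[OF W] e_def q_def by simp
qed

section \<open>Recurrence and closed form for the Gram rank distribution\<close>

definition gram_count :: "'a :: {field, finite} mat \<Rightarrow> nat \<Rightarrow> nat \<Rightarrow> nat" where
  "gram_count J k e = card {W \<in> inj_mats (dim_row J) k. mrank (W\<^sup>T * J * W) = e}"

lemma gram_count_eq_sum:
  "real (gram_count J k e) = (\<Sum>W\<in>inj_mats (dim_row J) k. if mrank (W\<^sup>T * J * W) = e then 1 else 0)"
  unfolding gram_count_def by (subst sum.If_cases) (auto simp: Int_def)

lemma gram_count_0: "real (gram_count J 0 e) = (if e = 0 then 1 else 0)"
proof -
  have "mrank ((0\<^sub>m (dim_row J) 0)\<^sup>T * J * 0\<^sub>m (dim_row J) 0) = 0"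
    using mrank_le_dim_col[of "(0\<^sub>m (dim_row J) 0)\<^sup>T * J * 0\<^sub>m (dim_row J) 0"] by simp
  then show ?thesis
    unfolding gram_count_eq_sum inj_mats_0 by auto
qed

text \<open>The guard \<open>2 \<le> e\<close> prevents the truncated \<open>e - 2\<close> from
  being read as rank 0.\<close>

lemma gram_count_Suc:
  fixes J :: "'a :: {field, finite} mat"
  assumes J: "alternating_mat J" "inj_mat J" "dim_row J = d"
  defines "q \<equiv> real CARD('a)"
  shows "real (gram_count J (Suc k) e) = (q ^ (e + d - k) - q ^ k) * real (gram_count J k e) +
    (if 2 \<le> e then (q ^ d - q ^ (e - 2 + d - k)) * real (gram_count J k (e - 2)) else 0)"
proof -
  let ?e = "\<lambda>W. mrank (W\<^sup>T * J * W)"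
  have "real (gram_count J (Suc k) e) = (\<Sum>W\<in>inj_mats d k.
      (q ^ (?e W + d - k) - q ^ k) * (if ?e W = e then 1 else 0) +
      (q ^ d - q ^ (?e W + d - k)) * (if Suc (Suc (?e W)) = e then 1 else 0))"
    unfolding gram_count_eq_sum J(3) q_def
    using sum_gram_rank_Suc[OF J, of "\<lambda>x. if x = e then 1 else 0" k] .
  also have "\<dots> = (\<Sum>W\<in>inj_mats d k. (q ^ (e + d - k) - q ^ k) * (if ?e W = e then 1 else 0) +
      (if 2 \<le> e then (q ^ d - q ^ (e - 2 + d - k)) * (if ?e W = e - 2 then 1 else 0) else 0))"
    by (intro sum.cong refl) auto
  also have "\<dots> = (q ^ (e + d - k) - q ^ k) * real (gram_count J k e) +
      (if 2 \<le> e then (q ^ d - q ^ (e - 2 + d - k)) * real (gram_count J k (e - 2)) else 0)"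
    unfolding gram_count_eq_sum J(3) sum.distrib sum_distrib_left by simp
  finally show ?thesis .
qed

text \<open>The chain starts at rank 0 and jumps by 0 or 2, so odd ranks are never reached.\<close>

lemma gram_count_odd:
  fixes J :: "'a :: {field, finite} mat"
  assumes J: "alternating_mat J" "inj_mat J" and "odd e"
  shows "gram_count J k e = 0"
  using assms(3)
proof (induction k arbitrary: e)
  case 0
  then show ?case using gram_count_0[of J e] by (auto split: if_splits)
next
  case (Suc k)
  have "real (gram_count J (Suc k) e) = 0"
    unfolding gram_count_Suc[OF J refl] using Suc.IH[of e] Suc.IH[of "e - 2"] Suc.prems by simp
  then show ?case by simp
qed

text \<open>For \<open>t = 1/q\<close>, the proportion of \<open>2n \<times> k\<close> matrices that are injective with Gram matrix of rank \<open>2m\<close>.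
  For \<open>j \<ge> n\<close> the truncated exponent \<open>n - j\<close> is \<open>0\<close>, so that the product vanishes, as it should.\<close>

definition gram_prob :: "real \<Rightarrow> nat \<Rightarrow> nat \<Rightarrow> nat \<Rightarrow> real" where
  "gram_prob t n k m = (if 2 * m \<le> k then
     t ^ (\<Sum>{..<k - 2 * m}) * (\<Prod>j<k - m. 1 - t ^ (2 * (n - j))) * qfac t k /
     (qfac t (k - 2 * m) * qfac (t\<^sup>2) m) else 0)"

text \<open>With \<open>r = k - 2 * m\<close>, all terms are multiples of a common factor, and what
  remains is \<open>1 - t ^ Suc k = (1 - t ^ Suc r) + t ^ Suc r * (1 - t ^ (2 * m))\<close>.\<close>

lemma gram_prob_Suc:
  assumes t: "0 < t" "t < 1"
  shows "gram_prob t n (Suc k) m = (t ^ (k - 2 * m) - t ^ (2 * n - k)) * gram_prob t n k m +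
    (if 1 \<le> m then (1 - t ^ (k - 2 * (m - 1))) * gram_prob t n k (m - 1) else 0)"
proof -
  let ?P = "\<lambda>a. \<Prod>j<a. 1 - t ^ (2 * (n - j))"
  have pos: "qfac t a \<noteq> 0" "qfac (t\<^sup>2) a \<noteq> 0" for a
    using qfac_pos[OF t, of a] qfac_square_pos[OF t, of a] by auto
  have tn: "1 - t ^ Suc a \<noteq> 0" for a using power_Suc_less_one[of t a] t by simp
  have sq: "qfac (t\<^sup>2) (Suc a) = qfac (t\<^sup>2) a * (1 - t ^ (2 * Suc a))" for a
    by (simp only: qfac_Suc power_mult)
  show ?thesis
  proof (cases "2 * m \<le> k")
    case True
    then obtain r where k: "k = 2 * m + r" using le_Suc_ex by blast
    define a where "a = m + r"
    have ka: "k - m = a" "Suc k - m = Suc a" "k - 2 * m = r" "Suc k - 2 * m = Suc r"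
      by (auto simp: k a_def)
    have P: "?P (Suc a) = ?P a * (1 - t ^ (2 * (n - a)))" by simp
    \<comment> \<open>For \<open>a \<le> n\<close> the exponents are not truncated and simply add
      up. For \<open>a > n\<close> the product contains the factor for \<open>j = n\<close>, which
      is \<open>1 - t ^ 0 = 0\<close>.\<close>
    have fst: "(t ^ r - t ^ (2 * n - k)) * ?P a = t ^ r * (1 - t ^ (2 * (n - a))) * ?P a"
    proof (cases "a \<le> n")
      case True
      then have "2 * n - k = r + 2 * (n - a)" by (auto simp: k a_def)
      then show ?thesis by (simp add: power_add algebra_simps)
    next
      case False
      then have "?P a = 0" by (intro prod_zero) (auto intro!: bexI[of _ n])
      then show ?thesis by simp
    qed
    let ?K = "t ^ (\<Sum>{..<r}) * ?P (Suc a) * qfac t k / (qfac t r * qfac (t\<^sup>2) m)"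
    have L: "gram_prob t n (Suc k) m = ?K * (t ^ r * (1 - t ^ Suc k) / (1 - t ^ Suc r))"
      unfolding gram_prob_def ka using k by (simp add: qfac_Suc power_add ac_simps)
    have R1: "(t ^ (k - 2 * m) - t ^ (2 * n - k)) * gram_prob t n k m = ?K * t ^ r"
    proof -
      have "(t ^ r - t ^ (2 * n - k)) * gram_prob t n k m =
          ((t ^ r - t ^ (2 * n - k)) * ?P a) * (t ^ (\<Sum>{..<r}) * qfac t k / (qfac t r * qfac (t\<^sup>2) m))"
        unfolding gram_prob_def ka using True by simp
      then show ?thesis unfolding fst ka P by simp
    qed
    show ?thesis
    proof (cases m)
      case 0
      then have "r = k" using k by simp
      then show ?thesis
        unfolding L R1 using 0 tn[of k] by simp
    next
      case (Suc l)
      have kl: "k - 2 * (m - 1) = Suc (Suc r)" "k - (m - 1) = Suc a" "2 * (m - 1) \<le> k"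
        using k Suc by (auto simp: a_def)
      have "(1 - t ^ (k - 2 * (m - 1))) * gram_prob t n k (m - 1) =
          ?K * (t ^ r * t ^ Suc r * (1 - t ^ (2 * m)) / (1 - t ^ Suc r))"
      proof -
        have "(1 - t ^ (k - 2 * (m - 1))) * gram_prob t n k (m - 1) =
            (1 - t ^ Suc (Suc r)) * (t ^ (\<Sum>{..<Suc (Suc r)}) * ?P (Suc a) * qfac t k /
            (qfac t r * (1 - t ^ Suc r) * (1 - t ^ Suc (Suc r)) * qfac (t\<^sup>2) (m - 1)))"
          unfolding gram_prob_def kl using kl(3) by (simp add: qfac_Suc)
        also have "\<dots> = t ^ (\<Sum>{..<Suc (Suc r)}) * ?P (Suc a) * qfac t k /
            (qfac t r * (1 - t ^ Suc r) * qfac (t\<^sup>2) (m - 1))"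
          using tn[of "Suc r"] by simp
        also have "t ^ (\<Sum>{..<Suc (Suc r)}) = t ^ (\<Sum>{..<r}) * (t ^ r * t ^ Suc r)"
          by (simp add: power_add algebra_simps)
        also have "t ^ (\<Sum>{..<r}) * (t ^ r * t ^ Suc r) * ?P (Suc a) * qfac t k /
            (qfac t r * (1 - t ^ Suc r) * qfac (t\<^sup>2) (m - 1)) =
            ?K * (t ^ r * t ^ Suc r * (1 - t ^ (2 * m)) / (1 - t ^ Suc r))"
        proof -
          have "qfac (t\<^sup>2) m = qfac (t\<^sup>2) (m - 1) * (1 - t ^ (2 * m))" using sq[of l] Suc by simp
          moreover have "1 - t ^ (2 * m) \<noteq> 0" using tn[of "Suc (2 * l)"] Suc by simp
          ultimately show ?thesis by (simp add: ac_simps)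
        qed
        finally show ?thesis .
      qed
      then have R2: "(if 1 \<le> m then (1 - t ^ (k - 2 * (m - 1))) * gram_prob t n k (m - 1) else 0) =
          ?K * (t ^ r * t ^ Suc r * (1 - t ^ (2 * m)) / (1 - t ^ Suc r))"
        using Suc by simp
      have "t ^ r * (1 - t ^ Suc k) / (1 - t ^ Suc r) =
          t ^ r + t ^ r * t ^ Suc r * (1 - t ^ (2 * m)) / (1 - t ^ Suc r)"
      proof -
        have "t ^ Suc k = t ^ Suc r * t ^ (2 * m)" using k by (simp add: power_add)
        then have "1 - t ^ Suc k = (1 - t ^ Suc r) + t ^ Suc r * (1 - t ^ (2 * m))"
          by (simp add: right_diff_distrib)
        then show ?thesis
          using tn[of r] by (simp only: distrib_left add_divide_distrib) (simp add: mult.assoc)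
      qed
      then show ?thesis unfolding L R1 R2 by (simp only: distrib_left)
    qed
  next
    case False
    then obtain l where m: "m = Suc l" by (cases m) auto
    show ?thesis
    proof (cases "Suc k = 2 * m")
      case True
      \<comment> \<open>Full rank \<open>2 * m\<close> first becomes possible here:
        \<open>2 * m\<close> exceeds \<open>k\<close>, so only the jump from \<open>m - 1\<close>
        contributes.\<close>
      then have k: "k = Suc (2 * l)" using m by simp
      have "k - l = m" "Suc k - m = m" using k m by auto
      then show ?thesis
        using k m tn[of 0] tn[of k] True sq[of l]
        by (simp add: gram_prob_def qfac_Suc[of t k]) (simp add: qfac_def)
    next
      case ne: False
      then have "2 * m > Suc k" using False by simp
      \<comment> \<open>Either \<open>k = 2 * (m - 1)\<close> and the first factor is
        \<open>1 - t ^ 0\<close>, or \<open>2 * (m - 1)\<close> already exceeds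
        \<open>k\<close>.\<close>
      moreover have "(1 - t ^ (k - 2 * (m - 1))) * gram_prob t n k (m - 1) = 0"
      proof (cases "k = 2 * l")
        case True
        then show ?thesis using m by simp
      next
        case False
        then have "\<not> 2 * l \<le> k" using \<open>2 * m > Suc k\<close> m by simp
        then show ?thesis using m by (simp add: gram_prob_def)
      qed
      ultimately show ?thesis using False m by (simp add: gram_prob_def)
    qed
  qed
qed

lemma gram_count_even:
  fixes J :: "'a :: {field, finite} mat"
  assumes J: "alternating_mat J" "inj_mat J" "dim_row J = 2 * n"
  defines "q \<equiv> real CARD('a)"
  shows "real (gram_count J k (2 * m)) = q ^ (2 * n * k) * gram_prob (1 / q) n k m"
proof (induction k arbitrary: m)
  case 0
  then show ?case
    by (auto simp: gram_count_0 gram_prob_def)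
next
  case (Suc k)
  let ?t = "1 / q" and ?d = "2 * n"
  have q: "q > 1" using one_less_card_field[where 'a = 'a] by (simp add: q_def)
  show ?case
  proof (cases "k \<le> ?d")
    case kd: True
    have A: "(q ^ (2 * m + ?d - k) - q ^ k) * gram_prob ?t n k m =
        q ^ ?d * ((?t ^ (k - 2 * m) - ?t ^ (?d - k)) * gram_prob ?t n k m)"
    proof (cases "2 * m \<le> k")
      case True
      have "q ^ ?d * ?t ^ (k - 2 * m) = q ^ (?d - (k - 2 * m))" "q ^ ?d * ?t ^ (?d - k) = q ^ k"
        using q kd by (auto simp: power_divide power_diff field_simps simp flip: power_add)
      moreover have "?d - (k - 2 * m) = 2 * m + ?d - k" using True kd by simp
      ultimately have e: "q ^ ?d * ?t ^ (k - 2 * m) = q ^ (2 * m + ?d - k)" "q ^ ?d * ?t ^ (?d - k) = q ^ k"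
        by (simp_all only:)
      have gen: "D * ((x - y) * G) = (D * x - D * y) * G" for D x y G :: real by (simp add: algebra_simps)
      show ?thesis by (subst gen) (simp only: e)
    qed (simp add: gram_prob_def)
    have B: "(q ^ ?d - q ^ (2 * m - 2 + ?d - k)) * gram_prob ?t n k (m - 1) =
        q ^ ?d * ((1 - ?t ^ (k - 2 * (m - 1))) * gram_prob ?t n k (m - 1))"
    proof (cases "2 * (m - 1) \<le> k")
      case True
      have "q ^ ?d * ?t ^ (k - 2 * (m - 1)) = q ^ (?d - (k - 2 * (m - 1)))"
        using q kd by (auto simp: power_divide power_diff field_simps simp flip: power_add)
      moreover have "?d - (k - 2 * (m - 1)) = 2 * m - 2 + ?d - k" using True kd by (simp add: algebra_simps)
      ultimately have e: "q ^ ?d * ?t ^ (k - 2 * (m - 1)) = q ^ (2 * m - 2 + ?d - k)" by (simp only:)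
      have gen: "D * ((1 - x) * G) = (D - D * x) * G" for D x G :: real by (simp add: algebra_simps)
      show ?thesis by (subst gen) (simp only: e)
    qed (simp add: gram_prob_def)
    have "real (gram_count J (Suc k) (2 * m)) =
        (q ^ (2 * m + ?d - k) - q ^ k) * (q ^ (?d * k) * gram_prob ?t n k m) +
        (if 1 \<le> m then (q ^ ?d - q ^ (2 * m - 2 + ?d - k)) * (q ^ (?d * k) * gram_prob ?t n k (m - 1)) else 0)"
      using gram_count_Suc[OF J, of k "2 * m"] Suc.IH[of m] Suc.IH[of "m - 1"]
      by (simp add: q_def right_diff_distrib')
    also have "\<dots> = q ^ (?d * k) * ((q ^ (2 * m + ?d - k) - q ^ k) * gram_prob ?t n k m +
        (if 1 \<le> m then (q ^ ?d - q ^ (2 * m - 2 + ?d - k)) * gram_prob ?t n k (m - 1) else 0))"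
      by (simp add: algebra_simps)
    also have "\<dots> = q ^ (?d * k) * q ^ ?d * gram_prob ?t n (Suc k) m"
      unfolding A B using q by (subst gram_prob_Suc) (auto simp: algebra_simps)
    also have "q ^ (?d * k) * q ^ ?d = q ^ (?d * Suc k)" by (simp add: power_add)
    finally show ?thesis .
  next
    case False
    \<comment> \<open>Beyond \<open>2n\<close> columns nothing is injective. The closed form
      vanishes at \<open>k\<close> by the induction hypothesis, and then at \<open>Suc k\<close> by
      its recurrence.\<close>
    have "inj_mats ?d k = ({} :: 'a mat set)" "inj_mats ?d (Suc k) = ({} :: 'a mat set)"
      using inj_mats_le[where 'a = 'a, of _ ?d k] inj_mats_le[where 'a = 'a, of _ ?d "Suc k"] False by auto
    then have z: "gram_count J k l = 0" "gram_count J (Suc k) l = 0" for l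
      using J(3) by (auto simp: gram_count_def)
    have "gram_prob ?t n k l = 0" for l using Suc.IH[of l] z(1) q by simp
    then have "gram_prob ?t n (Suc k) m = 0" using q by (subst gram_prob_Suc) auto
    then show ?thesis using z by simp
  qed
qed

subsection \<open>The symplectic group\<close>

lemma symplectic_form_mat_eq:
  "symplectic_form_mat n = mat (2 * n) (2 * n) (\<lambda>(i, j). if j = i + n then 1 else if i = j + n then - 1 else (0 :: 'a :: field))"
  by (intro eq_matI) (auto simp: symplectic_form_mat_def)

lemma dim_symplectic_form_mat [simp]:
  "dim_row (symplectic_form_mat n) = 2 * n" "dim_col (symplectic_form_mat n) = 2 * n"
  by (simp_all add: symplectic_form_mat_eq)

lemma symplectic_form_mult_vec:
  fixes v :: "'a :: field vec"
  assumes v: "dim_vec v = 2 * n" and i: "i < 2 * n"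
  shows "(symplectic_form_mat n *\<^sub>v v) $ i = (if i < n then v $ (i + n) else - v $ (i - n))"
proof -
  have "(symplectic_form_mat n *\<^sub>v v) $ i =
      (\<Sum>j = 0..<2 * n. (if j = i + n then 1 else if i = j + n then - 1 else 0) * v $ j)"
    using v i by (simp add: symplectic_form_mat_eq scalar_prod_def)
  also have "\<dots> = (\<Sum>j = 0..<2 * n. if j = (if i < n then i + n else i - n) then (if i < n then v $ (i + n) else - v $ (i - n)) else 0)"
    using i by (intro sum.cong refl) auto
  also have "\<dots> = (if i < n then v $ (i + n) else - v $ (i - n))"
    using i by (subst sum.delta) auto
  finally show ?thesis .
qed

lemma alternating_symplectic_form: "alternating_mat (symplectic_form_mat n :: 'a :: field mat)"
proof -
  have "v \<bullet> (symplectic_form_mat n *\<^sub>v v) = 0" if v: "dim_vec v = 2 * n" for v :: "'a vec"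
  proof -
    have "v \<bullet> (symplectic_form_mat n *\<^sub>v v) = (\<Sum>i = 0..<2 * n. v $ i * (if i < n then v $ (i + n) else - v $ (i - n)))"
      using v by (simp add: scalar_prod_def[of v] symplectic_form_mult_vec del: index_mult_mat_vec)
    also have "\<dots> = (\<Sum>i = 0..<n. v $ i * v $ (i + n)) + (\<Sum>i = n..<2 * n. - (v $ i * v $ (i - n)))"
    proof -
      have "{0..<2 * n} = {0..<n} \<union> {n..<2 * n}" by auto
      then show ?thesis by (simp add: sum.union_disjoint)
    qed
    also have "(\<Sum>i = n..<2 * n. - (v $ i * v $ (i - n))) = (\<Sum>i = 0..<n. - (v $ (i + n) * v $ i))"
      by (rule sum.reindex_bij_witness[of _ "\<lambda>i. i + n" "\<lambda>i. i - n"]) auto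
    finally show ?thesis by (simp add: sum_negf mult.commute)
  qed
  moreover have "(symplectic_form_mat n)\<^sup>T = - (symplectic_form_mat n :: 'a mat)"
    by (intro eq_matI) (auto simp: symplectic_form_mat_eq)
  ultimately show ?thesis by (simp add: alternating_mat_def)
qed

lemma symplectic_form_squared:
  "symplectic_form_mat n * symplectic_form_mat n = - (1\<^sub>m (2 * n) :: 'a :: field mat)"
proof (rule eq_mat_by_vec)
  fix v :: "'a vec" assume "dim_vec v = dim_col (- (1\<^sub>m (2 * n) :: 'a mat))"
  then have v: "dim_vec v = 2 * n" by simp
  have "symplectic_form_mat n *\<^sub>v (symplectic_form_mat n *\<^sub>v v) = - v"
    using v by (intro eq_vecI) (auto simp: symplectic_form_mult_vec simp del: index_mult_mat_vec)
  then show "symplectic_form_mat n * symplectic_form_mat n *\<^sub>v v = - 1\<^sub>m (2 * n) *\<^sub>v v"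
    using v by (simp add: mat_vec_assoc)
qed auto

lemma inj_symplectic_form: "inj_mat (symplectic_form_mat n :: 'a :: field mat)"
proof (rule left_inverse_inj_mat)
  show "- symplectic_form_mat n * symplectic_form_mat n = (1\<^sub>m (dim_col (symplectic_form_mat n)) :: 'a mat)"
    by (simp add: symplectic_form_squared)
qed auto

lemma symplectic_group_eq:
  "symplectic_group n = {W \<in> inj_mats (2 * n) (2 * n).
     W\<^sup>T * symplectic_form_mat n * W = (symplectic_form_mat n :: 'a :: {field, finite} mat)}"
proof -
  have "invertible_mat W \<longleftrightarrow> inj_mat W" if W: "W \<in> carrier_mat (2 * n) (2 * n)" for W :: "'a mat"
  proof
    assume "invertible_mat W"
    then obtain B where B: "W * B = 1\<^sub>m (2 * n)" "B * W = 1\<^sub>m (dim_row B)"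
      using W by (auto simp: invertible_mat_def inverts_mat_def)
    have "dim_col B = 2 * n" using B(1) by (metis index_mult_mat(3) index_one_mat(3))
    moreover have "dim_row B = 2 * n"
      using B(2) W by (metis carrier_matD(2) index_mult_mat(3) index_one_mat(3))
    ultimately show "inj_mat W" using B(2) W by (intro left_inverse_inj_mat[of B]) auto
  next
    assume "inj_mat W"
    then obtain B where "B \<in> carrier_mat (2 * n) (2 * n)" "B * W = 1\<^sub>m (2 * n)" "W * B = 1\<^sub>m (2 * n)"
      using square_inj_mat_inverse[OF _ W] by blast
    then show "invertible_mat W"
      using W by (auto simp: invertible_mat_def inverts_mat_def square_mat.simps)
  qed
  then show ?thesis by (auto simp: symplectic_group_def inj_mats_def)
qed

text \<open>The columns of a symplectic matrix are chosen from the last to the first, prescribing the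
  trailing principal submatrices of the form as Gram matrices.\<close>

lemma card_symplectic_group:
  defines "q \<equiv> real CARD('a :: {field, finite})"
  shows "real (card (symplectic_group n :: 'a mat set)) = q ^ (n * (2 * n + 1)) * qfac ((1 / q)\<^sup>2) n"
proof -
  have q: "q > 1" using one_less_card_field[where 'a = 'a] by (simp add: q_def)
  let ?d = "2 * n"
  define J :: "'a mat" where "J = symplectic_form_mat n"
  have J: "alternating_mat J" "inj_mat J" "dim_row J = ?d" "dim_col J = ?d"
    by (simp_all add: J_def alternating_symplectic_form inj_symplectic_form)
  \<comment> \<open>\<open>K k\<close> is the trailing principal block of the form, and
    \<open>c k\<close> the part below the diagonal of the column just before that block, at index
    \<open>2n - Suc k\<close>.\<close>
  define K where "K k = mat k k (\<lambda>(i, j). J $$ (?d - k + i, ?d - k + j))" for k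
  define c where "c k = vec k (\<lambda>i. J $$ (?d - k + i, ?d - Suc k))" for k
  define T where "T k = {W \<in> inj_mats ?d k. W\<^sup>T * J * W = K k}" for k
  have K_dim: "K k \<in> carrier_mat k k" "dim_vec (c k) = k" for k by (auto simp: K_def c_def)
  have Jij: "J $$ (i, j) = (if j = i + n then 1 else if i = j + n then - 1 else 0)" if "i < ?d" "j < ?d" for i j
    using that by (simp add: J_def symplectic_form_mat_eq)
  have K_Suc: "K (Suc k) = border_mat 0 (- c k) (c k) (K k)" if k: "k < ?d" for k
  proof (rule eq_matI)
    fix i j assume "i < dim_row (border_mat 0 (- c k) (c k) (K k))" "j < dim_col (border_mat 0 (- c k) (c k) (K k))"
    then have ij: "i < Suc k" "j < Suc k" using K_dim[of k] by auto
    have dims: "dim_vec (c k) = k" "dim_vec (- c k) = k" "K k \<in> carrier_mat k k"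
      using K_dim[of k] by auto
    have s: "?d - Suc k + Suc l = ?d - k + l" for l using k by simp
    have KS: "K (Suc k) $$ (a, b) = J $$ (?d - Suc k + a, ?d - Suc k + b)" if "a < Suc k" "b < Suc k" for a b
      using that by (simp add: K_def)
    show "K (Suc k) $$ (i, j) = border_mat 0 (- c k) (c k) (K k) $$ (i, j)"
    proof (cases i)
      case 0
      show ?thesis
      proof (cases j)
        case 0
        then show ?thesis using \<open>i = 0\<close> k border_mat_index(1)[OF dims]
          by (simp add: KS Jij)
      next
        case (Suc l)
        then have l: "l < k" using ij by simp
        have "K (Suc k) $$ (i, j) = J $$ (?d - Suc k, ?d - k + l)"
          unfolding KS[OF ij] by (simp only: \<open>i = 0\<close> Suc s add_0_right)
        also have "\<dots> = - J $$ (?d - k + l, ?d - Suc k)"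
          using k l by (simp add: Jij)
        also have "\<dots> = border_mat 0 (- c k) (c k) (K k) $$ (i, j)"
          using \<open>i = 0\<close> Suc l border_mat_index(2)[OF dims l] by (simp add: c_def)
        finally show ?thesis .
      qed
    next
      case (Suc i')
      then have i': "i' < k" using ij by simp
      show ?thesis
      proof (cases j)
        case 0
        have "K (Suc k) $$ (i, j) = J $$ (?d - k + i', ?d - Suc k)"
          unfolding KS[OF ij] by (simp only: 0 Suc s add_0_right)
        then show ?thesis
          using Suc 0 i' border_mat_index(3)[OF dims i'] by (simp add: c_def)
      next
        case j: (Suc l)
        then have l: "l < k" using ij by simp
        have "K (Suc k) $$ (i, j) = J $$ (?d - k + i', ?d - k + l)"
          unfolding KS[OF ij] by (simp only: j Suc s)
        then show ?thesis
          using Suc j i' l border_mat_index(4)[OF dims i' l] by (simp add: K_def)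
      qed
    qed
  qed (use K_dim[of k] in \<open>auto simp: K_def\<close>)
  \<comment> \<open>The prescribed pairings form a surjective linear system with
    \<open>q ^ (2n - k)\<close> solutions. For \<open>k < n\<close> the system is homogeneous and
    the \<open>q ^ k\<close> vectors in the span of the columns solve it, so they are excluded; for
    \<open>k \<ge> n\<close> no solution lies in the span.\<close>
  have fibre: "real (card {w \<in> carrier_vec ?d - mat_range W. W\<^sup>T * J *\<^sub>v w = c k}) =
      q ^ (?d - k) - (if k < n then q ^ k else 0)" if W: "W \<in> T k" and k: "k < ?d" for W k
  proof -
    have Wi: "W \<in> inj_mats ?d k" and Wc: "W \<in> carrier_mat ?d k" "inj_mat W" and g: "W\<^sup>T * J * W = K k"
      using W by (auto simp: T_def inj_mats_def)
    have [simp]: "dim_row W = ?d" "dim_col W = k" using Wc by auto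
    let ?B = "W\<^sup>T * J"
    let ?S = "{w \<in> carrier_vec ?d. ?B *\<^sub>v w = c k}"
    have surj: "surj_mat ?B"
      using Wc J inj_iff_surj_square[of J] by (intro surj_mat_mult) (auto simp: surj_mat_transpose_iff)
    then have "c k \<in> mat_range ?B" using K_dim[of k] by (simp add: surj_mat_def)
    then have "card ?S = card (mat_kernel ?B)"
      using card_kernel_translate[of "c k" ?B] J by simp
    also have "\<dots> = CARD('a) ^ (?d - k)"
      using surj J by (simp add: card_mat_kernel surj_mat_iff_mrank)
    finally have S: "card ?S = CARD('a) ^ (?d - k)" .
    have Bw: "?B *\<^sub>v (W *\<^sub>v y) = K k *\<^sub>v y" if "dim_vec y = k" for y
      unfolding g[symmetric] using that J by (simp add: mat_vec_assoc)
    have fin: "finite ?S" by (rule finite_subset[OF _ finite_carrier_vec[of ?d]]) blast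
    show ?thesis
    proof (cases "k < n")
      case True
      have "K k = 0\<^sub>m k k" "c k = 0\<^sub>v k"
        using True by (auto simp: K_def c_def Jij intro!: eq_matI eq_vecI)
      then have sub: "mat_range W \<subseteq> ?S"
        using Bw by (auto simp: mem_mat_range)
      have "{w \<in> carrier_vec ?d - mat_range W. ?B *\<^sub>v w = c k} = ?S - mat_range W" by blast
      moreover have "card (?S - mat_range W) = card ?S - card (mat_range W)"
        using sub by (intro card_Diff_subset) auto
      moreover have "card (mat_range W) \<le> card ?S" using sub fin by (intro card_mono)
      ultimately show ?thesis
        using S True mrank_inj_mats[OF Wi] by (simp add: of_nat_diff card_mat_range q_def)
    next
      case False
      have "?B *\<^sub>v w \<noteq> c k" if "w \<in> mat_range W" for w
      proof
        assume eq: "?B *\<^sub>v w = c k"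
        obtain y where y: "dim_vec y = k" "w = W *\<^sub>v y" using \<open>w \<in> mat_range W\<close> by (auto simp: mem_mat_range)
        have n: "0 < n" using k by simp
        \<comment> \<open>Row \<open>n - 1\<close> of the block belongs to the symplectic partner of
          the new index, which lies outside the block. So the row is zero, while \<open>c k\<close>
          has the entry -1 there.\<close>
        have "row (K k) (n - 1) = 0\<^sub>v k"
          using False k n by (intro eq_vecI) (auto simp: K_def Jij)
        then have "(K k *\<^sub>v y) $ (n - 1) = 0"
          using False n y(1) K_dim[of k] by (simp add: scalar_prod_left_zero)
        moreover have "c k $ (n - 1) = - 1"
          using False k n by (simp add: c_def Jij)
        ultimately show False using eq Bw[OF y(1)] y(2) by simp
      qed
      then have "{w \<in> carrier_vec ?d - mat_range W. ?B *\<^sub>v w = c k} = ?S" by blast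
      then show ?thesis using S False by (simp add: q_def)
    qed
  qed
  have count: "real (card (T k)) = (\<Prod>i<k. q ^ (?d - i) - (if i < n then q ^ i else 0))" if "k \<le> ?d" for k
    using that
  proof (induction k)
    case 0
    have "(0\<^sub>m ?d 0)\<^sup>T * J * 0\<^sub>m ?d 0 = K 0"
      by (intro eq_matI) (auto simp: K_def)
    then have "T 0 = {0\<^sub>m ?d 0}" unfolding T_def inj_mats_0 by auto
    then show ?case by simp
  next
    case (Suc k)
    then have k: "k < ?d" by simp
    have iff: "(add_col w W)\<^sup>T * J * add_col w W = K (Suc k) \<longleftrightarrow>
        W\<^sup>T * J * W = K k \<and> W\<^sup>T * J *\<^sub>v w = c k"
      if W: "W \<in> carrier_mat ?d k" and w: "dim_vec w = ?d" for W w
    proof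
      let ?C = "W\<^sup>T * J * W" and ?b = "W\<^sup>T * J *\<^sub>v w"
      have gram: "(add_col w W)\<^sup>T * J * add_col w W = border_mat 0 (- ?b) ?b ?C"
        by (rule gram_add_col[OF J(1,3) W w])
      {
        assume "(add_col w W)\<^sup>T * J * add_col w W = K (Suc k)"
        then have eq: "border_mat 0 (- ?b) ?b ?C = border_mat 0 (- c k) (c k) (K k)"
          unfolding gram K_Suc[OF k] .
        have "?C \<in> carrier_mat k k" using W by (intro carrier_matI) auto
        then show "?C = K k \<and> ?b = c k"
          using border_mat_inject[OF eq, of k k] K_dim[of k] W by simp
      next
        assume "?C = K k \<and> ?b = c k"
        then show "(add_col w W)\<^sup>T * J * add_col w W = K (Suc k)"
          unfolding gram K_Suc[OF k] by simp
      }
    qed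
    have "real (card (T (Suc k))) = (\<Sum>A\<in>inj_mats ?d (Suc k). if A\<^sup>T * J * A = K (Suc k) then 1 else 0)"
      unfolding T_def by (subst sum.If_cases) (auto simp: Int_def)
    also have "\<dots> = (\<Sum>W\<in>inj_mats ?d k. \<Sum>w\<in>carrier_vec ?d - mat_range W.
        if W\<^sup>T * J * W = K k \<and> W\<^sup>T * J *\<^sub>v w = c k then 1 else 0)"
      unfolding sum_inj_mats_Suc by (intro sum.cong refl) (auto simp: iff inj_mats_def)
    also have "\<dots> = (\<Sum>W\<in>inj_mats ?d k. if W\<^sup>T * J * W = K k
        then real (card {w \<in> carrier_vec ?d - mat_range W. W\<^sup>T * J *\<^sub>v w = c k}) else 0)"
    proof (intro sum.cong refl)
      fix W :: "'a mat"
      have "(\<Sum>w\<in>carrier_vec ?d - mat_range W. if W\<^sup>T * J *\<^sub>v w = c k then 1 else 0) =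
          real (card {w \<in> carrier_vec ?d - mat_range W. W\<^sup>T * J *\<^sub>v w = c k})"
        by (subst sum.If_cases) (auto simp: Int_def conj_ac)
      then show "(\<Sum>w\<in>carrier_vec ?d - mat_range W.
          if W\<^sup>T * J * W = K k \<and> W\<^sup>T * J *\<^sub>v w = c k then 1 else 0) =
          (if W\<^sup>T * J * W = K k
           then real (card {w \<in> carrier_vec ?d - mat_range W. W\<^sup>T * J *\<^sub>v w = c k}) else 0)"
        by simp
    qed
    also have "\<dots> = (\<Sum>W\<in>T k. real (card {w \<in> carrier_vec ?d - mat_range W. W\<^sup>T * J *\<^sub>v w = c k}))"
      unfolding T_def by (rule sum.inter_filter[symmetric]) simp
    also have "\<dots> = (\<Sum>W\<in>T k. q ^ (?d - k) - (if k < n then q ^ k else 0))"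
      by (intro sum.cong refl fibre k)
    finally show ?case using Suc by simp
  qed
  have "T ?d = symplectic_group n"
  proof -
    have "K ?d = J" using J by (intro eq_matI) (auto simp: K_def)
    then show ?thesis unfolding T_def symplectic_group_eq J_def by simp
  qed
  then have "real (card (symplectic_group n :: 'a mat set)) = (\<Prod>i<?d. q ^ (?d - i) - (if i < n then q ^ i else 0))"
    using count[of ?d] by simp
  also have "\<dots> = (\<Prod>i<?d. q ^ (?d - i) * (if i < n then 1 - ((1 / q)\<^sup>2) ^ (n - i) else 1))"
  proof (intro prod.cong refl)
    fix i assume "i \<in> {..<?d}"
    have "q ^ (?d - i) * ((1 / q)\<^sup>2) ^ (n - i) = q ^ i" if i: "i < n"
    proof -
      have "?d - i = i + 2 * (n - i)" using i by simp
      then have "q ^ (?d - i) = q ^ i * (q\<^sup>2) ^ (n - i)" by (simp only: power_add power_mult)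
      moreover have "(q\<^sup>2) ^ (n - i) * ((1 / q)\<^sup>2) ^ (n - i) = 1"
        using q by (simp add: power_divide flip: power_mult_distrib)
      ultimately show ?thesis by simp
    qed
    then show "q ^ (?d - i) - (if i < n then q ^ i else 0) =
        q ^ (?d - i) * (if i < n then 1 - ((1 / q)\<^sup>2) ^ (n - i) else 1)"
      by (simp add: right_diff_distrib)
  qed
  also have "\<dots> = (\<Prod>i<?d. q ^ (?d - i)) * (\<Prod>i<?d. if i < n then 1 - ((1 / q)\<^sup>2) ^ (n - i) else 1)"
    by (rule prod.distrib)
  also have "(\<Prod>i<?d. q ^ (?d - i)) = q ^ (n * (2 * n + 1))"
  proof -
    have "(\<Sum>i<?d. ?d - i) = (\<Sum>i = 1..?d. i)"
      by (rule sum.reindex_bij_witness[of _ "\<lambda>i. ?d - i" "\<lambda>i. ?d - i"]) auto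
    also have "\<dots> = n * (2 * n + 1)" by (induction n) auto
    finally show ?thesis by (simp flip: power_sum)
  qed
  also have "(\<Prod>i<?d. if i < n then 1 - ((1 / q)\<^sup>2) ^ (n - i) else 1) = (\<Prod>i<n. 1 - ((1 / q)\<^sup>2) ^ (n - i))"
    by (rule prod.mono_neutral_cong_right) auto
  also have "\<dots> = qfac ((1 / q)\<^sup>2) n"
    unfolding qfac_def
    by (rule prod.reindex_bij_witness[of _ "\<lambda>i. n - i" "\<lambda>i. n - i"]) auto
  finally show ?thesis .
qed

text \<open>Since \<open>J * J = - 1\<close>, expanding \<open>(1 + Z J) J (1 + Z J)\<^sup>T\<close>
  gives \<open>J - Z + Z\<^sup>T + Z J Z\<^sup>T\<close>, so preserving \<open>J\<close> is the Wall
  equation. The extra factor \<open>J\<close> in the type is injective and leaves ranks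
  unchanged.\<close>

lemma card_symplectic_rank_type:
  fixes \<rho> :: "nat \<Rightarrow> nat"
  shows "card {h \<in> symplectic_group n :: 'a :: {field, finite} mat set. \<forall>i. mrank ((h - 1\<^sub>m (2 * n)) ^\<^sub>m i) = \<rho> i} =
    card (wall_type (symplectic_form_mat n :: 'a mat) \<rho>)"
proof -
  let ?d = "2 * n" and ?J = "symplectic_form_mat n :: 'a mat"
  let ?f = "\<lambda>Z. 1\<^sub>m ?d + Z * ?J"
  have Jt: "?J\<^sup>T = - ?J" using alternating_symplectic_form[of n, where 'a = 'a] unfolding alternating_mat_def by blast
  have JJ: "?J * (?J * X) = - X" if "dim_row X = ?d" for X
    using that symplectic_form_squared[of n, where 'a = 'a] by (simp flip: mat_assoc)
  have Jc: "?J \<in> carrier_mat ?d ?d" by (intro carrier_matI) auto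
  \<comment> \<open>The group is defined by \<open>h\<^sup>T J h = J\<close>, whereas the Wall
    equation comes from \<open>h J h\<^sup>T = J\<close>. They say that the products of
    \<open>h J\<close> and \<open>h\<^sup>T J\<close> in the two orders are -1.\<close>
  have sp_iff: "h \<in> symplectic_group n \<longleftrightarrow> h * ?J * h\<^sup>T = ?J" if h: "h \<in> carrier_mat ?d ?d" for h
  proof -
    have [simp]: "dim_row h = ?d" "dim_col h = ?d" using h by auto
    have swap: "B * A = - 1\<^sub>m ?d" if "A * B = - 1\<^sub>m ?d" "A \<in> carrier_mat ?d ?d" "B \<in> carrier_mat ?d ?d" for A B :: "'a mat"
    proof -
      have "(- A) * B = 1\<^sub>m ?d" using that by simp
      then have "B * (- A) = 1\<^sub>m ?d"
        using that by (intro mat_mult_left_right_inverse[of "- A" ?d B]) auto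
      then have "- (B * A) = 1\<^sub>m ?d" using that(2,3) by simp
      then show ?thesis by (metis uminus_uminus_mat)
    qed
    have c: "X * ?J \<in> carrier_mat ?d ?d" "?J * X \<in> carrier_mat ?d ?d" if "X \<in> carrier_mat ?d ?d" for X
      using that Jc by auto
    have a: "h\<^sup>T * ?J * h = ?J" if "h * ?J * h\<^sup>T = ?J"
    proof -
      have "(h * ?J) * (h\<^sup>T * ?J) = - 1\<^sub>m ?d"
        using arg_cong[OF that, of "\<lambda>X. X * ?J"] symplectic_form_squared[of n, where 'a = 'a] by (simp add: mat_assoc)
      from swap[OF this c(1) c(1)] have "(h\<^sup>T * ?J) * (h * ?J) = - 1\<^sub>m ?d"
        using h by simp
      moreover have "h\<^sup>T * ?J * (h * ?J) * ?J = (h\<^sup>T * ?J * h) * (?J * ?J)"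
        by (simp add: mat_assoc)
      ultimately have "- (h\<^sup>T * ?J * h) = - ?J"
        using h by (simp add: symplectic_form_squared)
      then show ?thesis by simp
    qed
    have b: "h * ?J * h\<^sup>T = ?J" if "h\<^sup>T * ?J * h = ?J"
    proof -
      have "(h\<^sup>T * ?J) * (h * ?J) = - 1\<^sub>m ?d"
        using arg_cong[OF that, of "\<lambda>X. X * ?J"] symplectic_form_squared[of n, where 'a = 'a] by (simp add: mat_assoc)
      from swap[OF this c(1) c(1)] have "(h * ?J) * (h\<^sup>T * ?J) = - 1\<^sub>m ?d"
        using h by simp
      moreover have "h * ?J * (h\<^sup>T * ?J) * ?J = (h * ?J * h\<^sup>T) * (?J * ?J)"
        by (simp add: mat_assoc)
      ultimately have "- (h * ?J * h\<^sup>T) = - ?J"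
        using h by (simp add: symplectic_form_squared)
      then show ?thesis by simp
    qed
    have inj: "inj_mat h" if "h\<^sup>T * ?J * h = ?J"
    proof (rule inj_matI)
      fix v :: "'a vec" assume v: "dim_vec v = dim_col h" "h *\<^sub>v v = 0\<^sub>v (dim_row h)"
      have "?J *\<^sub>v v = (h\<^sup>T * ?J * h) *\<^sub>v v" using that by simp
      also have "\<dots> = h\<^sup>T *\<^sub>v (?J *\<^sub>v (h *\<^sub>v v))"
        using v(1) by (simp add: mat_vec_assoc)
      also have "\<dots> = 0\<^sub>v ?d" unfolding v(2) by simp
      finally have "?J *\<^sub>v v = 0\<^sub>v ?d" .
      then show "v = 0\<^sub>v (dim_col h)" using inj_matD[OF inj_symplectic_form, of v] v by simp
    qed
    show ?thesis
      unfolding symplectic_group_eq inj_mats_def using h a b inj by blast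
  qed
  have wall_iff: "?f Z \<in> symplectic_group n \<longleftrightarrow> Z \<in> wall_forms ?J" if Z: "Z \<in> carrier_mat ?d ?d" for Z
  proof -
    have [simp]: "dim_row Z = ?d" "dim_col Z = ?d" using Z by auto
    have fc: "?f Z \<in> carrier_mat ?d ?d" using Z Jc by simp
    have t: "(?f Z)\<^sup>T = 1\<^sub>m ?d - ?J * Z\<^sup>T"
    proof -
      have "(?f Z)\<^sup>T = 1\<^sub>m ?d + (Z * ?J)\<^sup>T"
        using Z Jc by (subst transpose_add[of _ ?d ?d]) auto
      also have "(Z * ?J)\<^sup>T = - (?J * Z\<^sup>T)"
        by (simp add: transpose_mult' Jt)
      also have "1\<^sub>m ?d + - (?J * Z\<^sup>T) = 1\<^sub>m ?d - ?J * Z\<^sup>T"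
        by (intro eq_matI) auto
      finally show ?thesis .
    qed
    have l: "?f Z * ?J = ?J - Z"
    proof -
      have "?f Z * ?J = 1\<^sub>m ?d * ?J + Z * ?J * ?J"
        using Z Jc by (intro add_mult_distrib_mat[of _ ?d ?d _ _ ?d]) auto
      also have "Z * ?J * ?J = - Z"
        using symplectic_form_squared[of n, where 'a = 'a] by (simp add: mat_assoc)
      also have "1\<^sub>m ?d * ?J + - Z = ?J - Z" by (simp, intro eq_matI) auto
      finally show ?thesis .
    qed
    have "?f Z * ?J * (?f Z)\<^sup>T = (?J - Z) * 1\<^sub>m ?d - (?J - Z) * (?J * Z\<^sup>T)"
      unfolding t l using Z Jc by (intro mult_minus_distrib_mat[of _ ?d ?d _ ?d]) auto
    also have "(?J - Z) * (?J * Z\<^sup>T) = ?J * (?J * Z\<^sup>T) - Z * (?J * Z\<^sup>T)"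
      using Z Jc by (intro minus_mult_distrib_mat[of _ ?d ?d _ _ ?d]) auto
    also have "\<dots> = - Z\<^sup>T - Z * ?J * Z\<^sup>T"
      by (simp add: JJ mat_assoc)
    finally have e: "?f Z * ?J * (?f Z)\<^sup>T =
        (?J - Z) - (- Z\<^sup>T - Z * ?J * Z\<^sup>T)" by simp
    let ?G = "Z * ?J * Z\<^sup>T"
    have "?f Z * ?J * (?f Z)\<^sup>T = ?J \<longleftrightarrow> Z - Z\<^sup>T = ?G"
    proof -
      have ew: "?f Z * ?J * (?f Z)\<^sup>T = ?J \<longleftrightarrow>
          (\<forall>i<?d. \<forall>j<?d. (?J - Z - (- Z\<^sup>T - ?G)) $$ (i, j) = ?J $$ (i, j))"
        unfolding e by (auto simp: mat_eq_iff)
      have ew': "Z - Z\<^sup>T = ?G \<longleftrightarrow>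
          (\<forall>i<?d. \<forall>j<?d. (Z - Z\<^sup>T) $$ (i, j) = ?G $$ (i, j))"
        by (auto simp: mat_eq_iff)
      have "(?J - Z - (- Z\<^sup>T - ?G)) $$ (i, j) = ?J $$ (i, j) \<longleftrightarrow>
          (Z - Z\<^sup>T) $$ (i, j) = ?G $$ (i, j)" if "i < ?d" "j < ?d" for i j
      proof -
        have gen: "a - z - (- b - g) = a \<longleftrightarrow> z - b = g" for a z b g :: 'a
          by (auto simp: algebra_simps)
        have "dim_row ?G = ?d" "dim_col ?G = ?d" by simp_all
        then show ?thesis using that gen[of "?J $$ (i, j)" "Z $$ (i, j)" "Z\<^sup>T $$ (i, j)" "?G $$ (i, j)"]
          by (simp del: index_mult_mat(1) index_transpose_mat(1))
      qed
      then show ?thesis unfolding ew ew' by blast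
    qed
    then show ?thesis
      unfolding sp_iff[OF fc] wall_forms_def using Z by simp
  qed
  have type_iff: "(\<forall>i. mrank ((?f Z - 1\<^sub>m ?d) ^\<^sub>m i) = \<rho> i) \<longleftrightarrow> (\<forall>i. mrank (?J * (Z * ?J) ^\<^sub>m i) = \<rho> i)"
    if Z: "Z \<in> carrier_mat ?d ?d" for Z
  proof -
    have "?f Z - 1\<^sub>m ?d = Z * ?J" using Z Jc by (intro eq_matI) auto
    then show ?thesis using Z by (simp add: mrank_mult_inj inj_symplectic_form)
  qed
  have "bij_betw ?f (wall_type ?J \<rho>) {h \<in> symplectic_group n. \<forall>i. mrank ((h - 1\<^sub>m ?d) ^\<^sub>m i) = \<rho> i}"
  proof (rule bij_betw_imageI)
    show "inj_on ?f (wall_type ?J \<rho>)"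
    \<comment> \<open>The inverse map multiplies \<open>h - 1\<close> by the inverse of
      \<open>J\<close>, which is \<open>- J\<close>.\<close>
    proof (rule inj_on_inverseI[where g = "\<lambda>h. - ((h - 1\<^sub>m ?d) * ?J)"])
      fix Z assume "Z \<in> wall_type ?J \<rho>"
      then have Z: "Z \<in> carrier_mat ?d ?d" by (simp add: wall_type_def wall_forms_def)
      have "?f Z - 1\<^sub>m ?d = Z * ?J" using Z Jc by (intro eq_matI) auto
      then show "- ((?f Z - 1\<^sub>m ?d) * ?J) = Z"
        using Z symplectic_form_squared[of n, where 'a = 'a] by (simp add: mat_assoc)
    qed
    show "?f ` wall_type ?J \<rho> = {h \<in> symplectic_group n. \<forall>i. mrank ((h - 1\<^sub>m ?d) ^\<^sub>m i) = \<rho> i}"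
    proof (intro equalityI subsetI)
      fix h assume "h \<in> ?f ` wall_type ?J \<rho>"
      then obtain Z where Z: "h = ?f Z" "Z \<in> wall_type ?J \<rho>" by blast
      then have "Z \<in> carrier_mat ?d ?d" "Z \<in> wall_forms ?J" by (auto simp: wall_type_def wall_forms_def)
      then show "h \<in> {h \<in> symplectic_group n. \<forall>i. mrank ((h - 1\<^sub>m ?d) ^\<^sub>m i) = \<rho> i}"
        using Z wall_iff[of Z] type_iff[of Z] by (simp add: wall_type_def)
    next
      fix h :: "'a mat" assume h: "h \<in> {h \<in> symplectic_group n. \<forall>i. mrank ((h - 1\<^sub>m ?d) ^\<^sub>m i) = \<rho> i}"
      then have hc: "h \<in> carrier_mat ?d ?d" by (simp add: symplectic_group_def)
      define Z where "Z = - ((h - 1\<^sub>m ?d) * ?J)"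
      have Z: "Z \<in> carrier_mat ?d ?d" using hc Jc by (auto simp: Z_def intro!: carrier_matI)
      have "Z * ?J = h - 1\<^sub>m ?d"
        using hc symplectic_form_squared[of n, where 'a = 'a] by (simp add: Z_def mat_assoc right_mult_one_mat[of _ ?d ?d] minus_carrier_mat)
      then have fZ: "?f Z = h" using hc by (intro eq_matI) auto
      then have "Z \<in> wall_type ?J \<rho>"
        using h wall_iff[OF Z] type_iff[OF Z] by (simp add: wall_type_def)
      then show "h \<in> ?f ` wall_type ?J \<rho>" using fZ by (intro image_eqI[of _ _ Z]) auto
    qed
  qed
  then show ?thesis by (simp add: bij_betw_same_card)
qed

subsection \<open>Jordan types and rank sequences\<close>

text \<open>Links the vector space dimension in the theory of Jordan forms to the rank defined by
  counting: coordinates in a basis \<open>B\<close> identify the kernel with the functions from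
  \<open>B\<close> to the field.\<close>

lemma kernel_dim_eq:
  fixes A :: "'a :: {field, finite} mat"
  shows "kernel_dim A = dim_col A - mrank A"
proof -
  interpret kernel "dim_row A" "dim_col A" A by unfold_locales auto
  obtain B where B: "finite B" "basis B"
    using kernel_basis_exists[of A "dim_row A" "dim_col A"] by auto
  have sub: "B \<subseteq> mat_kernel A" using B(2) by (simp add: Ker.basis_def)
  have crit: "\<exists>!a. a \<in> B \<rightarrow>\<^sub>E UNIV \<and> lincomb a B = v" if "v \<in> mat_kernel A" for v
    using B Ker.basis_criterion[OF B(1) sub] that by auto
  have "bij_betw (\<lambda>a. lincomb a B) (B \<rightarrow>\<^sub>E (UNIV :: 'a set)) (mat_kernel A)"
  proof (rule bij_betw_imageI)
    have mem: "lincomb a B \<in> mat_kernel A" if "a \<in> B \<rightarrow>\<^sub>E (UNIV :: 'a set)" for a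
      using Ker.lincomb_closed[OF sub, of a] by auto
    show "inj_on (\<lambda>a. lincomb a B) (B \<rightarrow>\<^sub>E (UNIV :: 'a set))"
      by (rule inj_onI) (metis crit mem)
    show "(\<lambda>a. lincomb a B) ` (B \<rightarrow>\<^sub>E (UNIV :: 'a set)) = mat_kernel A"
      using mem crit by (auto simp: image_iff) blast
  qed
  then have "card (mat_kernel A) = CARD('a) ^ card B"
    using bij_betw_same_card card_PiE[OF B(1), of "\<lambda>_. UNIV :: 'a set"] by fastforce
  then have "CARD('a) ^ card B = CARD('a) ^ (dim_col A - mrank A)"
    by (simp add: card_mat_kernel)
  then show ?thesis
    using one_less_card_field[where 'a = 'a] Ker.dim_basis[OF B] by simp
qed

lemma mrank_eq_0_iff:
  fixes A :: "'a :: {field, finite} mat"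
  shows "mrank A = 0 \<longleftrightarrow> A = 0\<^sub>m (dim_row A) (dim_col A)"
proof
  assume "mrank A = 0"
  then have "card (mat_range A) = 1" by (simp add: card_mat_range)
  then obtain x where x: "mat_range A = {x}" by (auto simp: card_1_singleton_iff)
  have "A *\<^sub>v v = 0\<^sub>v (dim_row A)" if "dim_vec v = dim_col A" for v
    using x mat_rangeI[OF that] mat_rangeI[of "0\<^sub>v (dim_col A)" A] by simp
  then show "A = 0\<^sub>m (dim_row A) (dim_col A)" by (intro eq_mat_by_vec) auto
next
  assume A: "A = 0\<^sub>m (dim_row A) (dim_col A)"
  have "mat_range (0\<^sub>m n m :: 'a mat) = {0\<^sub>v n}" for n m
    by (auto simp: mem_mat_range intro!: exI[of _ "0\<^sub>v m"])
  then have "card (mat_range A) = 1" using A by (metis card_1_singleton_iff One_nat_def)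
  then show "mrank A = 0" using one_less_card_field[where 'a = 'a] by (simp add: card_mat_range)
qed

lemma inj_mat_power:
  fixes A :: "'a :: comm_ring_1 mat"
  assumes "A \<in> carrier_mat n n" "inj_mat A"
  shows "inj_mat (A ^\<^sub>m k)"
proof (induction k)
  case (Suc k)
  show ?case unfolding pow_mat.simps by (rule inj_mat_mult[OF Suc assms(2)]) (use assms(1) in auto)
qed simp

lemma upper_triangular_add_one:
  fixes T :: "'a :: field mat"
  assumes "T \<in> carrier_mat n n" "upper_triangular T"
  shows "upper_triangular (1\<^sub>m n + T)"
  using assms by (intro upper_triangularI) auto

text \<open>Powers of a block triangular matrix have the powers of the lower block in their lower
  block. The witness \<open>b\<close> leaves the top entry open, since only nilpotency of that block
  is extracted.\<close>

lemma border_zero_col_power: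
  fixes N' :: "'a :: field mat"
  assumes N': "N' \<in> carrier_mat n n" and q: "dim_vec q = n" and v: "dim_vec v = n"
  shows "\<exists>b. border_mat 0 q (0\<^sub>v n) N' ^\<^sub>m k *\<^sub>v vCons a v = vCons b (N' ^\<^sub>m k *\<^sub>v v)"
  using v
proof (induction k arbitrary: a v)
  case 0
  then show ?case using N' by (intro exI[of _ a]) auto
next
  case (Suc k)
  let ?B = "border_mat 0 q (0\<^sub>v n) N'"
  have B: "?B \<in> carrier_mat (Suc n) (Suc n)" using N' by (intro carrier_matI) auto
  have "?B ^\<^sub>m Suc k *\<^sub>v vCons a v = ?B ^\<^sub>m k *\<^sub>v (?B *\<^sub>v vCons a v)"
    using Suc.prems B N' by (simp add: mat_vec_assoc)
  also have "?B *\<^sub>v vCons a v = vCons (q \<bullet> v) (N' *\<^sub>v v)"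
    using Suc.prems N' q by (subst border_mat_mult_vCons) (auto intro!: eq_vecI)
  finally have e: "?B ^\<^sub>m Suc k *\<^sub>v vCons a v = ?B ^\<^sub>m k *\<^sub>v vCons (q \<bullet> v) (N' *\<^sub>v v)" .
  have "N' ^\<^sub>m Suc k *\<^sub>v v = N' ^\<^sub>m k *\<^sub>v (N' *\<^sub>v v)"
    using Suc.prems N' by (simp add: mat_vec_assoc)
  then show ?case
    unfolding e using Suc.IH[of "N' *\<^sub>v v" "q \<bullet> v"] N' by simp
qed

text \<open>Needed because the library proves the existence of Jordan normal forms for upper triangular
  matrices over any field, but triangularizes only over fields with a conjugation.\<close>

lemma nilpotent_similar_upper_triangular:
  fixes N :: "'a :: {field, finite} mat"
  assumes "N \<in> carrier_mat n n" "N ^\<^sub>m k = 0\<^sub>m n n"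
  shows "\<exists>T \<in> carrier_mat n n. upper_triangular T \<and> similar_mat N T"
  using assms
proof (induction n arbitrary: N)
  case 0
  then show ?case by (intro bexI[of _ N]) (auto intro: similar_mat_refl)
next
  case (Suc n)
  have "\<not> inj_mat N"
  proof
    assume "inj_mat N"
    then have "inj_mat (0\<^sub>m (Suc n) (Suc n) :: 'a mat)"
      using inj_mat_power[OF Suc.prems(1), of k] Suc.prems(2) by simp
    then show False
      using inj_matD[of "0\<^sub>m (Suc n) (Suc n) :: 'a mat" "vCons 1 (0\<^sub>v n)"] by (simp add: zero_vec_Suc)
  qed
  then obtain v where v: "dim_vec v = Suc n" "N *\<^sub>v v = 0\<^sub>v (Suc n)" "v \<noteq> 0\<^sub>v (Suc n)"
    using inj_matI[of N] Suc.prems(1) by auto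
  obtain L where L: "L \<in> carrier_mat (Suc n) n" "inj_mat (add_col v L)"
    using extend_to_inj_mat[OF v(1,3)] by blast
  define g where "g = add_col v L"
  have g: "g \<in> carrier_mat (Suc n) (Suc n)" using L by (auto simp: g_def intro!: carrier_matI)
  obtain h where h: "h \<in> carrier_mat (Suc n) (Suc n)" "h * g = 1\<^sub>m (Suc n)" "g * h = 1\<^sub>m (Suc n)"
    using square_inj_mat_inverse[OF _ g] L(2) by (auto simp: g_def)
  \<comment> \<open>In a basis that starts with a kernel vector the first column of the matrix is
    zero.\<close>
  define M where "M = h * N * g"
  have M: "M \<in> carrier_mat (Suc n) (Suc n)" using h g Suc.prems(1) by (auto simp: M_def)
  have "M *\<^sub>v vCons 1 (0\<^sub>v n) = h *\<^sub>v (N *\<^sub>v (g *\<^sub>v vCons 1 (0\<^sub>v n)))"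
    unfolding M_def using h g Suc.prems(1) by (simp add: mat_vec_assoc)
  also have "g *\<^sub>v vCons 1 (0\<^sub>v n) = v"
    unfolding g_def using L v by (subst add_col_mult_vCons) (auto intro!: eq_vecI)
  also have "h *\<^sub>v (N *\<^sub>v v) = vCons 0 (0\<^sub>v n)"
    unfolding v(2) zero_vec_Suc[symmetric] using h by simp
  finally have M0: "M *\<^sub>v vCons 1 (0\<^sub>v n) = vCons 0 (0\<^sub>v n)" .
  obtain t q p N' where b: "M = border_mat t q p N'" "dim_vec q = n" "dim_vec p = n" "N' \<in> carrier_mat n n"
    using ex_border_mat[OF M] by blast
  have "M *\<^sub>v vCons 1 (0\<^sub>v n) = vCons (t * 1 + q \<bullet> 0\<^sub>v n) (1 \<cdot>\<^sub>v p + N' *\<^sub>v 0\<^sub>v n)"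
    unfolding b(1) using b by (intro border_mat_mult_vCons) auto
  also have "\<dots> = vCons t p"
    using b by (simp add: scalar_prod_right_zero)
  finally have "t = 0" "p = 0\<^sub>v n" using M0 by auto
  then have b': "M = border_mat 0 q (0\<^sub>v n) N'" using b(1) by simp
  have sim: "similar_mat_wit M N h g"
    using h g M Suc.prems(1) by (intro similar_mat_witI[of _ _ "Suc n"]) (auto simp: M_def)
  have "M ^\<^sub>m k = h * N ^\<^sub>m k * g" by (rule similar_mat_wit_pow_id[OF sim])
  then have Mk: "M ^\<^sub>m k = 0\<^sub>m (Suc n) (Suc n)" using Suc.prems h g by simp
  have "N' ^\<^sub>m k = 0\<^sub>m n n"
  proof (rule eq_mat_by_vec)
    fix x :: "'a vec" assume "dim_vec x = dim_col (0\<^sub>m n n :: 'a mat)"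
    then have x: "dim_vec x = n" by simp
    obtain c where "M ^\<^sub>m k *\<^sub>v vCons 0 x = vCons c (N' ^\<^sub>m k *\<^sub>v x)"
      unfolding b' using border_zero_col_power[OF b(4,2) x] by blast
    then show "N' ^\<^sub>m k *\<^sub>v x = 0\<^sub>m n n *\<^sub>v x" unfolding Mk using x by (simp add: zero_vec_Suc)
  qed (use b in auto)
  then obtain T' where T': "T' \<in> carrier_mat n n" "upper_triangular T'" "similar_mat N' T'"
    using Suc.IH[OF b(4)] by blast
  have Mb: "M = four_block_mat (0\<^sub>m 1 1) (mat_of_row q) (0\<^sub>m n 1) N'"
  proof (rule eq_matI)
    fix i j assume "i < dim_row (four_block_mat (0\<^sub>m 1 1) (mat_of_row q) (0\<^sub>m n 1) N')"
      "j < dim_col (four_block_mat (0\<^sub>m 1 1) (mat_of_row q) (0\<^sub>m n 1) N')"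
    then have "i < Suc n" "j < Suc n" using b by auto
    then show "M $$ (i, j) = four_block_mat (0\<^sub>m 1 1) (mat_of_row q) (0\<^sub>m n 1) N' $$ (i, j)"
      unfolding b' using b(2,4)
      by (cases i; cases j) (auto simp: border_mat_index[of "0\<^sub>v n" n q n N'])
  qed (use b b' in auto)
  have c: "mat_of_row q \<in> carrier_mat 1 n" using b(2) by auto
  obtain B0 where B0: "B0 \<in> carrier_mat 1 n"
    "similar_mat M (four_block_mat (0\<^sub>m 1 1) B0 (0\<^sub>m n 1) T')"
    using similar_mat_four_block_0_ex[OF similar_mat_refl[OF zero_carrier_mat] T'(3) c zero_carrier_mat b(4)]
    unfolding Mb[symmetric] by blast
  let ?T = "four_block_mat (0\<^sub>m 1 1) B0 (0\<^sub>m n 1) T'"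
  have "upper_triangular ?T" using T' by (intro upper_triangular_four_block) auto
  moreover have "similar_mat N ?T"
    using sim B0(2) similar_mat_sym similar_mat_trans unfolding similar_mat_def by meson
  moreover have "?T \<in> carrier_mat (Suc n) (Suc n)"
    using T' four_block_carrier_mat[of "0\<^sub>m 1 1" 1 1 T' n n] by simp
  ultimately show ?case by blast
qed

text \<open>Conjugation fixes the identity, so a triangular form of \<open>h - 1\<close> gives one
  of \<open>h\<close>.\<close>

lemma nilpotent_jordan_nf_exists:
  fixes h :: "'a :: {field, finite} mat"
  assumes h: "h \<in> carrier_mat n n" "(h - 1\<^sub>m n) ^\<^sub>m k = 0\<^sub>m n n"
  shows "\<exists>n_as. jordan_nf h n_as"
proof -
  have N: "h - 1\<^sub>m n \<in> carrier_mat n n" by (rule minus_carrier_mat) simp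
  obtain T where T: "T \<in> carrier_mat n n" "upper_triangular T" "similar_mat (h - 1\<^sub>m n) T"
    using nilpotent_similar_upper_triangular[OF N h(2)] by blast
  obtain P Q where w: "similar_mat_wit (h - 1\<^sub>m n) T P Q" using T(3) by (auto simp: similar_mat_def)
  note w' = similar_mat_witD2[OF N w]
  have "h = 1\<^sub>m n + (h - 1\<^sub>m n)" using h by (intro eq_matI) auto
  also have "\<dots> = P * 1\<^sub>m n * Q + P * T * Q" using w' by simp
  also have "\<dots> = P * (1\<^sub>m n + T) * Q"
  proof -
    have "P * (1\<^sub>m n + T) = P * 1\<^sub>m n + P * T"
      using w' by (intro mult_add_distrib_mat[of _ n n _ n]) auto
    then show ?thesis
      using w' by (simp add: add_mult_distrib_mat[of _ n n _ _ n])
  qed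
  finally have eq: "h = P * (1\<^sub>m n + T) * Q" .
  have "similar_mat_wit h (1\<^sub>m n + T) P Q"
    by (rule similar_mat_witI[of _ _ n]) (use w' eq h in auto)
  then have sim: "similar_mat h (1\<^sub>m n + T)" by (auto simp: similar_mat_def)
  have "jordan_nf (1\<^sub>m n + T) (triangular_to_jnf_vector (1\<^sub>m n + T))"
    using T by (intro triangular_to_jnf_vector[of _ n] upper_triangular_add_one) auto
  then show ?thesis
    using similar_mat_trans[OF sim] unfolding jordan_nf_def by blast
qed

text \<open>A unipotent Jordan block of size \<open>j\<close> contributes the truncated difference
  \<open>j - i\<close> to the rank of the \<open>i\<close>-th power of \<open>h - 1\<close>.\<close>

definition rank_sequence :: "nat multiset \<Rightarrow> nat \<Rightarrow> nat" where
  "rank_sequence mu i = (\<Sum>j\<in>#mu. j - i)"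

text \<open>As a function of \<open>i\<close>, the truncated \<open>j - i\<close> has a single kink,
  at \<open>i = j\<close>, so second differences read off multiplicities.\<close>

lemma rank_sequence_second_difference:
  "rank_sequence mu i + rank_sequence mu (Suc (Suc i)) = 2 * rank_sequence mu (Suc i) + count mu (Suc i)"
proof (induction mu)
  case (add x mu)
  have "(x - i) + (x - Suc (Suc i)) = 2 * (x - Suc i) + (if x = Suc i then 1 else 0)" by auto
  then show ?case using add by (auto simp: rank_sequence_def)
qed (simp add: rank_sequence_def)

lemma rank_sequence_inject:
  assumes "rank_sequence mu = rank_sequence nu" "0 \<notin># mu" "0 \<notin># nu"
  shows "mu = nu"
proof (rule multiset_eqI)
  fix x
  show "count mu x = count nu x"
  proof (cases x)
    case 0
    then show ?thesis using assms(2,3) by (simp add: not_in_iff)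
  next
    case (Suc i)
    then show ?thesis
      using rank_sequence_second_difference[of mu i] rank_sequence_second_difference[of nu i] assms(1)
      by simp
  qed
qed

lemma rank_sequence_0: "rank_sequence mu 0 = sum_mset mu"
  by (simp add: rank_sequence_def)

lemma rank_sequence_large: "sum_mset mu \<le> i \<Longrightarrow> rank_sequence mu i = 0"
proof (induction mu)
  case (add x mu)
  then show ?case by (simp add: rank_sequence_def)
qed (simp add: rank_sequence_def)

lemma rank_sequence_mset: "rank_sequence (mset xs) i = (\<Sum>x\<leftarrow>xs. x - i)"
  by (simp add: rank_sequence_def sum_mset_sum_list flip: mset_map)

text \<open>The kernels of the powers of \<open>h - 1\<close> see only blocks with eigenvalue 1.
  Nilpotency of \<open>h - 1\<close> excludes all other blocks, and then the ranks determine the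
  multiset of sizes.\<close>

lemma unipotent_jordan_type_iff:
  fixes h :: "'a :: {field, finite} mat"
  assumes h: "h \<in> carrier_mat N N" and mu: "is_partition_of mu N"
  shows "unipotent_mat h \<and> has_jordan_block_sizes h mu \<longleftrightarrow>
    (\<forall>i. mrank ((h - 1\<^sub>m N) ^\<^sub>m i) = rank_sequence mu i)"
proof -
  have [simp]: "dim_row h = N" "dim_col h = N" using h by auto
  have Nc: "h - 1\<^sub>m N \<in> carrier_mat N N" by (rule minus_carrier_mat) simp
  have cm: "char_matrix h 1 = h - 1\<^sub>m N"
    by (intro eq_matI) (auto simp: char_matrix_def)
  have unip: "unipotent_mat h \<longleftrightarrow> (\<exists>k. (h - 1\<^sub>m N) ^\<^sub>m k = 0\<^sub>m N N)"
    by (simp add: unipotent_mat_def square_mat.simps)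
  have ranks: "mrank ((h - 1\<^sub>m N) ^\<^sub>m i) = rank_sequence (mset (map fst n_as)) i"
    if jnf: "jordan_nf h n_as" and nil: "(h - 1\<^sub>m N) ^\<^sub>m k = 0\<^sub>m N N" for n_as i k
  proof -
    have pos: "n > 0" if "(n, e) \<in> set n_as" for n e
      using that jnf by (force simp: jordan_nf_def)
    have "similar_mat h (jordan_matrix n_as)" using jnf by (simp add: jordan_nf_def)
    then have N: "N = sum_list (map fst n_as)"
      using similar_matD by (metis \<open>dim_row h = N\<close> carrier_matD(1) insert_subset jordan_matrix_dim(1))
    have ker: "N - mrank ((h - 1\<^sub>m N) ^\<^sub>m j) = (\<Sum>n\<leftarrow>map fst [(n, e)\<leftarrow>n_as. e = 1]. min j n)" for j
    proof -
      have d: "dim_col ((h - 1\<^sub>m N) ^\<^sub>m j) = N" by (rule carrier_matD(2)[OF pow_carrier_mat[OF Nc]])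
      show ?thesis
        using dim_gen_eigenspace[OF jnf, of 1 j] unfolding dim_gen_eigenspace_def cm kernel_dim_eq d .
    qed
    have le: "mrank ((h - 1\<^sub>m N) ^\<^sub>m j) \<le> N" for j
      using mrank_le_dim_col[of "(h - 1\<^sub>m N) ^\<^sub>m j"]
      unfolding carrier_matD(2)[OF pow_carrier_mat[OF Nc]] .
    \<comment> \<open>At the exponent \<open>k\<close> the kernel is the whole space, so the blocks
      with eigenvalue 1 already have total size \<open>N\<close>; the others have total size 0, yet
      every block size is positive.\<close>
    have all1: "[(n, e)\<leftarrow>n_as. e = 1] = n_as"
    proof -
      have "mrank ((h - 1\<^sub>m N) ^\<^sub>m k) = 0" unfolding nil by (simp add: mrank_eq_0_iff)
      then have "sum_list (map fst n_as) = (\<Sum>n\<leftarrow>map fst [(n, e)\<leftarrow>n_as. e = 1]. min k n)"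
        using ker[of k] N by simp
      moreover have "(\<Sum>n\<leftarrow>map fst [(n, e)\<leftarrow>n_as. e = 1]. min k n) \<le> sum_list (map fst [(n, e)\<leftarrow>n_as. e = 1])"
        by (induction n_as) auto
      moreover have "sum_list (map fst xs) = sum_list (map fst [(n, e)\<leftarrow>xs. e = 1]) + sum_list (map fst [(n, e)\<leftarrow>xs. e \<noteq> 1])"
        for xs :: "(nat \<times> 'a) list" by (induction xs) auto
      ultimately have "sum_list (map fst [(n, e)\<leftarrow>n_as. e \<noteq> 1]) = 0" by (metis add_le_same_cancel1 le_zero_eq)
      then have "\<forall>x\<in>set [(n, e)\<leftarrow>n_as. e \<noteq> 1]. fst x = 0" by simp
      then have "\<forall>x\<in>set n_as. snd x = 1" using pos by fastforce
      then show ?thesis by (intro filter_True) auto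
    qed
    have "N - mrank ((h - 1\<^sub>m N) ^\<^sub>m i) = (\<Sum>n\<leftarrow>map fst n_as. min i n)"
      using ker[of i] unfolding all1 .
    moreover have "(\<Sum>n\<leftarrow>map fst n_as. min i n) + (\<Sum>n\<leftarrow>map fst n_as. n - i) = sum_list (map fst n_as)"
      by (induction n_as) auto
    ultimately show ?thesis
      using le[of i] N unfolding rank_sequence_mset by linarith
  qed
  show ?thesis
  proof
    assume "unipotent_mat h \<and> has_jordan_block_sizes h mu"
    then obtain k n_as where "(h - 1\<^sub>m N) ^\<^sub>m k = 0\<^sub>m N N" "jordan_nf h n_as" "mset (map fst n_as) = mu"
      unfolding unip has_jordan_block_sizes_def by blast
    then show "\<forall>i. mrank ((h - 1\<^sub>m N) ^\<^sub>m i) = rank_sequence mu i"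
      using ranks by blast
  next
    assume r: "\<forall>i. mrank ((h - 1\<^sub>m N) ^\<^sub>m i) = rank_sequence mu i"
    have "rank_sequence mu N = 0" using mu by (simp add: is_partition_of_def rank_sequence_large)
    then have nil: "(h - 1\<^sub>m N) ^\<^sub>m N = 0\<^sub>m N N"
      using r mrank_eq_0_iff[of "(h - 1\<^sub>m N) ^\<^sub>m N"] Nc by simp
    obtain n_as where jnf: "jordan_nf h n_as" using nilpotent_jordan_nf_exists[OF h nil] by blast
    have "rank_sequence (mset (map fst n_as)) = rank_sequence mu"
      using ranks[OF jnf nil] r by auto
    moreover have "0 \<notin># mset (map fst n_as)" using jnf by (auto simp: jordan_nf_def image_iff)
    ultimately have "mset (map fst n_as) = mu"
      using mu by (intro rank_sequence_inject) (auto simp: is_partition_of_def)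
    then show "unipotent_mat h \<and> has_jordan_block_sizes h mu"
      unfolding unip has_jordan_block_sizes_def using nil jnf by blast
  qed
qed

subsection \<open>Removing the first two columns of a partition\<close>

definition drop_two :: "nat multiset \<Rightarrow> nat multiset" where
  "drop_two mu = filter_mset (\<lambda>x. 0 < x) (image_mset (\<lambda>x. x - 2) mu)"

lemma zero_notin_drop_two: "0 \<notin># drop_two mu"
  by (simp add: drop_two_def)

text \<open>The multiplicities and column lengths of \<open>drop_two mu\<close> follow from this
  shift, being differences of the rank sequence.\<close>

lemma rank_sequence_drop_two: "rank_sequence (drop_two mu) i = rank_sequence mu (Suc (Suc i))"
  by (induction mu) (auto simp: drop_two_def rank_sequence_def)

lemma sum_mset_drop_two: "sum_mset (drop_two mu) = rank_sequence mu 2"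
  using rank_sequence_drop_two[of mu 0] by (simp add: rank_sequence_0 numeral_2_eq_2)

lemma count_drop_two: "count (drop_two mu) (Suc i) = count mu (Suc (Suc (Suc i)))"
  using rank_sequence_second_difference[of "drop_two mu" i]
    rank_sequence_second_difference[of mu "Suc (Suc i)"]
  by (simp add: rank_sequence_drop_two)

lemma conj_part_eq_size: "conj_part mu i = size (filter_mset (\<lambda>j. i \<le> j) mu)"
proof -
  have "set_mset (filter_mset (\<lambda>j. i \<le> j) mu) = {j. j \<in># mu \<and> i \<le> j}" by auto
  then show ?thesis
    unfolding conj_part_def size_multiset_overloaded_eq by (intro sum.cong) auto
qed

lemma conj_part_rank_sequence: "conj_part mu (Suc i) + rank_sequence mu (Suc i) = rank_sequence mu i"
  unfolding conj_part_eq_size rank_sequence_def by (induction mu) auto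

lemma conj_part_drop_two: "conj_part (drop_two mu) (Suc i) = conj_part mu (Suc (Suc (Suc i)))"
  using conj_part_rank_sequence[of "drop_two mu" i] conj_part_rank_sequence[of mu "Suc (Suc i)"]
  by (simp add: rank_sequence_drop_two)

lemma rank_sequence_Suc_le: "rank_sequence mu (Suc i) \<le> rank_sequence mu i"
  using conj_part_rank_sequence[of mu i] by simp

text \<open>Enlarging the summation range lets a partition and its reduction be summed over matching
  ranges.\<close>

lemma partition_n_eq:
  assumes "sum_mset mu \<le> S"
  shows "partition_n mu = (\<Sum>i<S. conj_part mu (Suc i) choose 2)"
proof -
  have z: "conj_part mu (Suc i) = 0" if "sum_mset mu \<le> i" for i
    using conj_part_rank_sequence[of mu i] rank_sequence_large[OF that] by simp
  have "partition_n mu = (\<Sum>i<sum_mset mu. conj_part mu (Suc i) choose 2)"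
    unfolding partition_n_def
    by (rule sum.reindex_bij_witness[of _ Suc "\<lambda>i. i - 1"]) auto
  also have "\<dots> = (\<Sum>i<S. conj_part mu (Suc i) choose 2)"
    using assms by (intro sum.mono_neutral_left) (auto simp: z)
  finally show ?thesis .
qed

lemma partition_n_drop_two:
  "partition_n mu = (conj_part mu 1 choose 2) + (conj_part mu 2 choose 2) + partition_n (drop_two mu)"
proof -
  have "sum_mset (drop_two mu) \<le> sum_mset mu"
    using rank_sequence_Suc_le[of mu 0] rank_sequence_Suc_le[of mu 1]
    by (simp add: sum_mset_drop_two rank_sequence_0 numeral_2_eq_2)
  then have "partition_n (drop_two mu) = (\<Sum>i<sum_mset mu. conj_part mu (Suc (Suc (Suc i))) choose 2)"
    by (subst partition_n_eq[of _ "sum_mset mu"]) (simp_all add: conj_part_drop_two)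
  moreover have "partition_n mu = (\<Sum>i<Suc (Suc (sum_mset mu)). conj_part mu (Suc i) choose 2)"
    by (rule partition_n_eq) simp
  ultimately show ?thesis
    unfolding sum.lessThan_Suc_shift by (simp add: numeral_2_eq_2)
qed

lemma num_odd_parts_drop_two: "num_odd_parts mu = count mu 1 + num_odd_parts (drop_two mu)"
proof (induction mu)
  case (add x mu)
  have "num_odd_parts (drop_two (add_mset x mu)) =
      (if odd x \<and> x \<noteq> 1 then 1 else 0) + num_odd_parts (drop_two mu)"
  proof -
    have "odd (x - 2) \<longleftrightarrow> odd x \<and> x \<noteq> 1" by (cases "x < 2") (auto simp: less_2_cases_iff)
    moreover have "odd (x - 2) \<Longrightarrow> 0 < x - 2" by (rule odd_pos)
    ultimately show ?thesis by (auto simp: num_odd_parts_def drop_two_def)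
  qed
  moreover have "num_odd_parts (add_mset x mu) = (if odd x then 1 else 0) + num_odd_parts mu"
    by (simp add: num_odd_parts_def)
  ultimately show ?case using add by auto
qed (simp add: num_odd_parts_def drop_two_def)

lemma prod_counts_eq:
  fixes f :: "nat \<Rightarrow> real"
  assumes "sum_mset mu \<le> S" "0 \<notin># mu" "f 0 = 1"
  shows "(\<Prod>i\<in>set_mset mu. f (count mu i)) = (\<Prod>i<S. f (count mu (Suc i)))"
proof -
  have le: "i \<le> sum_mset mu" if i: "i \<in># mu" for i
  proof -
    obtain nu where "mu = add_mset i nu" using multi_member_split[OF i] by blast
    then show ?thesis by simp
  qed
  have "(\<Prod>i<S. f (count mu (Suc i))) = (\<Prod>i\<in>{1..S}. f (count mu i))"
    by (rule prod.reindex_bij_witness[of _ "\<lambda>i. i - 1" Suc]) auto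
  also have "\<dots> = (\<Prod>i\<in>set_mset mu. f (count mu i))"
  proof (rule prod.mono_neutral_right)
    show "set_mset mu \<subseteq> {1..S}"
    proof
      fix i assume i: "i \<in># mu"
      then have "i \<noteq> 0" using assms(2) by metis
      then show "i \<in> {1..S}" using le[OF i] assms(1) by simp
    qed
  qed (use assms(3) in \<open>auto simp: not_in_iff\<close>)
  finally show ?thesis by simp
qed

lemma prod_counts_drop_two:
  fixes f :: "nat \<Rightarrow> real"
  assumes "0 \<notin># mu" "f 0 = 1"
  shows "(\<Prod>i\<in>set_mset mu. f (count mu i)) =
    f (count mu 1) * f (count mu 2) * (\<Prod>i\<in>set_mset (drop_two mu). f (count (drop_two mu) i))"
proof -
  have "sum_mset (drop_two mu) \<le> sum_mset mu"
    using rank_sequence_Suc_le[of mu 0] rank_sequence_Suc_le[of mu 1]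
    by (simp add: sum_mset_drop_two rank_sequence_0 numeral_2_eq_2)
  then have "(\<Prod>i\<in>set_mset (drop_two mu). f (count (drop_two mu) i)) = (\<Prod>i<sum_mset mu. f (count mu (Suc (Suc (Suc i)))))"
    using assms(2) zero_notin_drop_two by (subst prod_counts_eq[of _ "sum_mset mu"]) (simp_all add: count_drop_two)
  moreover have "(\<Prod>i\<in>set_mset mu. f (count mu i)) = (\<Prod>i<Suc (Suc (sum_mset mu)). f (count mu (Suc i)))"
    using assms by (intro prod_counts_eq) auto
  ultimately show ?thesis
    unfolding prod.lessThan_Suc_shift by (simp add: numeral_2_eq_2 mult.assoc)
qed

text \<open>Odd parts from 3 on stay odd and positive when reduced by 2, so the present round tests
  only the multiplicity of 1.\<close>

lemma odd_counts_drop_two: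
  "(\<forall>i. odd i \<longrightarrow> even (count mu i)) \<longleftrightarrow>
    even (count mu 1) \<and> (\<forall>i. odd i \<longrightarrow> even (count (drop_two mu) i))" (is "?L \<longleftrightarrow> ?R")
proof
  assume L: ?L
  have "even (count (drop_two mu) i)" if i: "odd i" for i
  proof -
    obtain j where "i = Suc j" using i by (cases i) auto
    then show ?thesis using L i by (simp add: count_drop_two)
  qed
  then show ?R using L by simp
next
  assume R: ?R
  show ?L
  proof (intro allI impI)
    fix i :: nat assume i: "odd i"
    show "even (count mu i)"
    proof (cases "i = 1")
      case False
      then obtain j where j: "i = Suc (Suc (Suc j))" using i
        by (metis One_nat_def even_Suc even_zero not0_implies_Suc)
      then have "odd (Suc j)" using i by simp
      then show ?thesis using R count_drop_two[of mu j] j by metis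
    qed (use R in simp)
  qed
qed

subsection \<open>The main recursion\<close>

text \<open>For a partition of \<open>2n\<close> this is the denominator in the theorem. Writing
  \<open>n\<close> as half of \<open>sum_mset mu\<close> makes it a function of the partition alone,
  and \<open>powr\<close> accommodates the halves before parity is known.\<close>

definition type_denom :: "real \<Rightarrow> nat multiset \<Rightarrow> real" where
  "type_denom q mu =
     q powr (real (partition_n mu) + real (sum_mset mu) / 2 + real (num_odd_parts mu) / 2) *
     (\<Prod>i\<in>set_mset mu. qfac ((1 / q)\<^sup>2) (count mu i div 2))"

text \<open>The first two columns have lengths \<open>2a + r\<close> and \<open>r\<close>. The
  integral exponent is the sum of their binomials, of \<open>n - m = r + a\<close>, and of
  \<open>a\<close> from the \<open>2a\<close> parts equal to 1.\<close>

lemma type_denom_drop_two: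
  assumes q: "1 < q" and mu: "0 \<notin># mu" "sum_mset mu = 2 * n"
    and m: "rank_sequence mu 2 = 2 * m" and a: "count mu 1 = 2 * a" and r: "conj_part mu 2 = r"
  shows "type_denom q mu = type_denom q (drop_two mu) * q ^ (2 * a * a + 2 * a * r + r * r + a) *
      qfac ((1 / q)\<^sup>2) a * qfac ((1 / q)\<^sup>2) (count mu 2 div 2)"
    and "n = m + r + a" and "rank_sequence mu 1 = 2 * m + r"
proof -
  show k: "rank_sequence mu 1 = 2 * m + r"
    using conj_part_rank_sequence[of mu 1] m r by (simp add: numeral_2_eq_2)
  then have n2: "2 * n + 2 * m = 2 * (2 * m + r) + 2 * a"
    using rank_sequence_second_difference[of mu 0] mu(2) m a
    by (simp add: rank_sequence_0 numeral_2_eq_2)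
  then show n: "n = m + r + a" by simp
  have c1: "conj_part mu 1 = 2 * a + r"
    using conj_part_rank_sequence[of mu 0] k n mu(2) by (simp add: rank_sequence_0)
  let ?D = "2 * a * a + 2 * a * r + r * r + a"
  have choose: "real (x choose 2) = real x * (real x - 1) / 2" for x
  proof -
    have "even (x * (x - 1))" by (cases x) simp_all
    then have "2 * (x choose 2) = x * (x - 1)" by (simp add: choose_two)
    then have "2 * real (x choose 2) = real x * real (x - 1)" by (metis of_nat_mult of_nat_numeral)
    then show ?thesis by (cases x) simp_all
  qed
  have "real (partition_n mu) = real ((2 * a + r) choose 2) + real (r choose 2) + real (partition_n (drop_two mu))"
    using partition_n_drop_two[of mu] c1 r by simp
  then have "real (partition_n mu) + real (sum_mset mu) / 2 + real (num_odd_parts mu) / 2 =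
      (real (partition_n (drop_two mu)) + real (sum_mset (drop_two mu)) / 2 +
       real (num_odd_parts (drop_two mu)) / 2) + real ?D"
    unfolding choose using num_odd_parts_drop_two[of mu] a m mu(2) n
    by (simp add: sum_mset_drop_two field_simps)
  then have "q powr (real (partition_n mu) + real (sum_mset mu) / 2 + real (num_odd_parts mu) / 2) =
      q powr (real (partition_n (drop_two mu)) + real (sum_mset (drop_two mu)) / 2 +
       real (num_odd_parts (drop_two mu)) / 2) * q ^ ?D"
    using q by (simp only: powr_add powr_realpow)
  moreover have "(\<Prod>i\<in>set_mset mu. qfac ((1 / q)\<^sup>2) (count mu i div 2)) =
      qfac ((1 / q)\<^sup>2) a * qfac ((1 / q)\<^sup>2) (count mu 2 div 2) *
      (\<Prod>i\<in>set_mset (drop_two mu). qfac ((1 / q)\<^sup>2) (count (drop_two mu) i div 2))"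
    using prod_counts_drop_two[OF mu(1), of "\<lambda>c. qfac ((1 / q)\<^sup>2) (c div 2)"] a by simp
  ultimately show "type_denom q mu = type_denom q (drop_two mu) * q ^ ?D *
      qfac ((1 / q)\<^sup>2) a * qfac ((1 / q)\<^sup>2) (count mu 2 div 2)"
    unfolding type_denom_def by (simp only: mult_ac)
qed

lemma prod_qfac_square:
  assumes "0 < t" "t < 1"
  shows "(\<Prod>j<m. 1 - t ^ (2 * (m + a - j))) = qfac (t\<^sup>2) (m + a) / qfac (t\<^sup>2) a"
proof (induction m)
  case 0
  show ?case using qfac_square_pos[OF assms, of a] by simp
next
  case (Suc m)
  have "(\<Prod>j<Suc m. 1 - t ^ (2 * (Suc m + a - j))) =
      (1 - t ^ (2 * Suc (m + a))) * (\<Prod>j<m. 1 - t ^ (2 * (m + a - j)))"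
    unfolding prod.lessThan_Suc_shift by simp
  also have "t ^ (2 * Suc (m + a)) = (t\<^sup>2) ^ Suc (m + a)" by (simp only: power_mult)
  finally show ?case using Suc by (simp add: qfac_Suc)
qed

text \<open>On the left stand the number of \<open>W\<close> with Gram rank \<open>2m\<close>, the
  order of the smaller symplectic group, and the number of borderings that end nonsingular. On the
  right stand the order of the larger group over the new denominator factors, times the order of the
  general linear group. The symbols of \<open>r\<close> and \<open>m\<close> cancel.\<close>

lemma recursion_identity:
  fixes n m r a k c :: nat
  assumes q: "1 < q" and n: "n = m + r + a" and k: "k = 2 * m + r" and c: "c \<le> r"
  defines "t \<equiv> 1 / q"
  shows "q ^ (2 * n * k) * gram_prob t n k m *
      (q ^ (m * (2 * m + 1)) * qfac (t\<^sup>2) m * q ^ (r * (2 * m) + \<Sum>{..r}) * ext_prob t r c) =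
    q ^ (n * (2 * n + 1)) * qfac (t\<^sup>2) n /
      (q ^ (2 * a * a + 2 * a * r + r * r + a) * qfac (t\<^sup>2) a * qfac (t\<^sup>2) ((r - c) div 2)) *
      (q ^ (k * k) * qfac t k)"
proof -
  have t: "0 < t" "t < 1" using q by (auto simp: t_def)
  have nz: "qfac t x \<noteq> 0" "qfac (t\<^sup>2) x \<noteq> 0" for x
    using qfac_pos[OF t, of x] qfac_square_pos[OF t, of x] by auto
  have km: "k - m = m + r" "k - 2 * m = r" "2 * m \<le> k" using k by auto
  have g: "gram_prob t n k m = t ^ (\<Sum>{..<r}) * (qfac (t\<^sup>2) n / qfac (t\<^sup>2) a) * qfac t k / (qfac t r * qfac (t\<^sup>2) m)"
    unfolding gram_prob_def km using km(3) prod_qfac_square[OF t, of "m + r" a] n by simp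
  have x: "ext_prob t r c = qfac t r / qfac (t\<^sup>2) ((r - c) div 2)"
    using c by (simp add: ext_prob_def)
  let ?D = "2 * a * a + 2 * a * r + r * r + a"
  have S: "{..r} = insert r {..<r}" by auto
  \<comment> \<open>The sum over \<open>{..r}\<close> comes from the borderings and the one over
    \<open>{..<r}\<close> from the Gram ranks; they differ by \<open>r\<close>.\<close>
  have qt: "q ^ (\<Sum>{..r}) * t ^ (\<Sum>{..<r}) = q ^ r"
    unfolding S using q by (simp add: t_def power_add power_divide)
  have exps: "2 * n * k + m * (2 * m + 1) + r * (2 * m) + r + ?D = n * (2 * n + 1) + k * k"
    unfolding n k by (simp add: algebra_simps)
  have q_eq: "q ^ (2 * n * k) * q ^ (m * (2 * m + 1)) * q ^ (r * (2 * m)) * q ^ r * q ^ ?D = q ^ (n * (2 * n + 1)) * q ^ (k * k)"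
    unfolding power_add[symmetric] exps ..
  have "q ^ (2 * n * k) * gram_prob t n k m *
      (q ^ (m * (2 * m + 1)) * qfac (t\<^sup>2) m * q ^ (r * (2 * m) + \<Sum>{..r}) * ext_prob t r c) =
      q ^ (2 * n * k) * q ^ (m * (2 * m + 1)) * q ^ (r * (2 * m)) * (q ^ (\<Sum>{..r}) * t ^ (\<Sum>{..<r})) *
      (qfac (t\<^sup>2) n * qfac t k / (qfac (t\<^sup>2) a * qfac (t\<^sup>2) ((r - c) div 2)))"
  proof -
    have gen: "A * (T * (En / Ea) * Qk / (Qr * Em)) * (B * Em * (C * S) * (Qr / Eb)) =
        A * B * C * (S * T) * (En * Qk / (Ea * Eb))"
      if "Em \<noteq> 0" "Qr \<noteq> 0" for A B C S T En Ea Qk Qr Em Eb :: real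
      using that by simp
    show ?thesis
      unfolding g x power_add[of q "r * (2 * m)"] by (rule gen[OF nz(2) nz(1)])
  qed
  also have "\<dots> = (q ^ (2 * n * k) * q ^ (m * (2 * m + 1)) * q ^ (r * (2 * m)) * q ^ r * q ^ ?D) / q ^ ?D *
      (qfac (t\<^sup>2) n * qfac t k / (qfac (t\<^sup>2) a * qfac (t\<^sup>2) ((r - c) div 2)))"
    unfolding qt using q by simp
  also have "\<dots> = q ^ (n * (2 * n + 1)) * qfac (t\<^sup>2) n /
      (q ^ ?D * qfac (t\<^sup>2) a * qfac (t\<^sup>2) ((r - c) div 2)) * (q ^ (k * k) * qfac t k)"
    unfolding q_eq by (simp add: mult_ac)
  finally show ?thesis .
qed

text \<open>The numerator is the order of the symplectic group, so each round compares only
  denominators. The induction ranges over all \<open>J\<close>, because the reduced form is known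
  only to be nondegenerate and alternating.\<close>

lemma card_wall_type:
  fixes J :: "'a :: {field, finite} mat"
  assumes "alternating_mat J" "inj_mat J" "dim_row J = 2 * n" "is_partition_of mu (2 * n)"
  defines "q \<equiv> real CARD('a)"
  shows "real (card (wall_type J (rank_sequence mu))) =
    (if \<forall>i. odd i \<longrightarrow> even (count mu i)
     then q ^ (n * (2 * n + 1)) * qfac ((1 / q)\<^sup>2) n / type_denom q mu else 0)"
  using assms(1-4)
proof (induction n arbitrary: mu J rule: less_induct)
  case (less n)
  have q: "1 < q" using one_less_card_field[where 'a = 'a] by (simp add: q_def)
  let ?\<rho> = "rank_sequence mu" and ?t = "1 / q"
  have mu: "0 \<notin># mu" "sum_mset mu = 2 * n" using less.prems(4) by (auto simp: is_partition_of_def)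
  have Jc: "J \<in> carrier_mat (2 * n) (2 * n)"
    using alternating_mat_square[OF less.prems(1)] less.prems(3) by simp
  show ?case
  proof (cases "n = 0")
    case True
    then have "mu = {#}" using mu by (metis mult_0_right multiset_nonemptyE sum_mset_0_iff)
    have unique: "Y = J" if "Y \<in> carrier_mat 0 0" for Y
      using that Jc True by (intro eq_matI) auto
    have rk0: "mrank A = 0" if "A \<in> carrier_mat 0 0" for A :: "'a mat"
      using mrank_le_dim_col[of A] that by simp
    have J0: "J \<in> carrier_mat 0 0" using Jc True by simp
    have "J \<in> wall_type J ?\<rho>"
    proof -
      have "J * (J * J) ^\<^sub>m i \<in> carrier_mat 0 0" for i using J0 by auto
      moreover have "J - J\<^sup>T = J * J * J\<^sup>T" using J0 by (intro eq_matI) auto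
      ultimately show ?thesis
        using J0 \<open>mu = {#}\<close> rk0 by (simp add: wall_type_def wall_forms_def rank_sequence_def)
    qed
    moreover have "wall_type J ?\<rho> \<subseteq> carrier_mat 0 0"
      using less.prems(3) True by (auto simp: wall_type_def wall_forms_def)
    ultimately have "wall_type J ?\<rho> = {J}" using unique by blast
    then show ?thesis
      using True q \<open>mu = {#}\<close> by (simp add: type_denom_def partition_n_def num_odd_parts_def)
  next
    case False
    define k e r where "k = ?\<rho> 1" and "e = ?\<rho> 2" and "r = conj_part mu 2"
    have ke: "k = r + e" using conj_part_rank_sequence[of mu 1] by (simp add: k_def e_def r_def numeral_2_eq_2)
    have diff0: "2 * n + e = 2 * k + count mu 1"
      using rank_sequence_second_difference[of mu 0] mu(2) by (simp add: rank_sequence_0 k_def e_def numeral_2_eq_2)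
    have diff1: "k + ?\<rho> 3 = 2 * e + count mu 2"
      using rank_sequence_second_difference[of mu 1] by (simp add: k_def e_def numeral_2_eq_2 numeral_3_eq_3)
    have r3: "?\<rho> 3 \<le> e" using rank_sequence_Suc_le[of mu 2] by (simp add: e_def numeral_3_eq_3 numeral_2_eq_2)
    \<comment> \<open>The smaller form has size \<open>e\<close>; a nonempty partition has a
      nonempty first column, so the induction descends.\<close>
    have elt: "e < 2 * n"
    proof -
      have "conj_part mu 1 \<noteq> 0"
      proof
        assume "conj_part mu 1 = 0"
        then have "filter_mset (\<lambda>j. 1 \<le> j) mu = {#}" by (simp add: conj_part_eq_size)
        moreover have "j \<in># filter_mset (\<lambda>j. 1 \<le> j) mu" if "j \<in># mu" "j \<noteq> 0" for j
          using that by simp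
        ultimately have "\<forall>j\<in>#mu. j = 0" by auto
        then show False using mu False by (metis mult_is_0 sum_mset_0_iff zero_neq_numeral)
      qed
      then have "?\<rho> 1 < ?\<rho> 0" using conj_part_rank_sequence[of mu 0] by simp
      then show ?thesis using ke mu(2) by (simp add: rank_sequence_0 k_def)
    qed
    have GLpos: "real (card (inj_mats k k :: 'a mat set)) = q ^ (k * k) * qfac ?t k"
      "q ^ (k * k) * qfac ?t k > 0"
      using card_inj_mats_square[of k, where 'a = 'a] qfac_pos[of ?t k] q by (auto simp: q_def)
    let ?\<tau> = "rank_sequence (drop_two mu)"
    let ?N = "\<lambda>W. card {Y \<in> wall_type (W\<^sup>T * J * W) ?\<tau>. inj_mat Y}"
    have \<tau>: "?\<tau> = (\<lambda>i. ?\<rho> (Suc (Suc i)))" by (simp add: fun_eq_iff rank_sequence_drop_two)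
    have \<tau>1: "?\<tau> 1 = ?\<rho> 3" by (simp add: \<tau> numeral_3_eq_3)
    have main: "real (card (wall_type J ?\<rho>)) * (q ^ (k * k) * qfac ?t k) = (\<Sum>W\<in>inj_mats (2 * n) k. real (?N W))"
      using card_wall_type_mult_GL[OF less.prems(1-3), of ?\<rho> k] mu(2)
      unfolding GLpos(1)[symmetric] \<tau> by (simp add: rank_sequence_0 k_def flip: of_nat_mult of_nat_sum)
    have gram_dim: "dim_row (W\<^sup>T * J * W) = k" "alternating_mat (W\<^sup>T * J * W)"
      if "W \<in> inj_mats (2 * n) k" for W
      using that less.prems(1,3) by (auto simp: inj_mats_def intro!: alternating_mat_congruence)
    \<comment> \<open>At index 0 the type prescribes the rank of the Gram matrix itself, so only
      Gram rank \<open>e\<close> contributes.\<close>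
    have N0: "?N W = 0" if "W \<in> inj_mats (2 * n) k" "mrank (W\<^sup>T * J * W) \<noteq> e" for W
    proof -
      let ?C = "W\<^sup>T * J * W"
      have C: "?C \<in> carrier_mat k k"
        using alternating_mat_square[OF gram_dim(2)[OF that(1)]] gram_dim(1)[OF that(1)] by simp
      have "Y \<notin> wall_type ?C ?\<tau>" for Y
      proof
        assume "Y \<in> wall_type ?C ?\<tau>"
        then have Yf: "Y \<in> wall_forms ?C" and ranks: "\<forall>i. mrank (?C * (Y * ?C) ^\<^sub>m i) = ?\<tau> i"
          unfolding wall_type_def by blast+
        have "Y \<in> carrier_mat k k"
          using Yf gram_dim(1)[OF that(1)] unfolding wall_forms_def by simp
        with spec[OF ranks, of 0] have "mrank ?C = ?\<tau> 0" using C by (simp add: right_mult_one_mat[of _ k k])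
        then show False using that(2) by (simp add: \<tau> e_def numeral_2_eq_2)
      qed
      then have empty: "{Y \<in> wall_type ?C ?\<tau>. inj_mat Y} = {}" by blast
      show ?thesis unfolding empty by simp
    qed
    show ?thesis
    proof (cases "even e")
      case False
      have "{W \<in> inj_mats (2 * n) k. mrank (W\<^sup>T * J * W) = e} = {}"
      proof -
        have "finite {W \<in> inj_mats (2 * n) k. mrank (W\<^sup>T * J * W) = e}" by simp
        then show ?thesis
          using gram_count_odd[OF less.prems(1,2) False, of k] less.prems(3) unfolding gram_count_def by simp
      qed
      then have "(\<Sum>W\<in>inj_mats (2 * n) k. real (?N W)) = 0"
        using N0 by (intro sum.neutral) auto
      then have "real (card (wall_type J ?\<rho>)) * (q ^ (k * k) * qfac ?t k) = 0" by (simp only: main)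
      then have "card (wall_type J ?\<rho>) = 0"
        using GLpos(2) by (metis less_irrefl mult_eq_0_iff of_nat_eq_0_iff)
      \<comment> \<open>For odd \<open>e\<close> the relation \<open>2n + e = 2k + m_1\<close> makes
        the multiplicity of 1 odd, so the claimed value is zero as well.\<close>
      moreover have "odd (count mu 1)" using diff0 False by presburger
      then have "\<not> (\<forall>i. odd i \<longrightarrow> even (count mu i))" by (metis odd_one)
      ultimately show ?thesis by (simp only: if_False of_nat_0)
    next
      case True
      then obtain m where m: "e = 2 * m" by blast
      have "even (count mu 1)" using diff0 m by presburger
      then obtain a where a: "count mu 1 = 2 * a" by blast
      have cond: "(\<forall>i. odd i \<longrightarrow> even (count mu i)) \<longleftrightarrow> (\<forall>i. odd i \<longrightarrow> even (count (drop_two mu) i))"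
        unfolding odd_counts_drop_two[of mu] using a by simp
      have part: "is_partition_of (drop_two mu) (2 * m)"
        using m by (simp add: is_partition_of_def zero_notin_drop_two sum_mset_drop_two e_def)
      have mn: "m < n" using elt m by simp
      define A where "A = (if \<forall>i. odd i \<longrightarrow> even (count (drop_two mu) i)
        then q ^ (m * (2 * m + 1)) * qfac (?t\<^sup>2) m / type_denom q (drop_two mu) else 0)"
      define F where "F = q ^ (r * e + \<Sum>{..r}) * ext_prob ?t r (e - ?\<rho> 3)"
      have N1: "real (?N W) = A * F" if W: "W \<in> inj_mats (2 * n) k" "mrank (W\<^sup>T * J * W) = e" for W
      proof -
        have kr: "k - e = r" using ke by simp
        obtain J' :: "'a mat" where J': "alternating_mat J'" "inj_mat J'" "dim_row J' = e"
          "real (?N W) = real (card (wall_type J' ?\<tau>)) * q ^ (r * e + \<Sum>{..r}) * ext_prob ?t r (e - ?\<tau> 1)"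
          using card_inj_wall_type_degenerate[OF gram_dim(2)[OF W(1)] gram_dim(1)[OF W(1)], of ?\<tau>]
          unfolding W(2) kr q_def by blast
        have "real (card (wall_type J' ?\<tau>)) = A"
          unfolding A_def using less.IH[OF mn J'(1,2) _ part] J'(3) m by simp
        then show ?thesis using J'(4) unfolding \<tau>1 F_def by simp
      qed
      have "(\<Sum>W\<in>inj_mats (2 * n) k. real (?N W)) =
          (\<Sum>W\<in>inj_mats (2 * n) k. if mrank (W\<^sup>T * J * W) = e then A * F else 0)"
        using N0 N1 by (intro sum.cong refl) auto
      also have "\<dots> = real (gram_count J k e) * (A * F)"
        unfolding gram_count_def less.prems(3) by (subst sum.If_cases) (auto simp: Int_def)
      also have "real (gram_count J k e) = q ^ (2 * n * k) * gram_prob ?t n k m"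
        unfolding m q_def by (rule gram_count_even[OF less.prems(1-3)])
      finally have eq: "real (card (wall_type J ?\<rho>)) * (q ^ (k * k) * qfac ?t k) =
          q ^ (2 * n * k) * gram_prob ?t n k m * (A * F)"
        using main by simp
      show ?thesis
      proof (cases "\<forall>i. odd i \<longrightarrow> even (count mu i)")
        case False
        then have "A = 0" unfolding A_def cond[symmetric] by (rule if_not_P)
        then have "real (card (wall_type J ?\<rho>)) * (q ^ (k * k) * qfac ?t k) = 0" unfolding eq by simp
        then have "real (card (wall_type J ?\<rho>)) = 0" using GLpos(2) by (metis less_irrefl mult_eq_0_iff)
        then show ?thesis using False by (simp only: if_False)
      next
        case c: True
        let ?E = "qfac (?t\<^sup>2)" and ?w = "type_denom q (drop_two mu)"
        note denom = type_denom_drop_two[OF q mu, of m a r, OF _ a r_def[symmetric]]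
        have dd: "type_denom q mu = ?w * q ^ (2 * a * a + 2 * a * r + r * r + a) * ?E a * ?E (count mu 2 div 2)"
          and n: "n = m + r + a"
          using denom m by (auto simp: e_def)
        \<comment> \<open>The starting corank is \<open>e - \<rho> 3\<close> with
          \<open>\<rho>\<close> the rank sequence of \<open>mu\<close>; its distance from
          \<open>r\<close> is the multiplicity of 2, which is how that factor of the denominator
          arises.\<close>
        have c2: "r - (e - ?\<rho> 3) = count mu 2" "e - ?\<rho> 3 \<le> r" using diff1 ke r3 by auto
        have A: "A = q ^ (m * (2 * m + 1)) * ?E m / ?w" unfolding A_def cond[symmetric] using c by simp
        have "real (card (wall_type J ?\<rho>)) * (q ^ (k * k) * qfac ?t k) =
            (q ^ (2 * n * k) * gram_prob ?t n k m *
            (q ^ (m * (2 * m + 1)) * ?E m * q ^ (r * (2 * m) + \<Sum>{..r}) * ext_prob ?t r (e - ?\<rho> 3))) / ?w"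
          unfolding eq A F_def by (simp add: m)
        also have "\<dots> = (q ^ (n * (2 * n + 1)) * ?E n /
            (q ^ (2 * a * a + 2 * a * r + r * r + a) * ?E a * ?E (count mu 2 div 2)) *
            (q ^ (k * k) * qfac ?t k)) / ?w"
          using recursion_identity[OF q n _ c2(2), of k] ke m unfolding c2(1) by simp
        also have "\<dots> = q ^ (n * (2 * n + 1)) * ?E n / type_denom q mu * (q ^ (k * k) * qfac ?t k)"
          unfolding dd by (simp add: mult_ac)
        finally have "real (card (wall_type J ?\<rho>)) = q ^ (n * (2 * n + 1)) * ?E n / type_denom q mu"
          using GLpos(2) by (metis less_irrefl mult_right_cancel)
        then show ?thesis unfolding if_P[OF c] .
      qed
    qed
  qed
qed

theorem theorem5p2:
  fixes n q :: nat and mu :: "nat multiset" and Sp :: "'a :: {field, finite} mat set"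
  assumes q: "q = CARD('a)"
    and Sp: "Sp = symplectic_group n"
    and mu: "is_partition_of mu (2 * n)"
  shows "real (card {h \<in> Sp. unipotent_mat h \<and> has_jordan_block_sizes h mu}) / real (card Sp) =
    (if \<forall>i. odd i \<longrightarrow> even (count mu i)
     then 1 / (real q powr (real (partition_n mu) + real n + real (num_odd_parts mu) / 2) *
               (\<Prod>i\<in>set_mset mu. \<Prod>k = 1..count mu i div 2. 1 - 1 / real q ^ (2 * k)))
     else 0)"
proof -
  have q1: "1 < real q" using one_less_card_field[where 'a = 'a] by (simp add: q)
  let ?J = "symplectic_form_mat n :: 'a mat" and ?t = "1 / real q"
  have "{h \<in> Sp. unipotent_mat h \<and> has_jordan_block_sizes h mu} =
      {h \<in> symplectic_group n. \<forall>i. mrank ((h - 1\<^sub>m (2 * n)) ^\<^sub>m i) = rank_sequence mu i}"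
    using unipotent_jordan_type_iff[OF _ mu] by (auto simp: Sp symplectic_group_def)
  then have "real (card {h \<in> Sp. unipotent_mat h \<and> has_jordan_block_sizes h mu}) =
      real (card (wall_type ?J (rank_sequence mu)))"
    by (simp add: card_symplectic_rank_type)
  also have "\<dots> = (if \<forall>i. odd i \<longrightarrow> even (count mu i)
     then real (card Sp) / type_denom (real q) mu else 0)"
    unfolding Sp card_symplectic_group q
    by (rule card_wall_type) (simp_all add: alternating_symplectic_form inj_symplectic_form mu)
  finally have count: "real (card {h \<in> Sp. unipotent_mat h \<and> has_jordan_block_sizes h mu}) =
      (if \<forall>i. odd i \<longrightarrow> even (count mu i) then real (card Sp) / type_denom (real q) mu else 0)" .
  have "qfac (?t\<^sup>2) c = (\<Prod>k = 1..c. 1 - 1 / real q ^ (2 * k))" for c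
    unfolding qfac_def by (intro prod.cong refl) (simp add: power_divide flip: power_mult)
  then have "type_denom (real q) mu =
      real q powr (real (partition_n mu) + real n + real (num_odd_parts mu) / 2) *
      (\<Prod>i\<in>set_mset mu. \<Prod>k = 1..count mu i div 2. 1 - 1 / real q ^ (2 * k))"
    using mu by (simp add: type_denom_def is_partition_of_def)
  moreover have "real (card Sp) \<noteq> 0"
    using q1 qfac_square_pos[of ?t n] unfolding Sp card_symplectic_group q[symmetric] by simp
  then have "real (card {h \<in> Sp. unipotent_mat h \<and> has_jordan_block_sizes h mu}) / real (card Sp) =
      (if \<forall>i. odd i \<longrightarrow> even (count mu i) then 1 / type_denom (real q) mu else 0)"
    unfolding count by (cases "\<forall>i. odd i \<longrightarrow> even (count mu i)") (simp_all only: if_True if_False, simp_all)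
  ultimately show ?thesis by (simp only:)
qed

end
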